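(* Let $B_1=\prod_{i=1}^{n}(-a_i,a_i)$ and $B_2=\prod_{i=1}^{n}(-b_i,b_i)$ (with $a_i,b_i\in(0,\infty)$) be two boxes in $\mathbb{R}^n$ with $B_1\subseteq B_2$, and let $U\subseteq\mathbb{R}^n$ be an arbitrary domain with $B_1\subseteq U\subseteq B_2$. For constants $C_1>0$, $C_2>1$, consider the conditions $$\text{(i)}\quad \frac{1}{a_i^2}-\frac{1}{b_i^2}\le \frac{C_1}{\max_{j} b_j^2}\ \text{ for all } i;\qquad \text{(ii)}\quad a_i\ge \frac{1}{C_2}b_i\ \text{ for all } i.$$ Fix $C_1>0$. For all $C_2>1$ sufficiently close to $1$ depending only on $C_1$ and $n$, if both (i) and (ii) hold, then $$\varphi_U(x)\asymp\varphi_{B_1}(x)$$ for all $x=(x_1,\dots,x_n)$ with $|x_i|<a_i-(b_i-a_i)$ for all $i$. The implied constants depend only on $n$ and $C_1$.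
   Context: A domain is a nonempty connected open set. For a bounded domain $U\subseteq\mathbb{R}^n$, $\varphi_U>0$ denotes the principal Dirichlet Laplacian eigenfunction of $U$, i.e. the positive eigenfunction of $-\Delta$ with Dirichlet boundary condition on $U$ corresponding to the smallest eigenvalue $\lambda(U)>0$, normalized so that $\|\varphi_U\|_{L^2(U)}=1$ (Lebesgue measure). $A\lesssim B$ means $A\le CB$ for a constant $C>0$ (the implied constant) depending only on the stated parameters; $A\asymp B$ means $A\lesssim B$ and $B\lesssim A$. *)

theory Defs
  imports "HOL-Analysis.Analysis"
begin

definition domain :: "'a::euclidean_space set \<Rightarrow> bool" where
  "domain U \<longleftrightarrow> open U \<and> connected U \<and> U \<noteq> {}"

definition partial_deriv :: "'a::euclidean_space \<Rightarrow> ('a \<Rightarrow> real) \<Rightarrow> 'a \<Rightarrow> real" where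
  "partial_deriv e f x = frechet_derivative f (at x) e"

definition grad :: "('a::euclidean_space \<Rightarrow> real) \<Rightarrow> 'a \<Rightarrow> 'a" where
  "grad f x = (\<Sum>e\<in>Basis. partial_deriv e f x *\<^sub>R e)"

definition laplacian :: "('a::euclidean_space \<Rightarrow> real) \<Rightarrow> 'a \<Rightarrow> real" where
  "laplacian f x = (\<Sum>e\<in>Basis. partial_deriv e (partial_deriv e f) x)"

(* Class C^k on an open set S. The set S has to be open: derivatives are the ones "at x",
   not relative to S. *)
primrec Ck_on :: "nat \<Rightarrow> ('a::euclidean_space \<Rightarrow> real) \<Rightarrow> 'a set \<Rightarrow> bool" where
  "Ck_on 0 f S \<longleftrightarrow> continuous_on S f"
| "Ck_on (Suc k) f S \<longleftrightarrow>
     (\<forall>x\<in>S. f differentiable (at x)) \<and> (\<forall>e\<in>Basis. Ck_on k (partial_deriv e f) S)"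

(* The space of test functions C_c^infinity(U), each extended by zero to the whole space. *)
definition test_functions :: "'a::euclidean_space set \<Rightarrow> ('a \<Rightarrow> real) set" where
  "test_functions U =
     {f. (\<forall>k. Ck_on k f UNIV) \<and> compact (closure {x. f x \<noteq> 0}) \<and> closure {x. f x \<noteq> 0} \<subseteq> U}"

(* u satisfies the Dirichlet boundary condition on the open set U in the usual sense
   that u is in H^1_0(U): it is a limit of test functions in the norm of H^1(U). Only meant for
   u of class C^1 on U, so that the weak gradient of u on U is the classical one; values of u
   outside U are irrelevant. The Lebesgue integrals are taken in [0, infinity], so nothing is
   assumed silently about integrability. *)
definition dirichlet_bc :: "'a::euclidean_space set \<Rightarrow> ('a \<Rightarrow> real) \<Rightarrow> bool" where
  "dirichlet_bc U u \<longleftrightarrow>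
     (\<exists>f :: nat \<Rightarrow> 'a \<Rightarrow> real. (\<forall>k. f k \<in> test_functions U) \<and>
        (\<lambda>k. \<integral>\<^sup>+x\<in>U. ennreal ((f k x - u x)\<^sup>2 + (norm (grad (f k) x - grad u x))\<^sup>2) \<partial>lborel)
          \<longlonglongrightarrow> 0)"

(* Eigenfunctions of minus the Laplacian with Dirichlet boundary condition. By interior
   regularity every (weak) eigenfunction has a unique smooth representative on U, which is the
   one whose pointwise values are meant; hence the equation is stated classically in U. The
   boundary of U is arbitrary, hence the boundary condition is membership in H^1_0(U). *)
definition dirichlet_eigenfunction :: "'a::euclidean_space set \<Rightarrow> real \<Rightarrow> ('a \<Rightarrow> real) \<Rightarrow> bool" where
  "dirichlet_eigenfunction U lam u \<longleftrightarrow>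
     Ck_on 2 u U \<and> dirichlet_bc U u \<and> (\<exists>x\<in>U. u x \<noteq> 0) \<and>
     (\<forall>x\<in>U. - laplacian u x = lam * u x)"

definition dirichlet_eigenvalue :: "'a::euclidean_space set \<Rightarrow> real \<Rightarrow> bool" where
  "dirichlet_eigenvalue U lam \<longleftrightarrow> (\<exists>u. dirichlet_eigenfunction U lam u)"

definition smallest_dirichlet_eigenvalue :: "'a::euclidean_space set \<Rightarrow> real \<Rightarrow> bool" where
  "smallest_dirichlet_eigenvalue U lam \<longleftrightarrow>
     dirichlet_eigenvalue U lam \<and> (\<forall>mu. dirichlet_eigenvalue U mu \<longrightarrow> lam \<le> mu)"

(* u is the function phi_U, which is determined by U (for a bounded domain U) up to its
   irrelevant values outside U. *)
definition principal_eigenfunction :: "'a::euclidean_space set \<Rightarrow> ('a \<Rightarrow> real) \<Rightarrow> bool" where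
  "principal_eigenfunction U u \<longleftrightarrow>
     (\<exists>lam. smallest_dirichlet_eigenvalue U lam \<and> dirichlet_eigenfunction U lam u) \<and>
     (\<forall>x\<in>U. u x > 0) \<and>
     (\<integral>\<^sup>+x\<in>U. ennreal ((u x)\<^sup>2) \<partial>lborel) = 1"

end

theory Submission
  imports Defs
begin

text \<open>For a vector \<open>c\<close> of positive half-sides let
\<open>S\<^sub>c(x) = (\<Prod>i. cos (\<pi> x\<^sub>i / (2 c\<^sub>i)))\<close>, the ground state of the box \<open>B\<^sub>c = (\<Prod>i. (-c\<^sub>i, c\<^sub>i))\<close>,
and let \<open>\<Lambda>\<^sub>c = (\<Sum>i. (\<pi> / (2 c\<^sub>i))\<^sup>2)\<close> be its eigenvalue. Everything rests on a bound that holds for each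
domain \<open>U\<close> with \<open>B\<^sub>a \<subseteq> U \<subseteq> B\<^sub>b\<close>:
\<open>k (\<Prod>i. a\<^sub>i)\<^sup>-\<^sup>1\<^sup>/\<^sup>2 S\<^sub>a \<le> \<phi>\<^sub>U\<close> on \<open>B\<^sub>a\<close> and \<open>\<phi>\<^sub>U \<le> K (\<Prod>i. b\<^sub>i)\<^sup>-\<^sup>1\<^sup>/\<^sup>2 S\<^sub>b\<close> on \<open>U\<close>, with constants depending
only on the dimension and \<open>C1\<close> (lemmas \<open>lower_bound\<close> and \<open>upper_bound\<close>). The smaller box is itself such a
domain, so the bound applies to both eigenfunctions, and \<open>S\<^sub>b \<le> \<pi>\<^sup>n S\<^sub>a\<close> on the region in question: there
\<open>b\<^sub>i - \<bar>x\<^sub>i\<bar> \<le> 2 (a\<^sub>i - \<bar>x\<^sub>i\<bar>)\<close>, and the cosines are comparable to the relative distances to the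
faces (\<open>ground_mode_compare\<close>).

The two-sided bound comes from the heat flow of boxes. Write \<open>u = \<phi>\<^sub>U\<close> and let \<open>lam\<close> be its
eigenvalue. If \<open>q \<ge> 0\<close> solves the heat equation on \<open>B\<^sub>b\<close>, then \<open>exp (lam t) * (\<integral>\<^sub>U u q\<^sub>t)\<close> is nondecreasing
in \<open>t\<close>, because its derivative is \<open>exp (lam t) * (\<integral>\<^sub>U (u \<Delta>q - q \<Delta>u))\<close> and \<open>u\<close> is positive with zero
boundary values, so that only a boundary flux of one sign is left (\<open>green_inequality\<close>). If instead
\<open>q > 0\<close> lives on a closed box inside \<open>U\<close> and vanishes on the faces, \<open>u\<close> and \<open>q\<close> exchange their
roles and the quantity is nonincreasing. The same inequality with the stationary mode gives
\<open>\<Lambda>\<^sub>b \<le> lam \<le> \<Lambda>\<^sub>a\<close>.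

The flows used are products of finite sine sums in one variable, so they are differentiated term by term,
and a one-dimensional maximum principle keeps them positive. At time \<open>T = 5 (max b\<^sub>j)\<^sup>2\<close> every factor is
within a factor 2 of its first mode (\<open>sine_heat_large_time\<close>), uniformly over all aspect ratios of the box.
Hence \<open>\<integral> u q\<^sub>0\<close> is bounded above and below by multiples of \<open>\<integral> S q\<^sub>0\<close>, and initial data that
concentrate at a point turn this into pointwise bounds (\<open>upper_bound_by_mass\<close>, \<open>lower_bound_by_mass\<close>).
The factors \<open>exp ((lam - \<Lambda>) T)\<close> are harmless, since condition (i) bounds \<open>(\<Lambda>\<^sub>a - \<Lambda>\<^sub>b) T\<close>.

The upper bound needs \<open>\<integral>\<^sub>U u \<le> \<bar>B\<^sub>b\<bar>\<^sup>1\<^sup>/\<^sup>2\<close>. The lower bound needs mass of \<open>u\<close> well inside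
\<open>B\<^sub>a\<close>: by the upper bound, a thin layer along the faces of \<open>B\<^sub>b\<close> carries at most half of
\<open>\<integral> u\<^sup>2 = 1\<close> (\<open>inner_mass\<close>), and if \<open>C2\<close> is close to 1 the rest of \<open>B\<^sub>b\<close> lies well inside \<open>B\<^sub>a\<close>. This is
the only place where \<open>C2\<close> enters.\<close>

section \<open>Heat flow on an interval\<close>

definition sine_heat :: "nat \<Rightarrow> (nat \<Rightarrow> real) \<Rightarrow> real \<Rightarrow> real \<Rightarrow> real" where
  "sine_heat N c t \<theta> = (\<Sum>k=1..N. c k * exp (- (real k)\<^sup>2 * t) * sin (real k * \<theta>))"

lemma second_derivative_nonneg_at_min:
  fixes f f' :: "real \<Rightarrow> real"
  assumes ab: "a < x" "x < b"
    and f: "\<And>y. (f has_real_derivative f' y) (at y)"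
    and f': "(f' has_real_derivative d) (at x)"
    and min: "\<And>y. a < y \<Longrightarrow> y < b \<Longrightarrow> f x \<le> f y"
  shows "d \<ge> 0"
proof (rule ccontr)
  assume "\<not> d \<ge> 0"
  then have "d < 0" by simp
  have "f' x = 0"
    by (rule DERIV_local_min[OF f, of "min (x - a) (b - x)"]) (use ab min in \<open>auto simp: abs_if split: if_splits\<close>)
  obtain e where e: "e > 0" "\<And>h. 0 < h \<Longrightarrow> h < e \<Longrightarrow> f' (x + h) < f' x"
    using DERIV_neg_dec_right[OF f' \<open>d < 0\<close>] by blast
  define h where "h = min e (b - x) / 2"
  have h: "0 < h" "h < e" "x + h < b" using e ab by (auto simp: h_def min_def field_simps)
  obtain z where z: "x < z" "z < x + h" "f (x + h) - f x = h * f' z"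
    using MVT2[of x "x + h" f f'] f h by (auto)
  have "f' z < 0" using e(2)[of "z - x"] z h \<open>f' x = 0\<close> by auto
  then have "f (x + h) < f x" using z h by (smt (verit) mult_pos_neg)
  moreover have "f x \<le> f (x + h)" using min[of "x + h"] h ab by auto
  ultimately show False by simp
qed

lemma derivative_nonpos_at_right_end_min:
  fixes f :: "real \<Rightarrow> real"
  assumes "a < x" and f: "(f has_real_derivative d) (at x)"
    and min: "\<And>y. a < y \<Longrightarrow> y \<le> x \<Longrightarrow> f x \<le> f y"
  shows "d \<le> 0"
proof (rule ccontr)
  assume "\<not> d \<le> 0"
  then have "d > 0" by simp
  obtain e where e: "e > 0" "\<And>h. 0 < h \<Longrightarrow> h < e \<Longrightarrow> f (x - h) < f x"
    using DERIV_pos_inc_left[OF f \<open>d > 0\<close>] by blast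
  define h where "h = min e (x - a) / 2"
  have h: "0 < h" "h < e" "x - h > a" using e assms(1) by (auto simp: h_def min_def field_simps)
  show False using e(2)[of h] min[of "x - h"] h by auto
qed

text \<open>The parabolic maximum principle. Adding \<open>\<delta> (1 + t)\<close> makes the heat equation strict: at a negative minimum
over the rectangle the space second derivative is nonnegative and the time derivative nonpositive,
although they differ by \<open>\<delta> > 0\<close>.\<close>

lemma sine_heat_nonneg:
  assumes g: "\<And>\<theta>. 0 \<le> \<theta> \<Longrightarrow> \<theta> \<le> pi \<Longrightarrow> 0 \<le> sine_heat N c 0 \<theta>"
    and t: "0 \<le> t" and \<theta>: "0 \<le> \<theta>" "\<theta> \<le> pi"
  shows "0 \<le> sine_heat N c t \<theta>"
proof -
  have main: "0 \<le> sine_heat N c t \<theta> + \<delta> * (1 + t)" if \<delta>: "\<delta> > 0" for \<delta>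
  proof -
    \<comment> \<open>On the three sides with \<open>t = 0\<close>, \<open>\<theta> = 0\<close> and \<open>\<theta> = \<pi>\<close> this is positive.\<close>
    define v where "v = (\<lambda>z. sine_heat N c (fst z) (snd z) + \<delta> * (1 + fst z))"
    have cont: "continuous_on ({0..t} \<times> {0..pi}) v"
      unfolding v_def sine_heat_def by (intro continuous_intros)
    have "compact ({0..t} \<times> {0..pi})" by (intro compact_Times compact_Icc)
    moreover have "{0..t} \<times> {0..pi} \<noteq> {}" using t by auto
    ultimately obtain z where z: "z \<in> {0..t} \<times> {0..pi}" "\<And>y. y \<in> {0..t} \<times> {0..pi} \<Longrightarrow> v z \<le> v y"
      using continuous_attains_inf[OF _ _ cont] by blast
    obtain s x where sx: "z = (s, x)" by (cases z)
    have s: "0 \<le> s" "s \<le> t" and x: "0 \<le> x" "x \<le> pi" using z(1) sx by auto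
    have zmin: "v (s, x) \<le> v (s', x')" if "0 \<le> s'" "s' \<le> t" "0 \<le> x'" "x' \<le> pi" for s' x'
      using z(2)[of "(s', x')"] that sx by auto
    have "0 \<le> v (s, x)"
    proof (rule ccontr)
      assume neg: "\<not> 0 \<le> v (s, x)"
      have "s \<noteq> 0"
      proof
        assume "s = 0"
        with neg g[OF x] \<delta> show False by (auto simp: v_def)
      qed
      have "x \<noteq> 0"
      proof
        assume "x = 0"
        with neg s \<delta> show False by (auto simp: v_def sine_heat_def)
      qed
      have "x \<noteq> pi"
      proof
        assume "x = pi"
        with neg s \<delta> show False by (auto simp: v_def sine_heat_def)
      qed
      define D where "D = (\<Sum>k=1..N. - (real k)\<^sup>2 * c k * exp (- (real k)\<^sup>2 * s) * sin (real k * x))"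
      define f' where "f' = (\<lambda>y. \<Sum>k=1..N. real k * c k * exp (- (real k)\<^sup>2 * s) * cos (real k * y))"
      have 1: "((\<lambda>y. v (s, y)) has_real_derivative f' y) (at y)" for y
        unfolding v_def sine_heat_def f'_def fst_conv snd_conv
        by (auto intro!: derivative_eq_intros sum.cong simp: algebra_simps)
      have 2: "(f' has_real_derivative D) (at x)"
        unfolding f'_def D_def
        by (auto intro!: derivative_eq_intros sum.cong simp: algebra_simps power2_eq_square)
      have "D \<ge> 0"
        by (rule second_derivative_nonneg_at_min[of 0 x pi, OF _ _ 1 2])
          (use x s \<open>x \<noteq> 0\<close> \<open>x \<noteq> pi\<close> zmin in auto)
      have 3: "((\<lambda>r. v (r, x)) has_real_derivative (D + \<delta>)) (at s)"
        unfolding v_def sine_heat_def D_def fst_conv snd_conv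
        by (auto intro!: derivative_eq_intros sum.cong simp: algebra_simps)
      have "D + \<delta> \<le> 0"
        by (rule derivative_nonpos_at_right_end_min[of 0 s, OF _ 3]) (use x s \<open>s \<noteq> 0\<close> zmin in auto)
      with \<open>D \<ge> 0\<close> \<delta> show False by simp
    qed
    also have "\<dots> \<le> v (t, \<theta>)" using zmin t \<theta> by simp
    finally show ?thesis by (simp add: v_def)
  qed
  show ?thesis
  proof (rule field_le_epsilon)
    fix e :: real assume "e > 0"
    then show "0 \<le> sine_heat N c t \<theta> + e"
      using main[of "e / (1 + t)"] t by simp
  qed
qed

lemma abs_sin_mult_le:
  assumes "0 \<le> \<theta>" "\<theta> \<le> pi"
  shows "\<bar>sin (real k * \<theta>)\<bar> \<le> real k * sin \<theta>"
proof (induction k)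
  case (Suc k)
  have s: "sin \<theta> \<ge> 0" using assms by (simp add: sin_ge_zero)
  have "sin (real (Suc k) * \<theta>) = sin (real k * \<theta>) * cos \<theta> + cos (real k * \<theta>) * sin \<theta>"
    by (simp add: algebra_simps sin_add)
  also have "\<bar>\<dots>\<bar> \<le> \<bar>sin (real k * \<theta>)\<bar> * \<bar>cos \<theta>\<bar> + \<bar>cos (real k * \<theta>)\<bar> * sin \<theta>"
    by (metis abs_mult abs_of_nonneg abs_triangle_ineq s)
  also have "\<dots> \<le> \<bar>sin (real k * \<theta>)\<bar> * 1 + 1 * sin \<theta>"
    by (intro add_mono mult_left_mono mult_right_mono s abs_ge_zero abs_cos_le_one)
  finally show ?case using Suc by (simp add: algebra_simps)
qed auto

text \<open>The affine map of \<open>[-b, b]\<close> onto \<open>[0, \<pi>]\<close>; thus \<open>sin (angle b y) = cos (\<pi> y / (2 b))\<close>.\<close>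

definition angle :: "real \<Rightarrow> real \<Rightarrow> real" where
  "angle b y = pi / 2 + pi / (2 * b) * y"

lemma angle_bounds:
  assumes "b > 0" "y \<in> {-b..b}"
  shows "0 \<le> angle b y" "angle b y \<le> pi"
proof -
  have e: "angle b y = pi * ((b + y) / (2 * b))" using assms by (simp add: angle_def field_simps)
  have "0 \<le> (b + y) / (2 * b)" "(b + y) / (2 * b) \<le> 1" using assms by auto
  then show "0 \<le> angle b y" "angle b y \<le> pi"
    unfolding e using mult_left_mono[of "(b + y) / (2 * b)" 1 pi] mult_nonneg_nonneg[of pi "(b + y) / (2 * b)"]
    by (simp_all del: times_divide_eq_right)
qed

lemma sine_orthogonality:
  assumes b: "b > 0" and k: "k \<ge> 1" and l: "l \<ge> 1"
  shows "has_bochner_integral lborel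
    (\<lambda>y. (sin (real k * angle b y) * sin (real l * angle b y)) * indicator {-b..b} y)
    (if k = l then b else 0)"
proof (cases "k = l")
  case True
  define F where "F = (\<lambda>y. y / 2 - b / (2 * pi * real k) * sin (2 * real k * angle b y))"
  have "(F has_real_derivative (sin (real k * angle b y) * sin (real k * angle b y))) (at y)" for y
  proof -
    have "sin (real k * angle b y) * sin (real k * angle b y) = (1 - cos (2 * real k * angle b y)) / 2"
      using cos_double_sin[of "real k * angle b y"] by (simp add: power2_eq_square mult.assoc)
    moreover have "(F has_real_derivative (1 - cos (2 * real k * angle b y)) / 2) (at y)"
      unfolding F_def angle_def using b k
      by (auto intro!: derivative_eq_intros simp: field_simps)
    ultimately show ?thesis by (simp only:)
  qed
  then have "has_bochner_integral lborel
    (\<lambda>y. (sin (real k * angle b y) * sin (real k * angle b y)) * indicator {-b..b} y) (F b - F (-b))"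
    using b by (intro has_bochner_integral_FTC_Icc_real)
      (auto simp: angle_def intro!: continuous_intros has_field_derivative_at_within)
  moreover have "sin (2 * real k * angle b b) = 0" "sin (2 * real k * angle b (-b)) = 0"
    using b sin_npi[of "2 * k"] by (auto simp: angle_def field_simps)
  ultimately show ?thesis using True by (simp add: F_def)
next
  case False
  define m where "m = real k - real l"
  define p where "p = real k + real l"
  have mp: "m \<noteq> 0" "p \<noteq> 0" using False k by (auto simp: m_def p_def)
  define F where "F = (\<lambda>y. b / (pi * m) * sin (m * angle b y) - b / (pi * p) * sin (p * angle b y))"
  have "(F has_real_derivative (sin (real k * angle b y) * sin (real l * angle b y))) (at y)" for y
  proof -
    have "sin (real k * angle b y) * sin (real l * angle b y) = (cos (m * angle b y) - cos (p * angle b y)) / 2"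
      by (simp add: m_def p_def sin_times_sin left_diff_distrib distrib_right)
    moreover have "(F has_real_derivative (cos (m * angle b y) - cos (p * angle b y)) / 2) (at y)"
      unfolding F_def angle_def using b mp
      by (auto intro!: derivative_eq_intros simp: field_simps)
    ultimately show ?thesis by (simp only:)
  qed
  then have "has_bochner_integral lborel
    (\<lambda>y. (sin (real k * angle b y) * sin (real l * angle b y)) * indicator {-b..b} y) (F b - F (-b))"
    using b by (intro has_bochner_integral_FTC_Icc_real)
      (auto simp: angle_def intro!: continuous_intros has_field_derivative_at_within)
  moreover have "angle b b = pi" "angle b (-b) = 0" using b by (auto simp: angle_def field_simps)
  moreover have "sin (m * pi) = 0" "sin (p * pi) = 0"
    by (auto simp: m_def p_def left_diff_distrib distrib_right sin_diff sin_add)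
  ultimately show ?thesis using False by (simp add: F_def)
qed

lemma sine_coefficient:
  assumes b: "b > 0" and k: "1 \<le> k" "k \<le> N"
  shows "has_bochner_integral lborel
    (\<lambda>y. (sine_heat N c 0 (angle b y) * sin (real k * angle b y)) * indicator {-b..b} y) (b * c k)"
proof -
  have "has_bochner_integral lborel
    (\<lambda>y. \<Sum>l=1..N. c l * ((sin (real l * angle b y) * sin (real k * angle b y)) * indicator {-b..b} y))
    (\<Sum>l=1..N. c l * (if l = k then b else 0))"
    by (intro has_bochner_integral_sum has_bochner_integral_mult_right sine_orthogonality b k) auto
  moreover have "(\<Sum>l=1..N. c l * (if l = k then b else 0)) = b * c k"
    using k by (simp add: if_distrib sum.delta cong: if_cong)
  ultimately show ?thesis
    by (simp add: sine_heat_def sum_distrib_right sum_distrib_left mult_ac)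
qed

text \<open>For a nonnegative sine sum the first coefficient controls all others: \<open>k sin \<theta> \<plusminus> sin (k \<theta>) \<ge> 0\<close> on
\<open>[0, \<pi>]\<close>, and integrating these weights against the sum gives \<open>k c\<^sub>1 \<plusminus> c\<^sub>k \<ge> 0\<close> up to a positive factor.\<close>

lemma sine_coefficient_bound:
  assumes g: "\<And>\<theta>. 0 \<le> \<theta> \<Longrightarrow> \<theta> \<le> pi \<Longrightarrow> 0 \<le> sine_heat N c 0 \<theta>"
    and k: "1 \<le> k" "k \<le> N"
  shows "\<bar>c k\<bar> \<le> real k * c 1"
proof -
  let ?g = "\<lambda>y. sine_heat N c 0 (angle 1 y)"
  have N: "1 \<le> N" using k by simp
  have *: "0 \<le> real k * c 1 + s * c k" if s: "s = 1 \<or> s = -1" for s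
  proof -
    have "has_bochner_integral lborel
      (\<lambda>y. real k * (?g y * sin (real 1 * angle 1 y) * indicator {-1..1} y)
         + s * (?g y * sin (real k * angle 1 y) * indicator {-1..1} y))
      (real k * (1 * c 1) + s * (1 * c k))"
      by (intro has_bochner_integral_add has_bochner_integral_mult_right sine_coefficient k N) auto
    moreover have "0 \<le> real k * (?g y * sin (real 1 * angle 1 y) * indicator {-1..1} y)
         + s * (?g y * sin (real k * angle 1 y) * indicator {-1..1} y)" for y
    proof (cases "y \<in> {-1..1}")
      case True
      have th: "0 \<le> angle 1 y" "angle 1 y \<le> pi" using angle_bounds[of 1 y] True by auto
      have "0 \<le> ?g y * (real k * sin (angle 1 y) + s * sin (real k * angle 1 y))"
        using abs_sin_mult_le[OF th, of k] s by (intro mult_nonneg_nonneg g th) auto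
      then show ?thesis using True by (simp add: algebra_simps)
    qed auto
    ultimately show ?thesis
      using Bochner_Integration.integral_nonneg has_bochner_integral_integral_eq by (smt (verit, best))
  qed
  show ?thesis using *[of 1] *[of "-1"] by (simp add: abs_le_iff)
qed

lemma sum_inverse_squares_bound: "(\<Sum>k=2..N. 1 / (real k)\<^sup>2) \<le> 1"
proof -
  have "(\<Sum>k=2..N. 1 / (real k)\<^sup>2) \<le> 1 - 1 / real N" if "N \<ge> 1"
    using that
  proof (induction N rule: nat_induct_at_least)
    case (Suc n)
    have "1 / (real (Suc n))\<^sup>2 \<le> 1 / real n - 1 / real (Suc n)"
    proof -
      have "1 / (real (Suc n))\<^sup>2 \<le> 1 / (real n * real (Suc n))"
        using Suc.hyps unfolding power2_eq_square by (intro divide_left_mono mult_right_mono mult_pos_pos) auto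
      also have "\<dots> = 1 / real n - 1 / real (Suc n)" using Suc.hyps by (simp add: field_simps)
      finally show ?thesis .
    qed
    with Suc show ?case by (simp add: sum.atLeast_Suc_atMost)
  qed auto
  then show ?thesis by (cases "N \<ge> 1") (force intro: order_trans)+
qed

lemma decay_bound:
  assumes "\<tau> \<ge> (10::real)" "k \<ge> 2"
  shows "(real k)\<^sup>2 * exp (- (real k)\<^sup>2 * \<tau>) \<le> 1 / 2 * exp (- \<tau>) * (1 / (real k)\<^sup>2)"
proof -
  define x where "x = (real k)\<^sup>2"
  have "real k \<ge> 2" using assms by simp
  then have x: "x \<ge> 4" unfolding x_def using power_mono[of 2 "real k" 2] by simp
  have "x \<le> exp (x - 1)" using exp_ge_add_one_self[of "x - 1"] by simp
  moreover have "2 * x \<le> exp ((x - 1) * 9)"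
    using exp_ge_add_one_self[of "(x - 1) * 9"] x by simp
  ultimately have "x * (2 * x) \<le> exp (x - 1) * exp ((x - 1) * 9)"
    using x by (intro mult_mono) auto
  also have "\<dots> = exp ((x - 1) * 10)" by (simp add: exp_add[symmetric] algebra_simps)
  also have "\<dots> \<le> exp ((x - 1) * \<tau>)" using x assms mult_left_mono[of 10 \<tau> "x - 1"] by simp
  also have "\<dots> = exp (- \<tau>) / exp (- x * \<tau>)" by (simp add: exp_diff[symmetric] algebra_simps)
  finally have "x * (2 * x) * exp (- x * \<tau>) \<le> exp (- \<tau>)"
    by (simp add: pos_le_divide_eq)
  then show ?thesis unfolding x_def[symmetric] using x by (simp add: field_simps)
qed

text \<open>After a time of order 1 only the first mode counts. By the coefficient bound the \<open>k\<close>-th term is at most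
\<open>k\<^sup>2 exp (- k\<^sup>2 \<tau>) c\<^sub>1 sin \<theta>\<close>, and these terms with \<open>k \<ge> 2\<close> add up to at most half of the first one. The
factor \<open>sin \<theta>\<close> survives, so the estimate is sharp up to the end points.\<close>

lemma sine_heat_large_time:
  assumes c: "\<And>k. 1 \<le> k \<Longrightarrow> k \<le> N \<Longrightarrow> \<bar>c k\<bar> \<le> real k * c 1" and N: "1 \<le> N"
    and \<tau>: "10 \<le> \<tau>" and \<theta>: "0 \<le> \<theta>" "\<theta> \<le> pi"
  shows "sine_heat N c \<tau> \<theta> \<le> 2 * (exp (- \<tau>) * c 1 * sin \<theta>)"
    and "1 / 2 * (exp (- \<tau>) * c 1 * sin \<theta>) \<le> sine_heat N c \<tau> \<theta>"
proof -
  define A where "A = exp (- \<tau>) * c 1 * sin \<theta>"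
  have c1: "c 1 \<ge> 0" using c[of 1] N by simp
  have s: "sin \<theta> \<ge> 0" using \<theta> by (simp add: sin_ge_zero)
  have A: "A \<ge> 0" using c1 s by (simp add: A_def)
  define R where "R = (\<Sum>k=2..N. c k * exp (- (real k)\<^sup>2 * \<tau>) * sin (real k * \<theta>))"
  have split: "sine_heat N c \<tau> \<theta> = A + R"
    unfolding sine_heat_def A_def R_def using N
    by (subst sum.atLeast_Suc_atMost) (auto simp: numeral_2_eq_2)
  have "\<bar>R\<bar> \<le> (\<Sum>k=2..N. \<bar>c k * exp (- (real k)\<^sup>2 * \<tau>) * sin (real k * \<theta>)\<bar>)"
    unfolding R_def by (rule sum_abs)
  also have "\<dots> \<le> (\<Sum>k=2..N. 1 / 2 * A * (1 / (real k)\<^sup>2))"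
  proof (rule sum_mono)
    fix k assume "k \<in> {2..N}"
    then have k: "1 \<le> k" "2 \<le> k" "k \<le> N" by auto
    have "\<bar>c k * exp (- (real k)\<^sup>2 * \<tau>) * sin (real k * \<theta>)\<bar>
      = \<bar>c k\<bar> * exp (- (real k)\<^sup>2 * \<tau>) * \<bar>sin (real k * \<theta>)\<bar>" by (simp add: abs_mult)
    also have "\<dots> \<le> (real k * c 1) * exp (- (real k)\<^sup>2 * \<tau>) * (real k * sin \<theta>)"
      using c1 by (intro mult_mono c k abs_sin_mult_le \<theta>) auto
    also have "\<dots> = ((real k)\<^sup>2 * exp (- (real k)\<^sup>2 * \<tau>)) * (c 1 * sin \<theta>)"
      by (simp add: power2_eq_square)
    also have "\<dots> \<le> (1 / 2 * exp (- \<tau>) * (1 / (real k)\<^sup>2)) * (c 1 * sin \<theta>)"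
      using decay_bound[OF \<tau> k(2)] c1 s by (intro mult_right_mono) auto
    finally show "\<bar>c k * exp (- (real k)\<^sup>2 * \<tau>) * sin (real k * \<theta>)\<bar> \<le> 1 / 2 * A * (1 / (real k)\<^sup>2)"
      by (simp add: A_def)
  qed
  also have "\<dots> = 1 / 2 * A * (\<Sum>k=2..N. 1 / (real k)\<^sup>2)" by (simp add: sum_distrib_left)
  also have "\<dots> \<le> 1 / 2 * A * 1" using A by (intro mult_left_mono sum_inverse_squares_bound) auto
  finally have R: "\<bar>R\<bar> \<le> 1 / 2 * A" by simp
  show "sine_heat N c \<tau> \<theta> \<le> 2 * (exp (- \<tau>) * c 1 * sin \<theta>)"
    "1 / 2 * (exp (- \<tau>) * c 1 * sin \<theta>) \<le> sine_heat N c \<tau> \<theta>"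
    using R A split unfolding A_def[symmetric] by (auto simp: abs_le_iff)
qed

text \<open>From \<open>2 cos \<theta> sin (k \<theta>) = sin ((k + 1) \<theta>) + sin ((k - 1) \<theta>)\<close>; the shifted sums match because the
term with frequency 0 vanishes.\<close>

lemma sine_sum_mult_cos:
  "\<exists>c'. \<forall>\<theta>. cos \<theta> * sine_heat N c 0 \<theta> = sine_heat (Suc N) c' 0 \<theta>"
proof -
  define d where "d = (\<lambda>k. if 1 \<le> k \<and> k \<le> N then c k else 0)"
  have d: "sine_heat N c 0 \<theta> = (\<Sum>k=1..N. d k * sin (real k * \<theta>))" for \<theta>
    by (simp add: sine_heat_def d_def)
  define c' where "c' = (\<lambda>k. (d (k - 1) + d (k + 1)) / 2)"
  have "cos \<theta> * sine_heat N c 0 \<theta> = sine_heat (Suc N) c' 0 \<theta>" for \<theta>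
  proof -
    have "cos \<theta> * sine_heat N c 0 \<theta>
      = (\<Sum>k=1..N. d k / 2 * sin (real (k + 1) * \<theta>)) + (\<Sum>k=1..N. d k / 2 * sin (real (k - 1) * \<theta>))"
      unfolding d sum_distrib_left sum.distrib[symmetric]
    proof (rule sum.cong, simp)
      fix k assume k: "k \<in> {1..N}"
      have *: "real (k - 1) * \<theta> = real k * \<theta> - \<theta>" "real (k + 1) * \<theta> = real k * \<theta> + \<theta>"
        using k by (simp_all add: of_nat_diff algebra_simps)
      show "cos \<theta> * (d k * sin (real k * \<theta>))
         = d k / 2 * sin (real (k + 1) * \<theta>) + d k / 2 * sin (real (k - 1) * \<theta>)"
        unfolding * by (simp add: sin_add sin_diff field_simps)
    qed
    also have "(\<Sum>k=1..N. d k / 2 * sin (real (k + 1) * \<theta>)) = (\<Sum>k=2..Suc N. d (k - 1) / 2 * sin (real k * \<theta>))"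
      using sum.shift_bounds_cl_nat_ivl[of "\<lambda>k. d (k - 1) / 2 * sin (real k * \<theta>)" 1 1 N] by (simp add: numeral_2_eq_2)
    also have "\<dots> = (\<Sum>k=1..Suc N. d (k - 1) / 2 * sin (real k * \<theta>))"
      by (rule sum.mono_neutral_left) (auto simp: d_def)
    also have "(\<Sum>k=1..N. d k / 2 * sin (real (k - 1) * \<theta>)) = (\<Sum>k=0..Suc N. d (k + 1) / 2 * sin (real k * \<theta>))"
    proof -
      have "(\<Sum>k=0..Suc N. d (k + 1) / 2 * sin (real k * \<theta>)) = (\<Sum>k=0+1..Suc N+1. d k / 2 * sin (real (k - 1) * \<theta>))"
        by (subst sum.shift_bounds_cl_nat_ivl) simp
      also have "\<dots> = (\<Sum>k=1..N. d k / 2 * sin (real (k - 1) * \<theta>))"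
        by (rule sum.mono_neutral_right) (auto simp: d_def)
      finally show ?thesis by simp
    qed
    also have "\<dots> = (\<Sum>k=1..Suc N. d (k + 1) / 2 * sin (real k * \<theta>))"
      by (rule sum.mono_neutral_right) (auto simp: Suc_le_eq)
    finally show ?thesis
      by (simp add: sine_heat_def c'_def sum.distrib[symmetric] algebra_simps add_divide_distrib)
  qed
  then show ?thesis by blast
qed

lemma sine_sum_add:
  "\<exists>c'. \<forall>\<theta>. \<alpha> * sine_heat M c 0 \<theta> + \<beta> * sine_heat N d 0 \<theta> = sine_heat (max M N) c' 0 \<theta>"
proof -
  define c' where "c' = (\<lambda>k. \<alpha> * (if k \<le> M then c k else 0) + \<beta> * (if k \<le> N then d k else 0))"
  have "\<alpha> * sine_heat M c 0 \<theta> + \<beta> * sine_heat N d 0 \<theta> = sine_heat (max M N) c' 0 \<theta>" for \<theta>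
  proof -
    have *: "sine_heat M c 0 \<theta> = (\<Sum>k=1..max M N. (if k \<le> M then c k else 0) * sin (real k * \<theta>))"
      "sine_heat N d 0 \<theta> = (\<Sum>k=1..max M N. (if k \<le> N then d k else 0) * sin (real k * \<theta>))"
      unfolding sine_heat_def by (intro sum.mono_neutral_cong_left; auto)+
    show ?thesis
      unfolding *
      by (simp add: sine_heat_def c'_def sum_distrib_left sum.distrib[symmetric] algebra_simps)
  qed
  then show ?thesis by blast
qed

lemma sine_sum_mult_quadratic:
  "\<exists>N' c'. N \<le> N' \<and> (\<forall>\<theta>. sine_heat N c 0 \<theta> * (1 - ((cos \<theta> - \<gamma>) / 2)\<^sup>2) = sine_heat N' c' 0 \<theta>)"
proof -
  obtain c1 where c1: "\<And>\<theta>. cos \<theta> * sine_heat N c 0 \<theta> = sine_heat (Suc N) c1 0 \<theta>"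
    using sine_sum_mult_cos by blast
  obtain c2 where c2: "\<And>\<theta>. cos \<theta> * sine_heat (Suc N) c1 0 \<theta> = sine_heat (Suc (Suc N)) c2 0 \<theta>"
    using sine_sum_mult_cos by blast
  obtain c3 where c3: "\<And>\<theta>. (1 - \<gamma>\<^sup>2 / 4) * sine_heat N c 0 \<theta> + (\<gamma> / 2) * sine_heat (Suc N) c1 0 \<theta>
      = sine_heat (max N (Suc N)) c3 0 \<theta>"
    using sine_sum_add by blast
  obtain c4 where c4: "\<And>\<theta>. 1 * sine_heat (max N (Suc N)) c3 0 \<theta> + (- 1 / 4) * sine_heat (Suc (Suc N)) c2 0 \<theta>
      = sine_heat (max (max N (Suc N)) (Suc (Suc N))) c4 0 \<theta>"
    using sine_sum_add by blast
  have "sine_heat N c 0 \<theta> * (1 - ((cos \<theta> - \<gamma>) / 2)\<^sup>2) = sine_heat (max (max N (Suc N)) (Suc (Suc N))) c4 0 \<theta>" for \<theta>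
    unfolding c4[symmetric] c3[symmetric] c2[symmetric] c1[symmetric]
    by (simp add: power2_eq_square algebra_simps add_divide_distrib diff_divide_distrib)
  then show ?thesis by (intro exI[of _ "max (max N (Suc N)) (Suc (Suc N))"] exI[of _ c4]) auto
qed

text \<open>Landau's kernel in the variable \<open>cos \<theta>\<close>: a power of a function with values in \<open>[0, 1]\<close> that equals 1
only at \<open>cos \<theta> = \<gamma>\<close>. For large \<open>m\<close> it concentrates there, and it still is a finite sine sum.\<close>

lemma peaked_sine_sum:
  "\<exists>N c. 1 \<le> N \<and> (\<forall>\<theta>. sin \<theta> * (1 - ((cos \<theta> - \<gamma>) / 2)\<^sup>2) ^ m = sine_heat N c 0 \<theta>)"
proof (induction m)
  case 0
  show ?case by (rule exI[of _ 1], rule exI[of _ "\<lambda>_. 1"]) (simp add: sine_heat_def)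
next
  case (Suc m)
  then obtain N c where N: "1 \<le> N" and c: "\<And>\<theta>. sin \<theta> * (1 - ((cos \<theta> - \<gamma>) / 2)\<^sup>2) ^ m = sine_heat N c 0 \<theta>"
    by blast
  obtain N' c' where "N \<le> N'" and "\<And>\<theta>. sine_heat N c 0 \<theta> * (1 - ((cos \<theta> - \<gamma>) / 2)\<^sup>2) = sine_heat N' c' 0 \<theta>"
    using sine_sum_mult_quadratic by blast
  then show ?case using N by (intro exI[of _ N'] exI[of _ c']) (auto simp: c[symmetric] mult_ac)
qed

text \<open>The maximum principle applied to the sum minus \<open>\<rho>\<close> times the first mode. It makes the flow strictly positive
inside the interval.\<close>

lemma sine_heat_lower_bound:
  assumes g: "\<And>\<theta>. 0 \<le> \<theta> \<Longrightarrow> \<theta> \<le> pi \<Longrightarrow> \<rho> * sin \<theta> \<le> sine_heat N c 0 \<theta>"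
    and N: "1 \<le> N" and t: "0 \<le> t" and \<theta>: "0 \<le> \<theta>" "\<theta> \<le> pi"
  shows "\<rho> * exp (- t) * sin \<theta> \<le> sine_heat N c t \<theta>"
proof -
  define c' where "c' = c(1 := c 1 - \<rho>)"
  have *: "sine_heat N c' s x = sine_heat N c s x - \<rho> * exp (- s) * sin x" for s x
  proof -
    have "sine_heat N c' s x = (c 1 - \<rho>) * exp (- s) * sin x + (\<Sum>k=Suc 1..N. c k * exp (- (real k)\<^sup>2 * s) * sin (real k * x))"
      unfolding sine_heat_def c'_def using N by (subst sum.atLeast_Suc_atMost) auto
    moreover have "sine_heat N c s x = c 1 * exp (- s) * sin x + (\<Sum>k=Suc 1..N. c k * exp (- (real k)\<^sup>2 * s) * sin (real k * x))"
      unfolding sine_heat_def using N by (subst sum.atLeast_Suc_atMost) auto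
    ultimately show ?thesis by (simp add: algebra_simps)
  qed
  have "0 \<le> sine_heat N c' t \<theta>"
    by (rule sine_heat_nonneg[OF _ t \<theta>]) (use g in \<open>simp add: *\<close>)
  then show ?thesis by (simp add: *)
qed

section \<open>Integrals of derivatives and of products\<close>

text \<open>Derivatives along a single direction suffice for integration by parts, and the rules of one-variable calculus
apply to them directly.\<close>

abbreviation dir_deriv :: "('a::real_normed_vector \<Rightarrow> real) \<Rightarrow> 'a \<Rightarrow> real \<Rightarrow> 'a \<Rightarrow> bool" where
  "dir_deriv f e d y \<equiv> ((\<lambda>s. f (y + s *\<^sub>R e)) has_real_derivative d) (at 0)"

text \<open>Translation invariance of Lebesgue measure makes the integrals of the difference quotients vanish; dominated
convergence carries this over to the derivative.\<close>

lemma integral_directional_derivative_zero: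
  fixes f g :: "'a::euclidean_space \<Rightarrow> real"
  assumes deriv: "\<And>y. dir_deriv f e (g y) y"
    and f: "continuous_on UNIV f" and g: "continuous_on UNIV g"
    and B: "bounded B" "\<And>y. y \<notin> B \<Longrightarrow> f y = 0" "\<And>y. y \<notin> B \<Longrightarrow> g y = 0"
  shows "integrable lborel g" "integral\<^sup>L lborel g = 0"
proof -
  obtain R where R: "\<And>y. y \<in> B \<Longrightarrow> norm y \<le> R" using B(1) unfolding bounded_iff by blast
  \<comment> \<open>Large enough to contain all translates of \<open>B\<close> by \<open>s e\<close> with \<open>s \<in> [-1, 0]\<close>.\<close>
  define K where "K = cball (0::'a) (R + norm e)"
  have K: "compact K" by (simp add: K_def)
  have BK: "y \<notin> B" "y + s *\<^sub>R e \<notin> B" if "y \<notin> K" "0 \<le> s" "s \<le> 1" for y s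
  proof -
    have n: "norm y > R + norm e" using that by (simp add: K_def)
    show "y \<notin> B" using R[of y] n norm_ge_zero[of e] by (metis add_increasing2 not_le)
    have "norm y \<le> norm (y + s *\<^sub>R e) + norm (s *\<^sub>R e)"
      using norm_triangle_ineq4[of "y + s *\<^sub>R e" "s *\<^sub>R e"] by simp
    moreover have "norm (s *\<^sub>R e) \<le> norm e" using that by (simp add: mult_left_le_one_le)
    ultimately show "y + s *\<^sub>R e \<notin> B" using R[of "y + s *\<^sub>R e"] n by (cases "y + s *\<^sub>R e \<in> B") auto
  qed
  have int: "integrable lborel h" if "continuous_on UNIV h" "\<And>y. y \<notin> B \<Longrightarrow> h y = 0" for h :: "'a \<Rightarrow> real"
  proof -
    have "integrable lborel (\<lambda>y. indicator K y *\<^sub>R h y)"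
      by (rule borel_integrable_compact[OF K]) (use that continuous_on_subset in blast)
    moreover have "(\<lambda>y. indicator K y *\<^sub>R h y) = h"
      using BK(1)[of _ 0] that(2) by (auto simp: indicator_def fun_eq_iff)
    ultimately show ?thesis by simp
  qed
  show intg: "integrable lborel g" using int g B by blast
  have intf: "integrable lborel f" using int f B by blast
  have "bounded (g ` K)"
    by (intro compact_imp_bounded compact_continuous_image continuous_on_subset[OF g] K) simp
  then obtain L where L: "\<And>y. y \<in> K \<Longrightarrow> \<bar>g y\<bar> \<le> L" unfolding bounded_iff by force
  have gL: "\<bar>g y\<bar> \<le> \<bar>L\<bar>" for y
    using L[of y] B(3)[of y] BK(1)[of y 0] by (cases "y \<in> K") auto
  have line: "((\<lambda>s. f (y + s *\<^sub>R e)) has_real_derivative g (y + r *\<^sub>R e)) (at r)" for y r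
    using deriv[of "y + r *\<^sub>R e"] DERIV_shift[of "\<lambda>s. f (y + s *\<^sub>R e)" "g (y + r *\<^sub>R e)" 0 r]
    by (simp add: algebra_simps)
  define h where "h = (\<lambda>n. 1 / (real n + 1))"
  have h: "0 < h n" "h n \<le> 1" for n by (auto simp: h_def)
  have h0: "h \<longlonglongrightarrow> 0" unfolding h_def using LIMSEQ_inverse_real_of_nat by (simp add: inverse_eq_divide add.commute)
  define F where "F = (\<lambda>n y. (f (y + h n *\<^sub>R e) - f y) / h n)"
  have fshift: "integrable lborel (\<lambda>y. f (y + c))" "(LINT y|lborel. f (y + c)) = integral\<^sup>L lborel f" for c
  proof -
    have m: "(+) c \<in> measurable lborel borel" "f \<in> borel_measurable borel"
      using f by (auto intro: borel_measurable_continuous_onI)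
    show "integrable lborel (\<lambda>y. f (y + c))"
      using integrable_distr_eq[OF m] intf lborel_distr_plus[of c] by (simp add: add.commute)
    show "(LINT y|lborel. f (y + c)) = integral\<^sup>L lborel f"
      using integral_distr[OF m] lborel_distr_plus[of c] by (simp add: add.commute)
  qed
  have F0: "integral\<^sup>L lborel (F n) = 0" for n
    unfolding F_def using fshift[of "h n *\<^sub>R e"] intf by simp
  have "(\<lambda>n. integral\<^sup>L lborel (F n)) \<longlonglongrightarrow> integral\<^sup>L lborel g"
  proof (rule integral_dominated_convergence[where w="\<lambda>y. indicator K y *\<^sub>R \<bar>L\<bar>"])
    show "g \<in> borel_measurable lborel" using intg by simp
    show "F n \<in> borel_measurable lborel" for n
      unfolding F_def using fshift(1)[of "h n *\<^sub>R e"] intf by simp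
    show "integrable lborel (\<lambda>y. indicator K y *\<^sub>R \<bar>L\<bar>)"
      by (rule borel_integrable_compact[OF K]) auto
    show "AE y in lborel. (\<lambda>n. F n y) \<longlonglongrightarrow> g y"
    proof (rule AE_I2)
      fix y
      have "(\<lambda>s. (f (y + s *\<^sub>R e) - f y) / s) \<midarrow>0\<rightarrow> g y"
        using deriv[of y] by (simp add: DERIV_def)
      then show "(\<lambda>n. F n y) \<longlonglongrightarrow> g y"
        unfolding F_def using h h0 by (intro tendsto_compose_eventually[where g="\<lambda>s. (f (y + s *\<^sub>R e) - f y) / s" and f=h and l=0])
          (auto simp: less_imp_neq[symmetric] intro!: always_eventually)
    qed
    show "AE y in lborel. norm (F n y) \<le> indicator K y *\<^sub>R \<bar>L\<bar>" for n
    proof (rule AE_I2)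
      fix y
      show "norm (F n y) \<le> indicator K y *\<^sub>R \<bar>L\<bar>"
      proof (cases "y \<in> K")
        case True
        obtain z where "f (y + h n *\<^sub>R e) - f (y + 0 *\<^sub>R e) = (h n - 0) * g (y + z *\<^sub>R e)"
          using MVT2[of 0 "h n" "\<lambda>s. f (y + s *\<^sub>R e)" "\<lambda>s. g (y + s *\<^sub>R e)"] line h by blast
        then have "F n y = g (y + z *\<^sub>R e)" using h(1)[of n] by (simp add: F_def)
        then show ?thesis using gL True by simp
      next
        case False
        then have "F n y = 0" using BK[OF False, of "h n"] h(1)[of n] h(2)[of n] B(2) by (simp add: F_def)
        then show ?thesis by simp
      qed
    qed
  qed
  then show "integral\<^sup>L lborel g = 0" by (simp add: F0 LIMSEQ_const_iff)
qed

text \<open>A function on \<open>V\<close> that vanishes off a compact subset of \<open>V\<close> is extended by zero to the whole space, whatever the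
boundary of \<open>V\<close> looks like.\<close>

lemma set_integral_directional_derivative_zero:
  fixes X X' :: "'a::euclidean_space \<Rightarrow> real"
  assumes V: "open V" "bounded V" and Z: "compact Z" "Z \<subseteq> V" and X0: "\<And>y. y \<in> V - Z \<Longrightarrow> X y = 0"
    and deriv: "\<And>y. y \<in> V \<Longrightarrow> dir_deriv X e (X' y) y"
    and X: "continuous_on V X" and X': "continuous_on V X'"
  shows "set_integrable lborel V X'" "(LINT y:V|lborel. X' y) = 0"
proof -
  define f where "f = (\<lambda>y. if y \<in> V then X y else 0)"
  define g where "g = (\<lambda>y. if y \<in> V then X' y else 0)"
  have near: "\<forall>\<^sub>F s in nhds 0. y + s *\<^sub>R e \<in> W" if "open W" "y \<in> W" for y W
  proof -
    have "((\<lambda>s. y + s *\<^sub>R e) \<longlongrightarrow> y + 0 *\<^sub>R e) (nhds 0)"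
      by (intro tendsto_intros filterlim_ident)
    then show ?thesis using that topological_tendstoD[of _ "y + 0 *\<^sub>R e" _ W] by simp
  qed
  have f0: "f y = 0" if "y \<notin> Z" for y using that X0 by (auto simp: f_def)
  have oZ: "open (- Z)" using Z compact_imp_closed by auto
  have X'0: "X' y = 0" if "y \<in> V" "y \<notin> Z" for y
  proof -
    have "((\<lambda>s. 0) has_real_derivative 0) (at 0)" by simp
    moreover have "\<forall>\<^sub>F s in nhds 0. X (y + s *\<^sub>R e) = 0"
      using eventually_conj[OF near[OF V(1) that(1)] near[OF oZ, of y]] that
      by (auto elim!: eventually_mono intro: X0)
    ultimately have "dir_deriv X e 0 y" by (subst DERIV_cong_ev[OF refl _ refl]) auto
    then show ?thesis using deriv[OF that(1)] DERIV_unique by blast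
  qed
  have UN: "UNIV = V \<union> - Z" using Z by auto
  have fg: "dir_deriv f e (g y) y" for y
  proof (cases "y \<in> V")
    case True
    have "\<forall>\<^sub>F s in nhds 0. f (y + s *\<^sub>R e) = X (y + s *\<^sub>R e)"
      using near[OF V(1) True] by eventually_elim (simp add: f_def)
    then show ?thesis using deriv[OF True] True by (subst DERIV_cong_ev[OF refl _ refl]) (auto simp: g_def)
  next
    case False
    have "\<forall>\<^sub>F s in nhds 0. f (y + s *\<^sub>R e) = 0"
    proof (rule eventually_mono)
      show "\<forall>\<^sub>F s in nhds 0. y + s *\<^sub>R e \<in> - Z" using False Z by (intro near oZ) auto
    qed (simp add: f0)
    then show ?thesis using False by (subst DERIV_cong_ev[OF refl _ refl]) (auto simp: g_def)
  qed
  have cont: "continuous_on UNIV (\<lambda>y. if y \<in> V then h y else 0)"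
    if "continuous_on V h" "\<And>y. y \<in> V \<Longrightarrow> y \<notin> Z \<Longrightarrow> h y = 0" for h :: "'a \<Rightarrow> real"
    unfolding UN
  proof (rule continuous_on_open_Un[OF V(1) oZ])
    show "continuous_on V (\<lambda>y. if y \<in> V then h y else 0)"
      using that(1) by (subst continuous_on_cong[OF refl, of V _ h]) auto
    show "continuous_on (- Z) (\<lambda>y. if y \<in> V then h y else 0)"
      using that(2) by (subst continuous_on_cong[OF refl, of _ _ "\<lambda>_. 0"]) auto
  qed
  have fc: "continuous_on UNIV f" unfolding f_def using X X0 by (intro cont) auto
  have gc: "continuous_on UNIV g" unfolding g_def using X' X'0 by (intro cont) auto
  have eq: "(\<lambda>y. indicator V y *\<^sub>R X' y) = g" by (auto simp: g_def indicator_def)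
  have res: "integrable lborel g" "integral\<^sup>L lborel g = 0"
    using integral_directional_derivative_zero[OF fg fc gc V(2)] by (auto simp: f_def g_def)
  show "set_integrable lborel V X'" unfolding set_integrable_def eq by (rule res)
  show "(LINT y:V|lborel. X' y) = 0" unfolding set_lebesgue_integral_def eq by (rule res)
qed

lemma set_integrable_continuous_bound:
  fixes f g :: "'a::euclidean_space \<Rightarrow> real"
  assumes "open V" "continuous_on V f" "set_integrable lborel V g" "\<And>y. y \<in> V \<Longrightarrow> \<bar>f y\<bar> \<le> g y"
  shows "set_integrable lborel V f"
proof (rule set_integrable_bound[OF assms(3)])
  show "set_borel_measurable lborel V f"
    unfolding set_borel_measurable_def
    using borel_measurable_continuous_on_indicator[OF _ assms(2)] assms(1) by simp
  show "AE x\<in>V in lborel. norm (f x) \<le> norm (g x)"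
    using assms(4) by (intro AE_I2) force
qed

lemma set_integrable_const_bounded:
  fixes V :: "'a::euclidean_space set"
  assumes "open V" "bounded V"
  shows "set_integrable lborel V (\<lambda>_. c::real)"
  unfolding set_integrable_def using assms emeasure_bounded_finite[of V]
  by (intro integrable_real_indicator integrable_scaleR_left) auto

lemma set_integrable_mult_continuous:
  fixes f g :: "'a::euclidean_space \<Rightarrow> real"
  assumes f: "set_integrable lborel A f" and g: "continuous_on UNIV g" and A: "bounded A"
  shows "set_integrable lborel A (\<lambda>y. f y * g y)"
proof -
  have "bounded (g ` closure A)"
    using A by (intro compact_imp_bounded compact_continuous_image continuous_on_subset[OF g]) auto
  then obtain M where M: "\<And>y. y \<in> closure A \<Longrightarrow> \<bar>g y\<bar> \<le> M" unfolding bounded_iff by force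
  have 1: "(\<lambda>y. indicator A y *\<^sub>R f y) \<in> borel_measurable borel"
    using f unfolding set_integrable_def by (simp add: borel_measurable_integrable)
  have 2: "g \<in> borel_measurable borel" by (rule borel_measurable_continuous_onI[OF g])
  show ?thesis
  proof (rule set_integrable_bound)
    show "set_integrable lborel A (\<lambda>y. M * f y)" using f by (rule set_integrable_mult_right)
    show "set_borel_measurable lborel A (\<lambda>y. f y * g y)"
      unfolding set_borel_measurable_def using borel_measurable_times[OF 1 2] by (simp add: mult.assoc)
    show "AE y\<in>A in lborel. norm (f y * g y) \<le> norm (M * f y)"
    proof (intro AE_I2 impI)
      fix y assume "y \<in> A"
      then have "\<bar>g y\<bar> \<le> \<bar>M\<bar>" using M[of y] closure_subset by fastforce
      then have "\<bar>g y\<bar> * \<bar>f y\<bar> \<le> \<bar>M\<bar> * \<bar>f y\<bar>" by (rule mult_right_mono) simp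
      then show "norm (f y * g y) \<le> norm (M * f y)" by (simp add: abs_mult mult.commute)
    qed
  qed
qed

lemma set_integrable_sum:
  fixes f :: "'i \<Rightarrow> 'a \<Rightarrow> real"
  assumes "\<And>i. i \<in> I \<Longrightarrow> set_integrable M A (f i)"
  shows "set_integrable M A (\<lambda>x. \<Sum>i\<in>I. f i x)"
  using assms unfolding set_integrable_def scaleR_sum_right
  by (rule Bochner_Integration.integrable_sum)

lemma set_integral_sum:
  fixes f :: "'i \<Rightarrow> 'a \<Rightarrow> real"
  assumes "\<And>i. i \<in> I \<Longrightarrow> set_integrable M A (f i)"
  shows "(LINT x:A|M. \<Sum>i\<in>I. f i x) = (\<Sum>i\<in>I. LINT x:A|M. f i x)"
  using assms unfolding set_integrable_def set_lebesgue_integral_def scaleR_sum_right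
  by (rule Bochner_Integration.integral_sum)

text \<open>A nonempty open set is not negligible.\<close>

lemma set_integral_pos:
  fixes h :: "'a::euclidean_space \<Rightarrow> real"
  assumes V: "open V" "V \<noteq> {}" and int: "set_integrable lborel V h" and pos: "\<And>y. y \<in> V \<Longrightarrow> 0 < h y"
  shows "0 < (LINT y:V|lborel. h y)"
proof -
  have nn: "AE y in lborel. 0 \<le> indicator V y *\<^sub>R h y"
    by (intro AE_I2) (auto simp: indicator_def less_imp_le[OF pos])
  have "0 \<le> (LINT y:V|lborel. h y)"
    unfolding set_lebesgue_integral_def by (rule integral_nonneg_AE[OF nn])
  moreover have "(LINT y:V|lborel. h y) \<noteq> 0"
  proof
    assume "(LINT y:V|lborel. h y) = 0"
    then have "AE y in lborel. indicator V y *\<^sub>R h y = 0"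
      using integral_nonneg_eq_0_iff_AE[OF int[unfolded set_integrable_def] nn]
      by (simp add: set_lebesgue_integral_def)
    then have "AE y in lborel. y \<notin> V"
      by eventually_elim (use pos in \<open>force simp: indicator_def split: if_splits\<close>)
    then have "V \<in> null_sets lborel"
      using AE_iff_null_sets[of V lborel] V by simp
    then have "negligible V" by (simp add: negligible_iff_null_sets null_sets_completionI)
    then show False using open_not_negligible V by blast
  qed
  ultimately show ?thesis by simp
qed

text \<open>Lebesgue measure is the image of the product of the one-dimensional Lebesgue measures on the coordinates.\<close>

lemma lborel_integral_prod:
  fixes g :: "'a::euclidean_space \<Rightarrow> real \<Rightarrow> real"
  assumes int: "\<And>e. e \<in> Basis \<Longrightarrow> integrable lborel (g e)"
  shows "(LINT y|lborel. (\<Prod>e\<in>Basis. g e (y \<bullet> e))) = (\<Prod>e\<in>(Basis::'a set). integral\<^sup>L lborel (g e))"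
proof -
  interpret product_sigma_finite "\<lambda>_::'a. lborel :: real measure"
    by unfold_locales
  have [measurable]: "g e \<in> borel_measurable borel" if "e \<in> Basis" for e
    using int[OF that] by (simp add: borel_measurable_integrable)
  have "(LINT y|lborel. (\<Prod>e\<in>Basis. g e (y \<bullet> e)))
      = (LINT y|distr (\<Pi>\<^sub>M b\<in>(Basis::'a set). lborel) borel (\<lambda>f. \<Sum>b\<in>Basis. f b *\<^sub>R b). (\<Prod>e\<in>Basis. g e (y \<bullet> e)))"
    by (subst lborel_eq[symmetric]) simp
  also have "\<dots> = (LINT f|(\<Pi>\<^sub>M b\<in>(Basis::'a set). lborel). (\<Prod>e\<in>Basis. g e ((\<Sum>b\<in>Basis. f b *\<^sub>R b) \<bullet> e)))"
    by (rule integral_distr) auto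
  also have "\<dots> = (LINT f|(\<Pi>\<^sub>M b\<in>(Basis::'a set). lborel). (\<Prod>e\<in>Basis. g e (f e)))"
    by (intro Bochner_Integration.integral_cong prod.cong refl) (simp add: inner_sum_left_Basis)
  also have "\<dots> = (\<Prod>e\<in>(Basis::'a set). integral\<^sup>L lborel (g e))"
    by (rule product_integral_prod) (use int in auto)
  finally show ?thesis .
qed

lemma measure_symmetric_box:
  fixes b :: "'a::euclidean_space"
  assumes "\<And>e. e \<in> Basis \<Longrightarrow> 0 < b \<bullet> e"
  shows "(LINT y:box (- b) b|lborel. c) = c * (2 ^ DIM('a) * (\<Prod>e\<in>Basis. b \<bullet> e))"
proof -
  have "measure lborel (box (- b) b) = (\<Prod>e\<in>Basis. (b - (- b)) \<bullet> e)"
    using assms by (subst measure_lborel_box_eq) (auto intro: less_imp_le)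
  also have "\<dots> = (\<Prod>e\<in>Basis. 2 * (b \<bullet> e))" by (intro prod.cong) (simp_all add: inner_add_left)
  finally show ?thesis by (simp add: set_lebesgue_integral_def prod.distrib)
qed

section \<open>A Green inequality for functions with zero trace\<close>

text \<open>A function \<open>u\<close> on \<open>V\<close>, twice differentiable along the coordinate directions, which is the limit in
\<open>H\<^sup>1(V)\<close> of compactly supported functions \<open>f k\<close> of class \<open>C\<^sup>1\<close>; \<open>du\<close>, \<open>ddu\<close> and \<open>df\<close> are the
partial derivatives. It covers both an eigenfunction of an arbitrary domain and a smooth function
on a box that vanishes on the faces.\<close>

locale zero_trace =
  fixes V :: "'a::euclidean_space set"
    and u :: "'a \<Rightarrow> real" and du ddu :: "'a \<Rightarrow> 'a \<Rightarrow> real"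
    and f :: "nat \<Rightarrow> 'a \<Rightarrow> real" and df :: "nat \<Rightarrow> 'a \<Rightarrow> 'a \<Rightarrow> real"
  assumes open_V: "open V" and bounded_V: "bounded V"
    and u_cont: "continuous_on V u" "\<And>e. e \<in> Basis \<Longrightarrow> continuous_on V (du e)"
      "\<And>e. e \<in> Basis \<Longrightarrow> continuous_on V (ddu e)"
    and u_deriv: "\<And>e y. e \<in> Basis \<Longrightarrow> y \<in> V \<Longrightarrow> dir_deriv u e (du e y) y"
      "\<And>e y. e \<in> Basis \<Longrightarrow> y \<in> V \<Longrightarrow> dir_deriv (du e) e (ddu e y) y"
    and f_supp: "\<And>k. \<exists>Z. compact Z \<and> Z \<subseteq> V \<and> (\<forall>y\<in>V - Z. f k y = 0)"
    and f_cont: "\<And>k. continuous_on V (f k)" "\<And>k e. e \<in> Basis \<Longrightarrow> continuous_on V (df k e)"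
    and f_deriv: "\<And>k e y. e \<in> Basis \<Longrightarrow> y \<in> V \<Longrightarrow> dir_deriv (f k) e (df k e y) y"
    and approx: "(\<lambda>k. \<integral>\<^sup>+y\<in>V. ennreal ((f k y - u y)\<^sup>2 + (\<Sum>e\<in>Basis. (df k e y - du e y)\<^sup>2)) \<partial>lborel) \<longlonglongrightarrow> 0"
    and lap_int: "set_integrable lborel V (\<lambda>y. (\<Sum>e\<in>Basis. ddu e y)\<^sup>2)"
begin

definition "err k y = (f k y - u y)\<^sup>2 + (\<Sum>e\<in>Basis. (df k e y - du e y)\<^sup>2)"

lemma err_nonneg: "0 \<le> err k y" by (auto simp: err_def intro!: add_nonneg_nonneg sum_nonneg)

lemma err_cont: "continuous_on V (err k)"
  unfolding err_def by (intro continuous_intros u_cont f_cont)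

lemma err_meas: "(\<lambda>y. indicator V y *\<^sub>R err k y) \<in> borel_measurable borel"
  using borel_measurable_continuous_on_indicator[OF _ err_cont] open_V by simp

lemma err_nn: "(\<integral>\<^sup>+y\<in>V. ennreal (err k y) \<partial>lborel) = (\<integral>\<^sup>+y. ennreal (indicator V y *\<^sub>R err k y) \<partial>lborel)"
  by (intro nn_integral_cong) (auto simp: indicator_def)

lemma err_int: "\<forall>\<^sub>F k in sequentially. set_integrable lborel V (err k)"
proof -
  have "\<forall>\<^sub>F k in sequentially. (\<integral>\<^sup>+y\<in>V. ennreal (err k y) \<partial>lborel) < 1"
    using order_tendstoD(2)[OF approx, of 1] by (simp add: err_def)
  then show ?thesis
  proof eventually_elim
    case (elim k)
    then show ?case unfolding set_integrable_def err_nn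
      using err_nonneg[of k] err_meas[of k]
      by (intro integrableI_nonneg AE_I2) (auto simp: indicator_def intro: less_trans)
  qed
qed

lemma err_tendsto: "(\<lambda>k. LINT y:V|lborel. err k y) \<longlonglongrightarrow> 0"
proof -
  have "(LINT y:V|lborel. err k y) = enn2real (\<integral>\<^sup>+y\<in>V. ennreal (err k y) \<partial>lborel)" for k
    unfolding set_lebesgue_integral_def err_nn
    using err_nonneg[of k] err_meas[of k]
    by (intro integral_eq_nn_integral AE_I2) (auto simp: indicator_def)
  moreover have "(\<lambda>k. enn2real (\<integral>\<^sup>+y\<in>V. ennreal (err k y) \<partial>lborel)) \<longlonglongrightarrow> enn2real 0"
    using approx by (intro tendsto_enn2real) (auto simp: err_def)
  ultimately show ?thesis by simp
qed

lemma u_int: "set_integrable lborel V (\<lambda>y. \<bar>u y\<bar>)"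
proof -
  obtain k where k: "set_integrable lborel V (err k)"
    using err_int by (meson eventually_sequentially order_refl)
  obtain Z where Z: "compact Z" "Z \<subseteq> V" "\<forall>y\<in>V - Z. f k y = 0" using f_supp by blast
  have "bounded (f k ` Z)"
    by (intro compact_imp_bounded compact_continuous_image continuous_on_subset[OF f_cont(1)] Z)
  then obtain B where B: "\<And>y. y \<in> Z \<Longrightarrow> \<bar>f k y\<bar> \<le> B" unfolding bounded_iff by force
  show ?thesis
  proof (rule set_integrable_continuous_bound[OF open_V])
    show "continuous_on V (\<lambda>y. \<bar>u y\<bar>)" by (intro continuous_intros u_cont)
    show "set_integrable lborel V (\<lambda>y. (\<bar>B\<bar> + 1) + err k y)"
      by (intro set_integral_add k set_integrable_const_bounded open_V bounded_V)
    fix y assume y: "y \<in> V"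
    have "\<bar>f k y\<bar> \<le> \<bar>B\<bar>" using B[of y] Z(3) y by (cases "y \<in> Z") auto
    moreover have "\<bar>u y - f k y\<bar> \<le> 1 + (f k y - u y)\<^sup>2"
      using sum_power2_ge_zero[of "\<bar>f k y - u y\<bar> - 1/2" 0] by (simp add: power2_eq_square algebra_simps abs_if split: if_splits)
    moreover have "(f k y - u y)\<^sup>2 \<le> err k y" by (auto simp: err_def intro!: sum_nonneg)
    ultimately show "\<bar>\<bar>u y\<bar>\<bar> \<le> \<bar>B\<bar> + 1 + err k y" by linarith
  qed
qed

context
  fixes p :: "'a \<Rightarrow> real" and dp ddp :: "'a \<Rightarrow> 'a \<Rightarrow> real" and C :: real
  assumes p_cont: "continuous_on V p" "\<And>e. e \<in> Basis \<Longrightarrow> continuous_on V (dp e)"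
      "\<And>e. e \<in> Basis \<Longrightarrow> continuous_on V (ddp e)"
    and p_deriv: "\<And>e y. e \<in> Basis \<Longrightarrow> y \<in> V \<Longrightarrow> dir_deriv p e (dp e y) y"
      "\<And>e y. e \<in> Basis \<Longrightarrow> y \<in> V \<Longrightarrow> dir_deriv (dp e) e (ddp e y) y"
    and p_bound: "\<And>y. y \<in> V \<Longrightarrow> 0 \<le> p y" "\<And>y. y \<in> V \<Longrightarrow> p y \<le> C"
      "\<And>e y. e \<in> Basis \<Longrightarrow> y \<in> V \<Longrightarrow> \<bar>dp e y\<bar> \<le> C"
      "\<And>y. y \<in> V \<Longrightarrow> \<bar>\<Sum>e\<in>Basis. ddp e y\<bar> \<le> C"
begin

definition "Lu y = (\<Sum>e\<in>Basis. ddu e y)"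
definition "Lp y = (\<Sum>e\<in>Basis. ddp e y)"
text \<open>Dominates the integrand of Green's formula, whatever the cutoff.\<close>

definition "majorant y = (C + C * (Lu y)\<^sup>2) + C * \<bar>u y\<bar>"

lemma laplacian_cont: "continuous_on V Lu" "continuous_on V Lp"
  unfolding Lu_def Lp_def by (intro continuous_intros u_cont p_cont; assumption)+

lemma lap_int': "set_integrable lborel V (\<lambda>y. (Lu y)\<^sup>2)"
  using lap_int by (simp add: Lu_def)

lemma majorant_integrable: "set_integrable lborel V majorant"
  unfolding majorant_def
  by (intro set_integral_add u_int set_integrable_mult_right lap_int' set_integrable_const_bounded open_V bounded_V)

lemma integrand_le_majorant:
  assumes y: "y \<in> V" and g: "\<bar>g\<bar> \<le> 1" and v: "\<bar>v\<bar> \<le> \<bar>u y\<bar>"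
  shows "\<bar>p y * g * Lu y - v * Lp y\<bar> \<le> majorant y"
proof -
  note pb = p_bound(1,2,4)[OF y]
  have C: "C \<ge> 0" using pb by linarith
  have "\<bar>p y * g * Lu y\<bar> \<le> C * 1 * \<bar>Lu y\<bar>"
    unfolding abs_mult using pb g C by (intro mult_mono) auto
  also have "\<dots> \<le> C * (1 + (Lu y)\<^sup>2)"
  proof -
    have "\<bar>Lu y\<bar> \<le> 1 + (Lu y)\<^sup>2"
      using zero_le_power2[of "\<bar>Lu y\<bar> - 1/2"] by (simp add: power2_eq_square algebra_simps)
    then show ?thesis using C by (simp add: mult_left_mono)
  qed
  finally have "\<bar>p y * g * Lu y\<bar> \<le> C + C * (Lu y)\<^sup>2" by (simp add: algebra_simps)
  moreover have "\<bar>v * Lp y\<bar> \<le> \<bar>u y\<bar> * C"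
    unfolding abs_mult using pb C v by (intro mult_mono) (auto simp: Lp_def)
  ultimately show ?thesis
    unfolding majorant_def mult.commute[of C "\<bar>u y\<bar>"] by linarith
qed

text \<open>Green's second formula with a nonlinear cutoff of \<open>u\<close>, where \<open>H\<close> is a primitive of the increasing
function \<open>G\<close>. The fields \<open>G(f\<^sub>k) p \<nabla>u\<close> and \<open>H(f\<^sub>k) \<nabla>p\<close> have compact support, so the integral of the difference of
their divergences is 0. With \<open>u\<close> in place of \<open>f\<^sub>k\<close> this difference would be
\<open>G'(u) p \<bar>\<nabla>u\<bar>\<^sup>2 + (p G(u) \<Delta>u - H(u) \<Delta>p)\<close>, whose first term is nonnegative. All that is lost in
replacing \<open>u\<close> by \<open>f\<^sub>k\<close> is controlled pointwise by the squared \<open>H\<^sup>1\<close> error \<open>err k\<close>, whose integral tends to 0.\<close>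

lemma truncated_green_inequality:
  fixes G' G H :: "real \<Rightarrow> real"
  assumes G_deriv: "\<And>s. (H has_real_derivative G s) (at s)" "\<And>s. (G has_real_derivative G' s) (at s)"
    and G_cont: "continuous_on UNIV G'" and G_bound: "\<And>s. 0 \<le> G' s" "\<And>s. G' s \<le> L" "\<And>s. \<bar>G s\<bar> \<le> 1"
    and G_zero: "G 0 = 0" "H 0 = 0"
  shows "set_integrable lborel V (\<lambda>y. p y * G (u y) * Lu y - H (u y) * Lp y)"
    and "(LINT y:V|lborel. p y * G (u y) * Lu y - H (u y) * Lp y) \<le> 0"
proof -
  define \<Phi> where "\<Phi> = (\<lambda>y. p y * G (u y) * Lu y - H (u y) * Lp y)"
  have Gc: "continuous_on UNIV G" "continuous_on UNIV H"
    by (intro continuous_at_imp_continuous_on ballI DERIV_isCont[OF G_deriv(2)] DERIV_isCont[OF G_deriv(1)])+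
  have compc: "continuous_on V (\<lambda>y. g (h y))" if "continuous_on UNIV g" "continuous_on V h" for g :: "real \<Rightarrow> real" and h
    using continuous_on_compose2[OF that] by simp
  have comp: "continuous_on V (\<lambda>y. G (u y))" "continuous_on V (\<lambda>y. H (u y))"
    "continuous_on V (\<lambda>y. G (f k y))" "continuous_on V (\<lambda>y. H (f k y))" "continuous_on V (\<lambda>y. G' (f k y))" for k
    by (fact compc[OF Gc(1) u_cont(1)] compc[OF Gc(2) u_cont(1)] compc[OF Gc(1) f_cont(1)]
      compc[OF Gc(2) f_cont(1)] compc[OF G_cont f_cont(1)])+
  have H_lip: "\<bar>H a - H b\<bar> \<le> \<bar>a - b\<bar>" for a b
    using field_differentiable_bound[of UNIV H G 1 a b] G_deriv(1) G_bound(3)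
    by (auto intro: has_field_derivative_at_within)
  have L: "L \<ge> 0" using G_bound(1,2)[of 0] by simp
  have G_lip: "\<bar>G a - G b\<bar> \<le> L * \<bar>a - b\<bar>" for a b
    using field_differentiable_bound[of UNIV G G' L a b] G_deriv(2) G_bound(1,2)
    by (auto intro: has_field_derivative_at_within)
  have int: "set_integrable lborel V \<Phi>"
  proof (rule set_integrable_continuous_bound[OF open_V _ majorant_integrable])
    show "continuous_on V \<Phi>"
      unfolding \<Phi>_def by (intro continuous_intros p_cont(1) laplacian_cont comp)
    show "\<bar>\<Phi> y\<bar> \<le> majorant y" if "y \<in> V" for y
      unfolding \<Phi>_def using H_lip[of "u y" 0] G_zero by (intro integrand_le_majorant that G_bound) auto
  qed
  then show "set_integrable lborel V (\<lambda>y. p y * G (u y) * Lu y - H (u y) * Lp y)" by (simp add: \<Phi>_def)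
  \<comment> \<open>The difference of the divergences of \<open>G(f\<^sub>k) p \<nabla>u\<close> and \<open>H(f\<^sub>k) \<nabla>p\<close>.\<close>
  define D where "D = (\<lambda>k y. \<Sum>e\<in>Basis.
      ((G' (f k y) * df k e y * p y + dp e y * G (f k y)) * du e y + ddu e y * (G (f k y) * p y))
      - (G (f k y) * df k e y * dp e y + ddp e y * H (f k y)))"
  have D: "set_integrable lborel V (D k)" "(LINT y:V|lborel. D k y) = 0" for k
  proof -
    obtain Z where Z: "compact Z" "Z \<subseteq> V" "\<forall>y\<in>V - Z. f k y = 0" using f_supp by blast
    let ?X = "\<lambda>e y. (G (f k y) * p y) * du e y - H (f k y) * dp e y"
    let ?X' = "\<lambda>e y. (G' (f k y) * df k e y * p y + dp e y * G (f k y)) * du e y + ddu e y * (G (f k y) * p y)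
        - (G (f k y) * df k e y * dp e y + ddp e y * H (f k y))"
    have "set_integrable lborel V (?X' e) \<and> (LINT y:V|lborel. ?X' e y) = 0" if e: "e \<in> Basis" for e
    proof -
      have X0: "?X e y = 0" if "y \<in> V - Z" for y using that Z G_zero by auto
      have c: "continuous_on V (?X e)" "continuous_on V (?X' e)"
        by (intro continuous_intros p_cont comp u_cont f_cont e)+
      have d: "dir_deriv (?X e) e (?X' e y) y" if y: "y \<in> V" for y
      proof -
        note d = f_deriv[OF e y, of k] p_deriv[OF e y] u_deriv(2)[OF e y]
        have *: "((\<lambda>s. g (f k (y + s *\<^sub>R e))) has_real_derivative g' (f k y) * df k e y) (at 0)"
          if "\<And>s. (g has_real_derivative g' s) (at s)" for g g'
          using DERIV_chain2[of g "g' (f k y)" "\<lambda>s. f k (y + s *\<^sub>R e)" 0, OF _ d(1)] that by simp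
        show ?thesis
          using DERIV_diff[OF DERIV_mult[OF DERIV_mult[OF *[OF G_deriv(2)] d(2)] d(4)] DERIV_mult[OF *[OF G_deriv(1)] d(3)]]
          by simp
      qed
      show ?thesis
        using set_integral_directional_derivative_zero[OF open_V bounded_V Z(1,2) X0 d c] by blast
    qed
    then show "set_integrable lborel V (D k)" "(LINT y:V|lborel. D k y) = 0"
      unfolding D_def by (auto simp: set_integral_sum intro!: set_integrable_sum)
  qed
  have pointwise: "\<Phi> y \<le> D k y + (L * C + (DIM('a) * C + C * L + C) / \<delta>) * err k y
      + \<delta> * ((DIM('a) * C + C) + C * L * (Lu y)\<^sup>2)"
    if y: "y \<in> V" and \<delta>: "\<delta> > 0" for y k \<delta>
  proof -
    note pb = p_bound(1,2,4)[OF y]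
    have C: "C \<ge> 0" using pb by linarith
    define a where "a = f k y" 
    define E where "E = err k y"
    have E: "(a - u y)\<^sup>2 + (\<Sum>e\<in>Basis. (df k e y - du e y)\<^sup>2) = E" by (simp add: E_def err_def a_def)
    have Eu: "(a - u y)\<^sup>2 \<le> E" unfolding E[symmetric] by (simp add: sum_nonneg)
    have Ee: "(df k e y - du e y)\<^sup>2 \<le> E" if "e \<in> Basis" for e
      unfolding E[symmetric] using that member_le_sum[of e Basis "\<lambda>e. (df k e y - du e y)\<^sup>2"] zero_le_power2[of "a - u y"]
      by (simp add: add_increasing)
    have Es: "(\<Sum>e\<in>Basis. (df k e y - du e y)\<^sup>2) \<le> E" unfolding E[symmetric] by simp
    \<comment> \<open>Young's inequality; every error term is a difference bounded by \<open>sqrt E\<close>, times something with a square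
      integral bounded uniformly in \<open>k\<close>.\<close>
    have young: "\<bar>x\<bar> * \<bar>z\<bar> \<le> \<delta> * z\<^sup>2 + E / \<delta>" if "x\<^sup>2 \<le> E" for x z
    proof -
      have "0 \<le> (\<delta> * \<bar>z\<bar> - \<bar>x\<bar> / 2)\<^sup>2" by simp
      then have "\<delta> * (\<bar>x\<bar> * \<bar>z\<bar>) \<le> \<delta> * (\<delta> * z\<^sup>2) + x\<^sup>2 / 4"
        by (simp add: power2_eq_square algebra_simps)
      also have "\<dots> \<le> \<delta> * (\<delta> * z\<^sup>2) + E" using that zero_le_power2[of x] by linarith
      also have "\<dots> = \<delta> * (\<delta> * z\<^sup>2 + E / \<delta>)" using \<delta> by (simp add: field_simps)
      finally show ?thesis using \<delta> by (simp add: mult_le_cancel_left_pos)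
    qed
    have young1: "\<bar>x\<bar> \<le> \<delta> + E / \<delta>" if "x\<^sup>2 \<le> E" for x
      using young[OF that, of 1] by simp
    have Deq: "D k y = G' a * p y * (\<Sum>e\<in>Basis. df k e y * du e y)
        + G a * (\<Sum>e\<in>Basis. dp e y * (du e y - df k e y)) + p y * G a * Lu y - H a * Lp y"
    proof -
      have "D k y = (\<Sum>e\<in>Basis. (G' a * p y) * (df k e y * du e y) + G a * (dp e y * (du e y - df k e y))
          + (p y * G a) * ddu e y - H a * ddp e y)"
        unfolding D_def a_def by (intro sum.cong refl) (simp add: algebra_simps)
      then show ?thesis
        unfolding Lu_def Lp_def by (simp only: sum.distrib sum_subtractf sum_distrib_left)
    qed
    \<comment> \<open>The only term without a small factor has a sign up to an error, since
      \<open>- r s \<le> (r - s)\<^sup>2\<close> for all reals.\<close>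
    have t1: "- (G' a * p y * (\<Sum>e\<in>Basis. df k e y * du e y)) \<le> L * C * E"
    proof -
      have "- (\<Sum>e\<in>Basis. df k e y * du e y) = (\<Sum>e\<in>Basis. - (df k e y * du e y))" by (simp add: sum_negf)
      also have "\<dots> \<le> (\<Sum>e\<in>Basis. (df k e y - du e y)\<^sup>2)"
      proof (rule sum_mono)
        fix e
        have "0 \<le> (df k e y - du e y / 2)\<^sup>2 + (du e y)\<^sup>2 / 4 * 3" by simp
        then show "- (df k e y * du e y) \<le> (df k e y - du e y)\<^sup>2"
          by (simp add: power2_eq_square algebra_simps)
      qed
      finally have "- (\<Sum>e\<in>Basis. df k e y * du e y) \<le> E" using Es by simp
      then have "(G' a * p y) * - (\<Sum>e\<in>Basis. df k e y * du e y) \<le> (G' a * p y) * E"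
        using G_bound(1)[of a] pb by (intro mult_left_mono) auto
      also have "\<dots> \<le> (L * C) * E"
        using G_bound(1,2)[of a] pb L C err_nonneg[of k y] by (intro mult_right_mono mult_mono) (auto simp: E_def)
      finally show ?thesis by simp
    qed
    have t2: "- (G a * (\<Sum>e\<in>Basis. dp e y * (du e y - df k e y))) \<le> DIM('a) * C * (\<delta> + E / \<delta>)"
    proof -
      have "\<bar>\<Sum>e\<in>Basis. dp e y * (du e y - df k e y)\<bar> \<le> (\<Sum>e\<in>(Basis::'a set). C * (\<delta> + E / \<delta>))"
      proof (rule order_trans[OF sum_abs], rule sum_mono)
        fix e :: 'a assume e: "e \<in> Basis"
        have "\<bar>du e y - df k e y\<bar> \<le> \<delta> + E / \<delta>"
          using young1[OF Ee[OF e]] by (simp add: abs_minus_commute)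
        then show "\<bar>dp e y * (du e y - df k e y)\<bar> \<le> C * (\<delta> + E / \<delta>)"
          unfolding abs_mult using p_bound(3)[OF e y] C by (intro mult_mono) auto
      qed
      also have "\<dots> = DIM('a) * C * (\<delta> + E / \<delta>)" by simp
      finally have "\<bar>\<Sum>e\<in>Basis. dp e y * (du e y - df k e y)\<bar> \<le> DIM('a) * C * (\<delta> + E / \<delta>)" .
      then have "\<bar>G a * (\<Sum>e\<in>Basis. dp e y * (du e y - df k e y))\<bar> \<le> 1 * (DIM('a) * C * (\<delta> + E / \<delta>))"
        unfolding abs_mult using G_bound(3) by (intro mult_mono) auto
      then show ?thesis by linarith
    qed
    have t3: "p y * (G (u y) - G a) * Lu y \<le> C * L * (\<delta> * (Lu y)\<^sup>2 + E / \<delta>)"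
    proof -
      have "p y * (G (u y) - G a) * Lu y \<le> \<bar>p y * (G (u y) - G a) * Lu y\<bar>" by simp
      also have "\<dots> \<le> C * (L * \<bar>u y - a\<bar>) * \<bar>Lu y\<bar>"
        unfolding abs_mult using pb C G_lip L by (intro mult_mono) auto
      also have "\<dots> = C * L * (\<bar>a - u y\<bar> * \<bar>Lu y\<bar>)" by (simp add: abs_minus_commute)
      also have "\<dots> \<le> C * L * (\<delta> * (Lu y)\<^sup>2 + E / \<delta>)"
        using C L young[OF Eu] by (intro mult_left_mono) auto
      finally show ?thesis .
    qed
    have t4: "- ((H (u y) - H a) * Lp y) \<le> C * (\<delta> + E / \<delta>)"
    proof -
      have "- ((H (u y) - H a) * Lp y) \<le> \<bar>(H (u y) - H a) * Lp y\<bar>" by simp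
      also have "\<dots> \<le> \<bar>a - u y\<bar> * C"
        unfolding abs_mult using pb C H_lip[of "u y" a] by (intro mult_mono) (auto simp: Lp_def abs_minus_commute)
      also have "\<dots> \<le> (\<delta> + E / \<delta>) * C" using C young1[OF Eu] by (intro mult_right_mono) auto
      finally show ?thesis by (simp add: mult.commute)
    qed
    have "\<Phi> y = D k y - (G' a * p y * (\<Sum>e\<in>Basis. df k e y * du e y))
        - (G a * (\<Sum>e\<in>Basis. dp e y * (du e y - df k e y)))
        + p y * (G (u y) - G a) * Lu y - ((H (u y) - H a) * Lp y)"
      unfolding Deq \<Phi>_def by (simp add: algebra_simps)
    also have "\<dots> \<le> D k y + L * C * E + DIM('a) * C * (\<delta> + E / \<delta>)
        + C * L * (\<delta> * (Lu y)\<^sup>2 + E / \<delta>) + C * (\<delta> + E / \<delta>)"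
      using t1 t2 t3 t4 by linarith
    also have "\<dots> = D k y + (L * C + (DIM('a) * C + C * L + C) / \<delta>) * err k y
      + \<delta> * ((DIM('a) * C + C) + C * L * (Lu y)\<^sup>2)"
      unfolding E_def[symmetric] by (simp add: algebra_simps add_divide_distrib)
    finally show ?thesis .
  qed
  define R where "R = (\<lambda>y. (DIM('a) * C + C) + C * L * (Lu y)\<^sup>2)"
  have R: "set_integrable lborel V R"
    unfolding R_def by (intro set_integral_add set_integrable_mult_right lap_int' set_integrable_const_bounded open_V bounded_V)
  \<comment> \<open>First \<open>k\<close> tends to infinity with \<open>\<delta>\<close> fixed, then \<open>\<delta>\<close> tends to 0.\<close>
  have step: "(LINT y:V|lborel. \<Phi> y) \<le> \<delta> * (LINT y:V|lborel. R y)" if \<delta>: "\<delta> > 0" for \<delta>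
  proof -
    define A where "A = L * C + (DIM('a) * C + C * L + C) / \<delta>"
    have "\<forall>\<^sub>F k in sequentially. (LINT y:V|lborel. \<Phi> y) \<le> A * (LINT y:V|lborel. err k y) + \<delta> * (LINT y:V|lborel. R y)"
      using err_int
    proof eventually_elim
      case (elim k)
      have i: "set_integrable lborel V (\<lambda>y. A * err k y)" "set_integrable lborel V (\<lambda>y. \<delta> * R y)"
        by (intro set_integrable_mult_right elim R)+
      have "(LINT y:V|lborel. \<Phi> y) \<le> (LINT y:V|lborel. (D k y + A * err k y) + \<delta> * R y)"
        using pointwise[OF _ \<delta>, of _ k] by (intro set_integral_mono int set_integral_add D i) (auto simp: A_def R_def)
      also have "\<dots> = (LINT y:V|lborel. D k y) + (LINT y:V|lborel. A * err k y) + (LINT y:V|lborel. \<delta> * R y)"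
        by (subst set_integral_add, intro set_integral_add D i, intro i, subst set_integral_add) (auto intro: D i)
      finally show ?case using D by simp
    qed
    moreover have "(\<lambda>k. A * (LINT y:V|lborel. err k y) + \<delta> * (LINT y:V|lborel. R y)) \<longlonglongrightarrow> A * 0 + \<delta> * (LINT y:V|lborel. R y)"
      by (intro tendsto_intros err_tendsto)
    ultimately show ?thesis using tendsto_lowerbound[of _ _ sequentially] by force
  qed
  have "(LINT y:V|lborel. \<Phi> y) \<le> 0"
  proof (rule field_le_epsilon)
    fix e :: real assume e: "e > 0"
    let ?I = "LINT y:V|lborel. R y"
    have "e / (1 + \<bar>?I\<bar>) * ?I \<le> e / (1 + \<bar>?I\<bar>) * (1 + \<bar>?I\<bar>)" using e by (intro mult_left_mono) auto
    also have "\<dots> = e" by simp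
    finally show "(LINT y:V|lborel. \<Phi> y) \<le> 0 + e" using step[of "e / (1 + \<bar>?I\<bar>)"] e by simp
  qed
  then show "(LINT y:V|lborel. p y * G (u y) * Lu y - H (u y) * Lp y) \<le> 0" by (simp add: \<Phi>_def)
qed

text \<open>The functions \<open>G(s) = s / sqrt (s\<^sup>2 + \<epsilon>\<^sup>2)\<close> and \<open>H(s) = sqrt (s\<^sup>2 + \<epsilon>\<^sup>2) - \<epsilon>\<close> tend to 1 and to \<open>s\<close> on
the positive values of \<open>u\<close> as \<open>\<epsilon> \<rightarrow> 0\<close>, and the cutoff disappears from the preceding inequality. For smooth
data the left side is \<open>\<integral> p \<partial>u/\<partial>\<nu>\<close> over the boundary, the flux of a positive function with zero boundary values.\<close>

lemma green_inequality:
  assumes u_pos: "\<And>y. y \<in> V \<Longrightarrow> 0 < u y"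
  shows "(LINT y:V|lborel. p y * (\<Sum>e\<in>Basis. ddu e y) - u y * (\<Sum>e\<in>Basis. ddp e y)) \<le> 0"
proof -
  define r where "r = (\<lambda>\<epsilon> s. sqrt (s\<^sup>2 + \<epsilon>\<^sup>2))"
  have r: "r \<epsilon> s > 0" "\<epsilon> \<le> r \<epsilon> s" "\<bar>s\<bar> \<le> r \<epsilon> s" "r \<epsilon> s \<le> \<bar>s\<bar> + \<epsilon>" "(r \<epsilon> s)\<^sup>2 = s\<^sup>2 + \<epsilon>\<^sup>2" if "\<epsilon> > 0" for \<epsilon> s :: real
  proof -
    show "r \<epsilon> s > 0" using that by (simp add: r_def add_nonneg_pos)
    show "\<epsilon> \<le> r \<epsilon> s" unfolding r_def using that by (intro real_le_rsqrt) simp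
    show "\<bar>s\<bar> \<le> r \<epsilon> s" unfolding r_def by (intro real_le_rsqrt) simp
    show "r \<epsilon> s \<le> \<bar>s\<bar> + \<epsilon>" unfolding r_def using that by (intro real_le_lsqrt) (auto simp: power2_sum)
    show "(r \<epsilon> s)\<^sup>2 = s\<^sup>2 + \<epsilon>\<^sup>2" by (simp add: r_def)
  qed
  have r_deriv: "(r \<epsilon> has_real_derivative s / r \<epsilon> s) (at s)" if "\<epsilon> > 0" for \<epsilon> s
    using r(1)[OF that, of s] that unfolding r_def
    by (auto intro!: derivative_eq_intros simp: add_nonneg_pos field_simps)
  have G_deriv: "((\<lambda>s. s / r \<epsilon> s) has_real_derivative \<epsilon>\<^sup>2 / (r \<epsilon> s) ^ 3) (at s)" if \<epsilon>: "\<epsilon> > 0" for \<epsilon> s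
  proof -
    have "((\<lambda>s. s / r \<epsilon> s) has_real_derivative (1 * r \<epsilon> s - s * (s / r \<epsilon> s)) / (r \<epsilon> s * r \<epsilon> s)) (at s)"
      by (intro DERIV_divide DERIV_ident r_deriv \<epsilon>) (use r(1)[OF \<epsilon>, of s] in simp)
    moreover have "(1 * r \<epsilon> s - s * (s / r \<epsilon> s)) / (r \<epsilon> s * r \<epsilon> s) = ((r \<epsilon> s)\<^sup>2 - s\<^sup>2) / (r \<epsilon> s) ^ 3"
      using r(1)[OF \<epsilon>, of s] by (simp add: field_simps power2_eq_square power3_eq_cube)
    ultimately show ?thesis using r(5)[OF \<epsilon>, of s] by simp
  qed
  define \<epsilon> where "\<epsilon> = (\<lambda>m::nat. 1 / (real m + 1))"
  have \<epsilon>: "\<epsilon> m > 0" "\<epsilon> m \<le> 1" for m by (auto simp: \<epsilon>_def)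
  have \<epsilon>0: "\<epsilon> \<longlonglongrightarrow> 0" unfolding \<epsilon>_def using LIMSEQ_inverse_real_of_nat by (simp add: inverse_eq_divide add.commute)
  define \<Phi> where "\<Phi> = (\<lambda>m y. p y * (u y / r (\<epsilon> m) (u y)) * Lu y - (r (\<epsilon> m) (u y) - \<epsilon> m) * Lp y)"
  have key: "set_integrable lborel V (\<Phi> m) \<and> (LINT y:V|lborel. \<Phi> m y) \<le> 0" for m
  proof -
    have e: "\<epsilon> m > 0" by (rule \<epsilon>)
    have Gd: "((\<lambda>s. r (\<epsilon> m) s - \<epsilon> m) has_real_derivative s / r (\<epsilon> m) s) (at s)" for s
      using DERIV_diff[OF r_deriv[OF e] DERIV_const[of "\<epsilon> m"]] by simp
    have Gc: "continuous_on UNIV (\<lambda>s. (\<epsilon> m)\<^sup>2 / (r (\<epsilon> m) s) ^ 3)"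
      using r(1)[OF e] less_imp_neq[symmetric] unfolding r_def by (intro continuous_intros) (auto simp: less_imp_neq[symmetric])
    have Gb: "(\<epsilon> m)\<^sup>2 / (r (\<epsilon> m) s) ^ 3 \<le> (\<epsilon> m)\<^sup>2 / (\<epsilon> m) ^ 3" for s
      using r[OF e, of s] e by (intro divide_left_mono power_mono) auto
    have "0 \<le> (\<epsilon> m)\<^sup>2 / (r (\<epsilon> m) s) ^ 3" "\<bar>s / r (\<epsilon> m) s\<bar> \<le> 1" for s
      using r[OF e, of s] by (auto simp: abs_divide)
    note * = truncated_green_inequality[OF Gd G_deriv[OF e] Gc this(1) Gb this(2)]
    show ?thesis
      unfolding \<Phi>_def using e by (intro conjI *) (auto simp: r_def)
  qed
  have "(\<lambda>m. LINT y:V|lborel. \<Phi> m y) \<longlonglongrightarrow> (LINT y:V|lborel. p y * Lu y - u y * Lp y)"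
    unfolding set_lebesgue_integral_def
  proof (rule integral_dominated_convergence[where w="\<lambda>y. indicator V y *\<^sub>R majorant y"])
    have c: "continuous_on V (\<lambda>y. p y * Lu y - u y * Lp y)" by (intro continuous_intros p_cont u_cont laplacian_cont)
    then show "(\<lambda>x. indicat_real V x *\<^sub>R (p x * Lu x - u x * Lp x)) \<in> borel_measurable lborel"
      using borel_measurable_continuous_on_indicator[OF _ c] open_V by simp
    show "(\<lambda>x. indicat_real V x *\<^sub>R \<Phi> m x) \<in> borel_measurable lborel" for m
      using key[of m] unfolding set_integrable_def by auto
    show "integrable lborel (\<lambda>y. indicator V y *\<^sub>R majorant y)"
      using majorant_integrable unfolding set_integrable_def .
    show "AE y in lborel. (\<lambda>m. indicat_real V y *\<^sub>R \<Phi> m y) \<longlonglongrightarrow> indicat_real V y *\<^sub>R (p y * Lu y - u y * Lp y)"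
    proof (rule AE_I2)
      fix y
      show "(\<lambda>m. indicat_real V y *\<^sub>R \<Phi> m y) \<longlonglongrightarrow> indicat_real V y *\<^sub>R (p y * Lu y - u y * Lp y)"
      proof (cases "y \<in> V")
        case True
        have "(\<lambda>m. r (\<epsilon> m) (u y)) \<longlonglongrightarrow> sqrt ((u y)\<^sup>2 + 0\<^sup>2)"
          unfolding r_def by (intro tendsto_intros \<epsilon>0)
        then have rl: "(\<lambda>m. r (\<epsilon> m) (u y)) \<longlonglongrightarrow> u y" using u_pos[OF True] by simp
        have "(\<lambda>m. \<Phi> m y) \<longlonglongrightarrow> p y * (u y / u y) * Lu y - (u y - 0) * Lp y"
          unfolding \<Phi>_def using u_pos[OF True] by (intro tendsto_intros rl \<epsilon>0) auto
        then show ?thesis using True u_pos[OF True] by simp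
      qed simp
    qed
    show "AE y in lborel. norm (indicat_real V y *\<^sub>R \<Phi> m y) \<le> indicator V y *\<^sub>R majorant y" for m
    proof (rule AE_I2)
      fix y
      note rr = r[OF \<epsilon>(1)[of m], of "u y"]
      have "\<bar>\<Phi> m y\<bar> \<le> majorant y" if "y \<in> V"
        unfolding \<Phi>_def using rr by (intro integrand_le_majorant that) (auto simp: abs_divide)
      then show "norm (indicat_real V y *\<^sub>R \<Phi> m y) \<le> indicator V y *\<^sub>R majorant y"
        by (simp add: indicator_def)
    qed
  qed
  then show ?thesis
    using key LIMSEQ_le_const2 unfolding Lu_def Lp_def by blast
qed

end

end

section \<open>Sine modes and heat flow on a box\<close>

definition sine_mode :: "'a::euclidean_space \<Rightarrow> ('a \<Rightarrow> nat) \<Rightarrow> 'a \<Rightarrow> real" where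
  "sine_mode b \<kappa> y = (\<Prod>e\<in>Basis. sin (real (\<kappa> e) * angle (b \<bullet> e) (y \<bullet> e)))"

definition mode_eigenvalue :: "'a::euclidean_space \<Rightarrow> ('a \<Rightarrow> nat) \<Rightarrow> real" where
  "mode_eigenvalue b \<kappa> = (\<Sum>e\<in>Basis. (real (\<kappa> e) * (pi / (2 * (b \<bullet> e))))\<^sup>2)"

text \<open>The partial derivative of the mode in the coordinate direction \<open>e\<close>; the value is meaningful for \<open>e \<in> Basis\<close>.\<close>

definition mode_deriv :: "'a::euclidean_space \<Rightarrow> ('a \<Rightarrow> nat) \<Rightarrow> 'a \<Rightarrow> 'a \<Rightarrow> real" where
  "mode_deriv b \<kappa> e y = real (\<kappa> e) * (pi / (2 * (b \<bullet> e))) * cos (real (\<kappa> e) * angle (b \<bullet> e) (y \<bullet> e)) *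
     (\<Prod>e'\<in>Basis - {e}. sin (real (\<kappa> e') * angle (b \<bullet> e') (y \<bullet> e')))"

lemma angle_deriv:
  "((\<lambda>s. angle b (y + s)) has_real_derivative (pi / (2 * b))) (at 0)"
proof -
  have "((\<lambda>s. pi / 2 + pi / (2 * b) * (y + s)) has_real_derivative 0 + pi / (2 * b) * (0 + 1)) (at 0)"
    by (intro DERIV_add DERIV_const DERIV_cmult DERIV_ident)
  then show ?thesis by (simp add: angle_def)
qed

lemma cos_angle_deriv:
  "((\<lambda>s. c * cos (k * angle b (y + s)) * P) has_real_derivative
     - (c * (k * (pi / (2 * b)))) * (sin (k * angle b y) * P)) (at 0)"
  by (auto intro!: derivative_eq_intros angle_deriv)

lemma mode_line:
  assumes e: "e \<in> Basis"
  shows "(\<Prod>e'\<in>Basis - {e}. sin (real (\<kappa> e') * angle (b \<bullet> e') ((y + s *\<^sub>R e) \<bullet> e')))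
    = (\<Prod>e'\<in>Basis - {e}. sin (real (\<kappa> e') * angle (b \<bullet> e') (y \<bullet> e')))"
  using e by (intro prod.cong refl) (auto simp: inner_add_left inner_Basis)

lemma sine_mode_split:
  assumes e: "e \<in> Basis"
  shows "sine_mode b \<kappa> y = sin (real (\<kappa> e) * angle (b \<bullet> e) (y \<bullet> e)) *
     (\<Prod>e'\<in>Basis - {e}. sin (real (\<kappa> e') * angle (b \<bullet> e') (y \<bullet> e')))"
  unfolding sine_mode_def using e by (subst prod.remove) auto

lemma sine_mode_deriv:
  assumes e: "e \<in> Basis"
  shows "dir_deriv (sine_mode b \<kappa>) e (mode_deriv b \<kappa> e y) y"
    and "dir_deriv (mode_deriv b \<kappa> e) e (- (real (\<kappa> e) * (pi / (2 * (b \<bullet> e))))\<^sup>2 * sine_mode b \<kappa> y) y"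
proof -
  have l: "(y + s *\<^sub>R e) \<bullet> e = y \<bullet> e + s" for s using e by (simp add: inner_add_left)
  show "dir_deriv (sine_mode b \<kappa>) e (mode_deriv b \<kappa> e y) y"
    unfolding sine_mode_split[OF e] mode_deriv_def mode_line[OF e] l
    by (auto intro!: derivative_eq_intros angle_deriv)
  show "dir_deriv (mode_deriv b \<kappa> e) e (- (real (\<kappa> e) * (pi / (2 * (b \<bullet> e))))\<^sup>2 * sine_mode b \<kappa> y) y"
    unfolding sine_mode_split[OF e] mode_deriv_def mode_line[OF e] l power2_eq_square
    by (rule cos_angle_deriv)
qed

lemma sine_mode_cont: "continuous_on A (sine_mode b \<kappa>)" "continuous_on A (mode_deriv b \<kappa> e)"
  unfolding sine_mode_def mode_deriv_def angle_def by (intro continuous_intros)+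

text \<open>A solution of the heat equation on the box with half-sides \<open>b\<close>, with zero boundary values. As a finite combination
of modes it extends to the whole space, and its integrals against any function are finite sums of exponentials
in \<open>t\<close>.\<close>

definition box_heat :: "'a::euclidean_space \<Rightarrow> ('a \<Rightarrow> nat) set \<Rightarrow> (('a \<Rightarrow> nat) \<Rightarrow> real) \<Rightarrow> real \<Rightarrow> 'a \<Rightarrow> real" where
  "box_heat b I C t y = (\<Sum>\<kappa>\<in>I. C \<kappa> * exp (- mode_eigenvalue b \<kappa> * t) * sine_mode b \<kappa> y)"

definition box_heat_deriv where
  "box_heat_deriv b I C t e y = (\<Sum>\<kappa>\<in>I. C \<kappa> * exp (- mode_eigenvalue b \<kappa> * t) * mode_deriv b \<kappa> e y)"

definition box_heat_deriv2 where
  "box_heat_deriv2 b I C t e y =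
     (\<Sum>\<kappa>\<in>I. C \<kappa> * exp (- mode_eigenvalue b \<kappa> * t) * (- (real (\<kappa> e) * (pi / (2 * (b \<bullet> e))))\<^sup>2 * sine_mode b \<kappa> y))"

lemma box_heat_dir_deriv:
  assumes e: "e \<in> Basis"
  shows "dir_deriv (box_heat b I C t) e (box_heat_deriv b I C t e y) y"
    and "dir_deriv (box_heat_deriv b I C t e) e (box_heat_deriv2 b I C t e y) y"
  unfolding box_heat_def box_heat_deriv_def box_heat_deriv2_def
  by (intro DERIV_sum DERIV_cmult sine_mode_deriv e)+

lemma box_heat_cont:
  "continuous_on A (box_heat b I C t)" "continuous_on A (box_heat_deriv b I C t e)"
  "continuous_on A (box_heat_deriv2 b I C t e)"
  unfolding box_heat_def box_heat_deriv_def box_heat_deriv2_def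
  by (intro continuous_intros sine_mode_cont)+

lemma box_heat_laplacian:
  "(\<Sum>e\<in>Basis. box_heat_deriv2 b I C t e y)
     = (\<Sum>\<kappa>\<in>I. C \<kappa> * exp (- mode_eigenvalue b \<kappa> * t) * (- mode_eigenvalue b \<kappa> * sine_mode b \<kappa> y))"
  unfolding box_heat_deriv2_def mode_eigenvalue_def
  by (subst sum.swap) (simp add: sum_distrib_left[symmetric] sum_distrib_right[symmetric] sum_negf)

text \<open>The heat flow of a product is the product of the one-dimensional flows, each run with its own clock
\<open>(\<pi> / (2 b\<^sub>e))\<^sup>2 t\<close>. This is how boxes of arbitrary aspect ratio are reduced to an interval.\<close>

lemma box_heat_product:
  fixes b :: "'a::euclidean_space"
  shows "(\<Prod>e\<in>Basis. sine_heat (N e) (c e) ((pi / (2 * (b \<bullet> e)))\<^sup>2 * t) (angle (b \<bullet> e) (y \<bullet> e)))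
    = box_heat b (PiE Basis (\<lambda>e. {1..N e})) (\<lambda>\<kappa>. \<Prod>e\<in>Basis. c e (\<kappa> e)) t y"
  unfolding sine_heat_def
proof (subst prod_sum_PiE)
  show "(\<Sum>\<kappa>\<in>PiE Basis (\<lambda>e. {1..N e}). \<Prod>e\<in>Basis. c e (\<kappa> e) *
      exp (- (real (\<kappa> e))\<^sup>2 * ((pi / (2 * (b \<bullet> e)))\<^sup>2 * t)) * sin (real (\<kappa> e) * angle (b \<bullet> e) (y \<bullet> e)))
    = box_heat b (PiE Basis (\<lambda>e. {1..N e})) (\<lambda>\<kappa>. \<Prod>e\<in>Basis. c e (\<kappa> e)) t y"
    unfolding box_heat_def
  proof (rule sum.cong[OF refl])
    fix \<kappa> :: "'a \<Rightarrow> nat"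
    have "(\<Prod>e\<in>(Basis::'a set). exp (- (real (\<kappa> e))\<^sup>2 * ((pi / (2 * (b \<bullet> e)))\<^sup>2 * t))) = exp (- mode_eigenvalue b \<kappa> * t)"
      by (simp add: exp_sum[symmetric] mode_eigenvalue_def sum_negf sum_distrib_right power_mult_distrib mult.assoc del: times_divide_eq_right)
    then show "(\<Prod>e\<in>Basis. c e (\<kappa> e) *
      exp (- (real (\<kappa> e))\<^sup>2 * ((pi / (2 * (b \<bullet> e)))\<^sup>2 * t)) * sin (real (\<kappa> e) * angle (b \<bullet> e) (y \<bullet> e)))
      = (\<Prod>e\<in>Basis. c e (\<kappa> e)) * exp (- mode_eigenvalue b \<kappa> * t) * sine_mode b \<kappa> y"
      by (simp add: prod.distrib sine_mode_def)
  qed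
qed auto

abbreviation ground_mode :: "'a::euclidean_space \<Rightarrow> 'a \<Rightarrow> real" where
  "ground_mode b \<equiv> sine_mode b (\<lambda>_. 1)"

abbreviation ground_eigenvalue :: "'a::euclidean_space \<Rightarrow> real" where
  "ground_eigenvalue b \<equiv> mode_eigenvalue b (\<lambda>_. 1)"

text \<open>A function with values in \<open>[0, 1]\<close> on the closed box, equal to 1 only at \<open>x\<close>; its powers times the ground mode are
the initial data of the heat flows.\<close>

definition peak :: "'a::euclidean_space \<Rightarrow> 'a \<Rightarrow> 'a \<Rightarrow> real" where
  "peak b x y = (\<Prod>e\<in>Basis. 1 - ((cos (angle (b \<bullet> e) (y \<bullet> e)) - cos (angle (b \<bullet> e) (x \<bullet> e))) / 2)\<^sup>2)"

text \<open>A heat flow that stays positive and, at a time \<open>T\<close> long on the scale of every side, is within factors \<open>2\<^sup>n\<close> of a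
multiple of the ground mode; the multiple is given by the pairing of the initial datum with the ground mode.\<close>

definition controlled_flow :: "'a::euclidean_space \<Rightarrow> ('a \<Rightarrow> nat) set \<Rightarrow> (('a \<Rightarrow> nat) \<Rightarrow> real) \<Rightarrow> real \<Rightarrow> bool" where
  "controlled_flow b I C \<gamma> \<longleftrightarrow> finite I \<and> 0 \<le> \<gamma> \<and>
    (\<forall>t\<ge>0. \<forall>y\<in>cbox (- b) b. 0 \<le> box_heat b I C t y) \<and>
    (\<forall>t\<ge>0. \<forall>y\<in>box (- b) b. 0 < box_heat b I C t y) \<and>
    (LINT y:box (- b) b|lborel. box_heat b I C 0 y * ground_mode b y) = (\<Prod>e\<in>Basis. b \<bullet> e) * \<gamma> \<and>
    (\<forall>T. (\<forall>e\<in>Basis. 10 \<le> (pi / (2 * (b \<bullet> e)))\<^sup>2 * T) \<longrightarrow> (\<forall>y\<in>cbox (- b) b.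
      box_heat b I C T y \<le> 2 ^ DIM('a) * exp (- ground_eigenvalue b * T) * \<gamma> * ground_mode b y \<and>
      (1 / 2) ^ DIM('a) * exp (- ground_eigenvalue b * T) * \<gamma> * ground_mode b y \<le> box_heat b I C T y))"

lemma angle_strict_bounds:
  assumes "b > 0" "- b < y" "y < b"
  shows "0 < angle b y" "angle b y < pi"
proof -
  have e: "angle b y = pi * ((b + y) / (2 * b))" using assms by (simp add: angle_def field_simps)
  have "0 < (b + y) / (2 * b)" "(b + y) / (2 * b) < 1" using assms by auto
  then show "0 < angle b y" "angle b y < pi"
    unfolding e using mult_strict_left_mono[of "(b + y) / (2 * b)" 1 pi] mult_pos_pos[of pi "(b + y) / (2 * b)"]
    by (simp_all del: times_divide_eq_right)
qed

lemma peak_factor: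
  "\<bar>(cos s - cos t) / 2\<bar> \<le> (1 + \<bar>cos t\<bar>) / 2" for s t :: real
proof -
  have "\<bar>cos s - cos t\<bar> \<le> 1 + \<bar>cos t\<bar>"
    using abs_cos_le_one[of s] abs_triangle_ineq4[of "cos s" "cos t"] by linarith
  then show ?thesis by simp
qed

context
  fixes b :: "'a::euclidean_space"
  assumes b: "\<And>e. e \<in> Basis \<Longrightarrow> 0 < b \<bullet> e"
begin

lemma box_angle:
  assumes "e \<in> Basis"
  shows "y \<in> cbox (- b) b \<Longrightarrow> 0 \<le> angle (b \<bullet> e) (y \<bullet> e)"
    and "y \<in> cbox (- b) b \<Longrightarrow> angle (b \<bullet> e) (y \<bullet> e) \<le> pi"
    and "y \<in> box (- b) b \<Longrightarrow> 0 < angle (b \<bullet> e) (y \<bullet> e)"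
    and "y \<in> box (- b) b \<Longrightarrow> angle (b \<bullet> e) (y \<bullet> e) < pi"
  using angle_bounds[OF b[OF assms], of "y \<bullet> e"] angle_strict_bounds[OF b[OF assms], of "y \<bullet> e"] assms
  by (auto simp: mem_box)

lemma ground_mode_bounds:
  shows "y \<in> cbox (- b) b \<Longrightarrow> 0 \<le> ground_mode b y" and "y \<in> box (- b) b \<Longrightarrow> 0 < ground_mode b y"
    and "y \<in> cbox (- b) b \<Longrightarrow> ground_mode b y \<le> 1"
  unfolding sine_mode_def
  by (auto intro!: prod_nonneg prod_pos prod_le_1 sin_ge_zero sin_gt_zero box_angle)

lemma peak_cont: "continuous_on A (peak b x)"
  unfolding peak_def angle_def by (auto intro!: continuous_intros simp: less_imp_neq[OF b, symmetric])

lemma peak_at: "peak b x x = 1" by (simp add: peak_def)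

lemma peak_term:
  "0 \<le> 1 - ((cos s - cos t) / 2)\<^sup>2" "1 - ((cos s - cos t) / 2)\<^sup>2 \<le> 1" for s t :: real
proof -
  have "\<bar>(cos s - cos t) / 2\<bar> \<le> 1"
    by (rule order_trans[OF peak_factor]) (use abs_cos_le_one[of t] in simp)
  then show "0 \<le> 1 - ((cos s - cos t) / 2)\<^sup>2" using abs_square_le_1[of "(cos s - cos t) / 2"] by linarith
qed simp

lemma peak_nonneg: "0 \<le> peak b x y"
  unfolding peak_def by (intro prod_nonneg peak_term ballI)

lemma peak_less_1:
  assumes x: "x \<in> cbox (- b) b" and y: "y \<in> cbox (- b) b" "y \<noteq> x"
  shows "peak b x y < 1"
proof -
  obtain e where e: "e \<in> Basis" "y \<bullet> e \<noteq> x \<bullet> e" using y(2) euclidean_eqI by blast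
  have "angle (b \<bullet> e) (y \<bullet> e) \<noteq> angle (b \<bullet> e) (x \<bullet> e)"
    using e b[OF e(1)] by (auto simp: angle_def)
  then have "cos (angle (b \<bullet> e) (y \<bullet> e)) \<noteq> cos (angle (b \<bullet> e) (x \<bullet> e))"
    using cos_inj_pi box_angle[OF e(1)] x y by metis
  then have "0 < ((cos (angle (b \<bullet> e) (y \<bullet> e)) - cos (angle (b \<bullet> e) (x \<bullet> e))) / 2)\<^sup>2" by simp
  moreover have "peak b x y \<le> (1 - ((cos (angle (b \<bullet> e) (y \<bullet> e)) - cos (angle (b \<bullet> e) (x \<bullet> e))) / 2)\<^sup>2) * 1"
    unfolding peak_def using e
    by (subst prod.remove[of _ e]) (auto intro!: mult_left_mono prod_le_1 peak_term simp del: mult_1_right)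
  ultimately show ?thesis by (auto elim!: order_le_less_trans)
qed

text \<open>The integral factors, and each factor is the orthogonality relation for the first coefficient. The integrand
vanishes on the faces, so open and closed intervals may be exchanged.\<close>

lemma ground_mode_pairing:
  assumes N: "\<And>e. e \<in> Basis \<Longrightarrow> 1 \<le> N e"
  shows "(LINT y:box (- b) b|lborel. (\<Prod>e\<in>Basis. sine_heat (N e) (c e) 0 (angle (b \<bullet> e) (y \<bullet> e))) * ground_mode b y)
     = (\<Prod>e\<in>Basis. (b \<bullet> e)) * (\<Prod>e\<in>Basis. c e 1)"
proof -
  let ?g = "\<lambda>e s. (sine_heat (N e) (c e) 0 (angle (b \<bullet> e) s) * sin (real 1 * angle (b \<bullet> e) s)) * indicator {- (b \<bullet> e)..b \<bullet> e} s"
  have g: "has_bochner_integral lborel (?g e) ((b \<bullet> e) * c e 1)" if "e \<in> Basis" for e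
    by (rule sine_coefficient) (use b N that in auto)
  have "indicator (box (- b) b) y *\<^sub>R ((\<Prod>e\<in>Basis. sine_heat (N e) (c e) 0 (angle (b \<bullet> e) (y \<bullet> e))) * ground_mode b y)
    = (\<Prod>e\<in>Basis. ?g e (y \<bullet> e))" for y
  proof (cases "y \<in> box (- b) b")
    case True
    then have "indicator {- (b \<bullet> e)..b \<bullet> e} (y \<bullet> e) = (1::real)" if "e \<in> Basis" for e
      using that by (auto simp: mem_box intro: less_imp_le)
    then show ?thesis using True by (simp add: sine_mode_def prod.distrib)
  next
    case False
    then obtain e where e: "e \<in> Basis" "\<not> (- (b \<bullet> e) < y \<bullet> e \<and> y \<bullet> e < b \<bullet> e)" by (auto simp: mem_box)
    have "?g e (y \<bullet> e) = 0"
    proof (cases "y \<bullet> e \<in> {- (b \<bullet> e)..b \<bullet> e}")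
      case True
      then have "y \<bullet> e = - (b \<bullet> e) \<or> y \<bullet> e = b \<bullet> e" using e by auto
      then have "angle (b \<bullet> e) (y \<bullet> e) = 0 \<or> angle (b \<bullet> e) (y \<bullet> e) = pi"
        using b[OF e(1)] by (auto simp: angle_def field_simps)
      then show ?thesis by auto
    qed auto
    then have "(\<Prod>e\<in>Basis. ?g e (y \<bullet> e)) = 0" using e(1) by (intro prod_zero) auto
    then show ?thesis using False by simp
  qed
  then have "(LINT y:box (- b) b|lborel. (\<Prod>e\<in>Basis. sine_heat (N e) (c e) 0 (angle (b \<bullet> e) (y \<bullet> e))) * ground_mode b y)
    = (LINT y|lborel. (\<Prod>e\<in>Basis. ?g e (y \<bullet> e)))"
    unfolding set_lebesgue_integral_def by (simp only:)
  also have "\<dots> = (\<Prod>e\<in>(Basis::'a set). integral\<^sup>L lborel (?g e))"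
    by (rule lborel_integral_prod) (use g in \<open>auto simp: has_bochner_integral_iff\<close>)
  also have "\<dots> = (\<Prod>e\<in>(Basis::'a set). (b \<bullet> e) * c e 1)"
    by (intro prod.cong refl has_bochner_integral_integral_eq g)
  finally show ?thesis by (simp add: prod.distrib)
qed

text \<open>The product of the peaked kernels on the intervals. The late-time estimates are products of the one-dimensional ones,
and the numbers \<open>\<gamma>\<close> are products of first coefficients.\<close>

lemma peaked_heat_flow:
  assumes x: "x \<in> box (- b) b"
  shows "\<exists>I C \<gamma>. controlled_flow b I C \<gamma> \<and> (\<forall>y. box_heat b I C 0 y = ground_mode b y * peak b x y ^ m)"
proof -
  have "\<forall>e. \<exists>N c. 1 \<le> N \<and> (\<forall>\<theta>. sin \<theta> * (1 - ((cos \<theta> - cos (angle (b \<bullet> e) (x \<bullet> e))) / 2)\<^sup>2) ^ m = sine_heat N c 0 \<theta>)"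
    using peaked_sine_sum by blast
  then obtain N c where N: "\<And>e. 1 \<le> N e"
    and c: "\<And>e \<theta>. sin \<theta> * (1 - ((cos \<theta> - cos (angle (b \<bullet> e) (x \<bullet> e))) / 2)\<^sup>2) ^ m = sine_heat (N e) (c e) 0 \<theta>"
    by metis
  define I where "I = PiE (Basis::'a set) (\<lambda>e. {1..N e})"
  define C where "C = (\<lambda>\<kappa>. \<Prod>e\<in>(Basis::'a set). c e (\<kappa> e))"
  define \<gamma> where "\<gamma> = (\<Prod>e\<in>(Basis::'a set). c e 1)"
  define \<tau> where "\<tau> = (\<lambda>t e. (pi / (2 * (b \<bullet> e)))\<^sup>2 * t)"
  define \<theta> where "\<theta> = (\<lambda>y e. angle (b \<bullet> e) (y \<bullet> e))"
  have prod: "box_heat b I C t y = (\<Prod>e\<in>Basis. sine_heat (N e) (c e) (\<tau> t e) (\<theta> y e))" for t y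
    unfolding I_def C_def \<tau>_def \<theta>_def box_heat_product ..
  have prod0: "box_heat b I C 0 y = (\<Prod>e\<in>Basis. sine_heat (N e) (c e) 0 (\<theta> y e))" for y
    unfolding prod by (simp add: \<tau>_def)
  have g0: "0 \<le> sine_heat (N e) (c e) 0 s" if "0 \<le> s" "s \<le> pi" for e s
    unfolding c[symmetric] using that by (intro mult_nonneg_nonneg sin_ge_zero zero_le_power peak_term)
  have \<tau>: "0 \<le> \<tau> t e" if "0 \<le> t" for t e using that by (simp add: \<tau>_def)
  have \<theta>: "0 \<le> \<theta> y e" "\<theta> y e \<le> pi" if "y \<in> cbox (- b) b" "e \<in> Basis" for y e
    using box_angle that by (auto simp: \<theta>_def)
  have sgt: "0 < sine_heat (N e) (c e) t s" if e: "e \<in> Basis" and t: "0 \<le> t" and s: "0 < s" "s < pi" for e t s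
  proof -
    define q where "q = cos (\<theta> x e)"
    have "\<bar>q\<bar> < 1"
    proof -
      have "0 < \<theta> x e" "\<theta> x e < pi" using box_angle(3,4)[OF e] x by (auto simp: \<theta>_def)
      then have "cos (\<theta> x e) < cos 0" "cos pi < cos (\<theta> x e)" by (intro cos_monotone_0_pi; simp)+
      then show ?thesis by (simp add: q_def)
    qed
    \<comment> \<open>A positive lower bound for the kernel on the whole interval: \<open>\<bar>cos r - q\<bar> \<le> 1 + \<bar>q\<bar> < 2\<close>, as the centre
      \<open>q\<close> is interior.\<close>
    define \<rho> where "\<rho> = (1 - ((1 + \<bar>q\<bar>) / 2)\<^sup>2) ^ m"
    have q1: "((1 + \<bar>q\<bar>) / 2)\<^sup>2 < 1" using \<open>\<bar>q\<bar> < 1\<close> abs_square_less_1[of "(1 + \<bar>q\<bar>) / 2"] by simp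
    have \<rho>: "0 < \<rho>" unfolding \<rho>_def using q1 by simp
    have "\<rho> * exp (- t) * sin s \<le> sine_heat (N e) (c e) t s"
    proof (rule sine_heat_lower_bound[OF _ N t])
      fix r :: real assume r: "0 \<le> r" "r \<le> pi"
      have "((cos r - q) / 2)\<^sup>2 \<le> ((1 + \<bar>q\<bar>) / 2)\<^sup>2"
        using peak_factor[of r "\<theta> x e"] unfolding q_def[symmetric] by (simp add: abs_le_square_iff[symmetric])
      then have "\<rho> \<le> (1 - ((cos r - q) / 2)\<^sup>2) ^ m"
        unfolding \<rho>_def using q1 by (intro power_mono) auto
      then show "\<rho> * sin r \<le> sine_heat (N e) (c e) 0 r"
        unfolding c[symmetric] q_def \<theta>_def mult.commute[of "sin r"] by (rule mult_right_mono[OF _ sin_ge_zero[OF r]])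
    qed (use s in auto)
    moreover have "0 < \<rho> * exp (- t) * sin s" using \<rho> s by (intro mult_pos_pos sin_gt_zero) auto
    ultimately show ?thesis by linarith
  qed
  have cb: "\<bar>c e k\<bar> \<le> real k * c e 1" if "1 \<le> k" "k \<le> N e" for e k
    by (rule sine_coefficient_bound[OF g0 that])
  have c1: "0 \<le> c e 1" for e using cb[of 1 e] N[of e] abs_ge_zero[of "c e 1"] by simp
  have gm: "ground_mode b y = (\<Prod>e\<in>Basis. sin (\<theta> y e))" for y by (simp add: sine_mode_def \<theta>_def)
  have ex: "exp (- ground_eigenvalue b * T) = (\<Prod>e\<in>(Basis::'a set). exp (- \<tau> T e))" for T
    by (simp add: mode_eigenvalue_def \<tau>_def exp_sum[symmetric] sum_negf sum_distrib_right)
  show ?thesis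
    unfolding controlled_flow_def
  proof (intro exI[of _ I] exI[of _ C] exI[of _ \<gamma>] conjI)
    show "finite I" unfolding I_def by (intro finite_PiE) auto
    have *: "box_heat b I C 0 y = ground_mode b y * peak b x y ^ m" for y
    proof -
      have "box_heat b I C 0 y = (\<Prod>e\<in>Basis. sin (\<theta> y e) * (1 - ((cos (\<theta> y e) - cos (\<theta> x e)) / 2)\<^sup>2) ^ m)"
        unfolding prod0 c[symmetric] \<theta>_def ..
      also have "\<dots> = (\<Prod>e\<in>Basis. sin (\<theta> y e)) * (\<Prod>e\<in>Basis. 1 - ((cos (\<theta> y e) - cos (\<theta> x e)) / 2)\<^sup>2) ^ m"
        by (simp only: prod.distrib prod_power_distrib)
      finally show ?thesis unfolding gm peak_def \<theta>_def .
    qed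
    then show "\<forall>y. box_heat b I C 0 y = ground_mode b y * peak b x y ^ m" by blast
    have "0 \<le> box_heat b I C t y" if "0 \<le> t" "y \<in> cbox (- b) b" for t y
      unfolding prod by (intro prod_nonneg ballI sine_heat_nonneg[OF g0] \<tau> \<theta> that)
    then show "\<forall>t\<ge>0. \<forall>y\<in>cbox (- b) b. 0 \<le> box_heat b I C t y" by blast
    have "0 < box_heat b I C t y" if "0 \<le> t" "y \<in> box (- b) b" for t y
      unfolding prod using that \<tau> box_angle(3,4) by (intro prod_pos sgt) (auto simp: \<theta>_def)
    then show "\<forall>t\<ge>0. \<forall>y\<in>box (- b) b. 0 < box_heat b I C t y" by blast
    show "0 \<le> \<gamma>" unfolding \<gamma>_def by (intro prod_nonneg c1 ballI)
    show "(LINT y:box (- b) b|lborel. box_heat b I C 0 y * ground_mode b y) = (\<Prod>e\<in>Basis. b \<bullet> e) * \<gamma>"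
      unfolding prod0 \<theta>_def \<gamma>_def by (rule ground_mode_pairing) (rule N)
    show "\<forall>T. (\<forall>e\<in>Basis. 10 \<le> (pi / (2 * (b \<bullet> e)))\<^sup>2 * T) \<longrightarrow> (\<forall>y\<in>cbox (- b) b.
      box_heat b I C T y \<le> 2 ^ DIM('a) * exp (- ground_eigenvalue b * T) * \<gamma> * ground_mode b y \<and>
      (1 / 2) ^ DIM('a) * exp (- ground_eigenvalue b * T) * \<gamma> * ground_mode b y \<le> box_heat b I C T y)"
    proof (intro allI impI ballI conjI)
      fix T y assume T: "\<forall>e\<in>Basis. 10 \<le> (pi / (2 * (b \<bullet> e)))\<^sup>2 * T" and y: "y \<in> cbox (- b) b"
      have T': "10 \<le> \<tau> T e" if "e \<in> Basis" for e using T that by (simp add: \<tau>_def)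
      have bd: "sine_heat (N e) (c e) (\<tau> T e) (\<theta> y e) \<le> 2 * (exp (- \<tau> T e) * c e 1 * sin (\<theta> y e))"
        "1 / 2 * (exp (- \<tau> T e) * c e 1 * sin (\<theta> y e)) \<le> sine_heat (N e) (c e) (\<tau> T e) (\<theta> y e)"
        if "e \<in> Basis" for e
        using sine_heat_large_time[where N="N e" and c="c e", OF _ N T'[OF that] \<theta>[OF y that]] cb by simp_all
      have nn: "0 \<le> exp (- \<tau> T e) * c e 1 * sin (\<theta> y e)" if "e \<in> Basis" for e
        using c1 \<theta>[OF y that] by (simp add: sin_ge_zero)
      have eq: "(\<Prod>e\<in>Basis. k * (exp (- \<tau> T e) * c e 1 * sin (\<theta> y e)))
        = k ^ DIM('a) * exp (- ground_eigenvalue b * T) * \<gamma> * ground_mode b y" for k :: real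
        unfolding ex \<gamma>_def gm by (simp add: prod.distrib)
      show "box_heat b I C T y \<le> 2 ^ DIM('a) * exp (- ground_eigenvalue b * T) * \<gamma> * ground_mode b y"
        unfolding prod eq[symmetric]
      proof (intro prod_mono conjI bd)
        show "0 \<le> sine_heat (N e) (c e) (\<tau> T e) (\<theta> y e)" if "e \<in> Basis" for e
          using order_trans[OF _ bd(2)[OF that]] nn[OF that] by simp
      qed
      show "(1 / 2) ^ DIM('a) * exp (- ground_eigenvalue b * T) * \<gamma> * ground_mode b y \<le> box_heat b I C T y"
        unfolding prod eq[symmetric] by (intro prod_mono conjI bd mult_nonneg_nonneg nn) auto
    qed
  qed
qed

lemma sine_mode_boundary:
  assumes "y \<in> cbox (- b) b" "y \<notin> box (- b) b"
  shows "sine_mode b \<kappa> y = 0"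
proof -
  obtain e where e: "e \<in> Basis" "\<not> (- (b \<bullet> e) < y \<bullet> e \<and> y \<bullet> e < b \<bullet> e)" using assms by (auto simp: mem_box)
  then have "y \<bullet> e = - (b \<bullet> e) \<or> y \<bullet> e = b \<bullet> e" using assms(1) by (force simp: mem_box)
  then have "angle (b \<bullet> e) (y \<bullet> e) = 0 \<or> angle (b \<bullet> e) (y \<bullet> e) = pi"
    using b[OF e(1)] by (auto simp: angle_def field_simps)
  then show ?thesis unfolding sine_mode_def by (intro prod_zero bexI[OF _ e(1)]) auto
qed

end

text \<open>If \<open>h\<close> is positive near \<open>x\<close>, its integral against a weight sufficiently concentrated at \<open>x\<close> is positive: near
\<open>x\<close> the weight is at least \<open>w1\<^sup>m\<close>, and at a distance from \<open>x\<close> it is at most \<open>w0\<^sup>m\<close> with \<open>w0 < w1\<close>. By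
contraposition, an inequality between integrals against all these weights yields the pointwise inequality.\<close>

lemma peaking_test_functions:
  fixes S W h :: "'a::euclidean_space \<Rightarrow> real"
  assumes D: "open D" "bounded D" "x \<in> D"
    and W: "continuous_on (closure D) W" "W x = 1" "\<And>y. y \<in> D \<Longrightarrow> 0 \<le> W y"
      "\<And>y. y \<in> closure D \<Longrightarrow> y \<noteq> x \<Longrightarrow> W y < 1"
    and S: "continuous_on D S" "\<And>y. y \<in> D \<Longrightarrow> 0 < S y" "\<And>y. y \<in> D \<Longrightarrow> S y \<le> 1"
    and h: "set_integrable lborel D h"
    and r: "0 < \<delta>" "0 < r" "ball x r \<subseteq> D" "\<And>y. y \<in> ball x r \<Longrightarrow> \<delta> \<le> h y"
  shows "\<exists>m. 0 < (LINT y:D|lborel. S y * W y ^ m * h y)"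
proof -
  have W1: "W y \<le> 1" if "y \<in> D" for y
    using W(2,4) that closure_subset[of D] by (cases "y = x") force+
  \<comment> \<open>The supremum of the weight off the ball is attained, hence less than 1.\<close>
  obtain w0 where w0: "0 \<le> w0" "w0 < 1" "\<And>y. y \<in> D - ball x r \<Longrightarrow> W y \<le> w0"
  proof (cases "closure D - ball x r = {}")
    case True
    show ?thesis by (rule that[of 0]) (use True closure_subset[of D] in auto)
  next
    case False
    have "compact (closure D - ball x r)" using D by (intro compact_diff) (auto simp: compact_closure)
    moreover have "continuous_on (closure D - ball x r) W" using W(1) by (rule continuous_on_subset) auto
    ultimately obtain z where z: "z \<in> closure D - ball x r" "\<And>y. y \<in> closure D - ball x r \<Longrightarrow> W y \<le> W z"
      using continuous_attains_sup False by metis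
    have "W z < 1" using z r by (intro W(4)) auto
    then show ?thesis
      by (intro that[of "max 0 (W z)"]) (use z closure_subset[of D] in \<open>auto simp: le_max_iff_disj\<close>)
  qed
  define w1 where "w1 = (1 + w0) / 2"
  have w1: "w0 < w1" "0 < w1" "w1 < 1" using w0 by (auto simp: w1_def)
  have "isCont W x" using W(1) D closure_subset[of D] by (metis continuous_on_eq_continuous_at continuous_on_subset)
  then obtain s where s: "0 < s" "\<And>y. dist y x < s \<Longrightarrow> \<bar>W y - W x\<bar> < 1 - w1"
    using w1 unfolding continuous_at_eps_delta dist_real_def by (metis diff_gt_0_iff_gt)
  define r' where "r' = min r s"
  have r': "0 < r'" "ball x r' \<subseteq> ball x r" using r s by (auto simp: r'_def)
  have Wr': "w1 \<le> W y" if "y \<in> ball x r'" for y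
  proof -
    have "dist y x < s" using that by (simp add: r'_def dist_commute)
    from s(2)[OF this] W(2) show ?thesis by linarith
  qed
  have int1: "set_integrable lborel (ball x r') S"
  proof (rule set_integrable_continuous_bound)
    show "continuous_on (ball x r') S" using S(1) r r' by (meson continuous_on_subset order_trans)
    show "set_integrable lborel (ball x r') (\<lambda>_. 1::real)" by (rule set_integrable_const_bounded) auto
    show "\<bar>S y\<bar> \<le> 1" if "y \<in> ball x r'" for y
      using S(2,3)[of y] that r r' by force
  qed simp
  define I1 where "I1 = \<delta> * (LINT y:ball x r'|lborel. S y)"
  have I1: "0 < I1"
    unfolding I1_def
  proof (intro mult_pos_pos set_integral_pos int1)
    show "0 < S y" if "y \<in> ball x r'" for y using that r r' S(2)[of y] by blast
  qed (use r r' in auto)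
  define J where "J = (LINT y:D|lborel. \<bar>h y\<bar>)"
  have "(\<lambda>m. (w0 / w1) ^ m * J) \<longlonglongrightarrow> 0 * J"
    using w0 w1 by (intro tendsto_intros LIMSEQ_power_zero) auto
  then have "\<forall>\<^sub>F m in sequentially. (w0 / w1) ^ m * J < I1" using I1 by (intro order_tendstoD) auto
  then obtain m where m: "(w0 / w1) ^ m * J < I1" by (meson eventually_sequentially order_refl)
  have "0 < w1 ^ m * I1 - w0 ^ m * J"
  proof -
    have "w0 ^ m * J = w1 ^ m * ((w0 / w1) ^ m * J)" using w1 by (simp add: power_divide)
    also have "\<dots> < w1 ^ m * I1" using m w1 by (intro mult_strict_left_mono) auto
    finally show ?thesis by simp
  qed
  also have "w1 ^ m * I1 - w0 ^ m * J
     = (LINT y|lborel. w1 ^ m * \<delta> * (indicator (ball x r') y *\<^sub>R S y) - w0 ^ m * (indicator D y *\<^sub>R \<bar>h y\<bar>))"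
    using int1 set_integrable_abs[OF h] unfolding I1_def J_def set_lebesgue_integral_def set_integrable_def
    by (subst Bochner_Integration.integral_diff) auto
  also have "\<dots> \<le> (LINT y:D|lborel. S y * W y ^ m * h y)"
    unfolding set_lebesgue_integral_def
  proof (rule integral_mono)
    show "integrable lborel (\<lambda>y. w1 ^ m * \<delta> * (indicator (ball x r') y *\<^sub>R S y) - w0 ^ m * (indicator D y *\<^sub>R \<bar>h y\<bar>))"
      using int1 set_integrable_abs[OF h] unfolding set_integrable_def by auto
    show "integrable lborel (\<lambda>y. indicator D y *\<^sub>R (S y * W y ^ m * h y))"
      unfolding set_integrable_def[symmetric]
    proof (rule set_integrable_bound[OF h])
      have "continuous_on D (\<lambda>y. S y * W y ^ m)"
        using W(1) by (intro continuous_intros S(1) continuous_on_subset[OF W(1) closure_subset])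
      then have 1: "(\<lambda>y. indicator D y *\<^sub>R (S y * W y ^ m)) \<in> borel_measurable borel"
        using D by (intro borel_measurable_continuous_on_indicator) auto
      have 2: "(\<lambda>y. indicator D y *\<^sub>R h y) \<in> borel_measurable borel"
        using h unfolding set_integrable_def by (simp add: borel_measurable_integrable)
      have "(\<lambda>y. indicator D y *\<^sub>R (S y * W y ^ m * h y)) = (\<lambda>y. (indicator D y *\<^sub>R (S y * W y ^ m)) * (indicator D y *\<^sub>R h y))"
        by (auto simp: indicator_def)
      then show "set_borel_measurable lborel D (\<lambda>y. S y * W y ^ m * h y)"
        unfolding set_borel_measurable_def using borel_measurable_times[OF 1 2] by simp
      show "AE y\<in>D in lborel. norm (S y * W y ^ m * h y) \<le> norm (h y)"
      proof (intro AE_I2 impI)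
        fix y assume y: "y \<in> D"
        have "\<bar>S y\<bar> * \<bar>W y ^ m\<bar> * \<bar>h y\<bar> \<le> 1 * 1 * \<bar>h y\<bar>"
          using S(2,3)[OF y] W(3)[OF y] W1[OF y] by (intro mult_right_mono mult_mono) (auto simp: power_le_one)
        then show "norm (S y * W y ^ m * h y) \<le> norm (h y)" by (simp add: abs_mult)
      qed
    qed
    fix y
    show "w1 ^ m * \<delta> * (indicator (ball x r') y *\<^sub>R S y) - w0 ^ m * (indicator D y *\<^sub>R \<bar>h y\<bar>)
      \<le> indicator D y *\<^sub>R (S y * W y ^ m * h y)"
    proof (cases "y \<in> D")
      case False
      then have "y \<notin> ball x r'" using r r' by blast
      then show ?thesis using False by simp
    next
      case True
      note s = S(2,3)[OF True] W(3)[OF True]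
      consider "y \<in> ball x r'" | "y \<in> ball x r" "y \<notin> ball x r'" | "y \<notin> ball x r" by blast
      then show ?thesis
      proof cases
        case 1
        have "w1 ^ m * \<delta> * S y \<le> W y ^ m * h y * S y"
          using Wr'[OF 1] r' 1 s r w1 by (intro mult_right_mono mult_mono power_mono) auto
        moreover have "0 \<le> w0 ^ m * \<bar>h y\<bar>" using w0 by simp
        ultimately show ?thesis using 1 True by (simp add: algebra_simps)
      next
        case 2
        have "0 \<le> S y * W y ^ m * h y" using s r(1) r(4)[OF 2(1)] by (intro mult_nonneg_nonneg) auto
        moreover have "0 \<le> w0 ^ m * \<bar>h y\<bar>" using w0 by simp
        ultimately show ?thesis using 2 True by (simp add: algebra_simps)
      next
        case 3
        have n: "y \<notin> ball x r'" using 3 r' by blast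
        have "\<bar>S y\<bar> * \<bar>W y ^ m\<bar> * \<bar>h y\<bar> \<le> 1 * w0 ^ m * \<bar>h y\<bar>"
          using s w0(1) w0(3)[of y] True 3 by (intro mult_right_mono mult_mono) (auto simp: power_mono)
        then have "\<bar>S y * W y ^ m * h y\<bar> \<le> w0 ^ m * \<bar>h y\<bar>" by (simp add: abs_mult)
        then show ?thesis using n True by simp
      qed
    qed
  qed
  finally show ?thesis by blast
qed

section \<open>Functions vanishing on the boundary of a box have zero trace\<close>

text \<open>A \<open>C\<^sup>1\<close> substitute for \<open>max 0 (s - \<epsilon>)\<close>: it vanishes for \<open>s \<le> \<epsilon>\<close> and equals \<open>(s - \<epsilon>)\<^sup>2 / s\<close> beyond.\<close>

definition soft_cut :: "real \<Rightarrow> real \<Rightarrow> real" where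
  "soft_cut \<epsilon> s = max \<epsilon> s - 2 * \<epsilon> + \<epsilon>\<^sup>2 / max \<epsilon> s"

definition soft_cut_deriv :: "real \<Rightarrow> real \<Rightarrow> real" where
  "soft_cut_deriv \<epsilon> s = 1 - (\<epsilon> / max \<epsilon> s)\<^sup>2"

lemma soft_cut_eq_0: "0 < \<epsilon> \<Longrightarrow> s \<le> \<epsilon> \<Longrightarrow> soft_cut \<epsilon> s = 0"
  by (simp add: soft_cut_def power2_eq_square)

lemma soft_cut_has_derivative:
  assumes \<epsilon>: "0 < \<epsilon>"
  shows "(soft_cut \<epsilon> has_real_derivative soft_cut_deriv \<epsilon> s) (at s)"
proof -
  consider "s < \<epsilon>" | "s = \<epsilon>" | "\<epsilon> < s" by linarith
  then show ?thesis
  proof cases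
    case 1
    have "\<forall>\<^sub>F x in nhds s. x < \<epsilon>" using 1 by (intro eventually_nhds_in_open[of "{..<\<epsilon>}" s, simplified]) auto
    then have "\<forall>\<^sub>F x in nhds s. soft_cut \<epsilon> x = 0"
      by eventually_elim (use soft_cut_eq_0 \<epsilon> in auto)
    then have "(soft_cut \<epsilon> has_real_derivative 0) (at s)"
      by (subst DERIV_cong_ev[OF refl _ refl]) auto
    then show ?thesis using 1 \<epsilon> by (simp add: soft_cut_deriv_def)
  next
    case 3
    have "\<forall>\<^sub>F x in nhds s. \<epsilon> < x" using 3 by (intro eventually_nhds_in_open[of "{\<epsilon><..}" s, simplified]) auto
    then have "\<forall>\<^sub>F x in nhds s. soft_cut \<epsilon> x = x - 2 * \<epsilon> + \<epsilon>\<^sup>2 / x"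
      by eventually_elim (auto simp: soft_cut_def max_def)
    moreover have "((\<lambda>x. x - 2 * \<epsilon> + \<epsilon>\<^sup>2 / x) has_real_derivative 1 - (\<epsilon> / s)\<^sup>2) (at s)"
      using 3 \<epsilon> by (auto intro!: derivative_eq_intros simp: power2_eq_square)
    ultimately have "(soft_cut \<epsilon> has_real_derivative 1 - (\<epsilon> / s)\<^sup>2) (at s)"
      by (subst DERIV_cong_ev[OF refl _ refl]) auto
    then show ?thesis using 3 by (simp add: soft_cut_deriv_def max_def)
  next
    case 2
    \<comment> \<open>At the junction both one-sided derivatives are 0, since the function is of second order there.\<close>
    have bd: "\<bar>soft_cut \<epsilon> (\<epsilon> + h)\<bar> \<le> h\<^sup>2 / \<epsilon>" for h
    proof (cases "h \<le> 0")
      case True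
      then show ?thesis using \<epsilon> soft_cut_eq_0[of \<epsilon> "\<epsilon> + h"] by simp
    next
      case False
      then have "soft_cut \<epsilon> (\<epsilon> + h) = h\<^sup>2 / (\<epsilon> + h)"
        using \<epsilon> by (simp add: soft_cut_def max_def field_simps power2_eq_square)
      also have "\<dots> \<le> h\<^sup>2 / \<epsilon>" using False \<epsilon> by (intro divide_left_mono) auto
      finally show ?thesis using False \<epsilon> \<open>soft_cut \<epsilon> (\<epsilon> + h) = h\<^sup>2 / (\<epsilon> + h)\<close> by simp
    qed
    have "(\<lambda>h. (soft_cut \<epsilon> (\<epsilon> + h) - soft_cut \<epsilon> \<epsilon>) / h) \<midarrow>0\<rightarrow> 0"
    proof (rule Lim_null_comparison)
      show "\<forall>\<^sub>F h in at 0. norm ((soft_cut \<epsilon> (\<epsilon> + h) - soft_cut \<epsilon> \<epsilon>) / h) \<le> \<bar>h\<bar> / \<epsilon>"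
      proof (rule eventually_at_filter[THEN iffD2], rule always_eventually, intro allI impI)
        fix h :: real assume "h \<noteq> 0"
        then have "\<bar>soft_cut \<epsilon> (\<epsilon> + h)\<bar> / \<bar>h\<bar> \<le> (h\<^sup>2 / \<epsilon>) / \<bar>h\<bar>" using bd by (intro divide_right_mono) auto
        also have "\<dots> = \<bar>h\<bar> / \<epsilon>" using \<open>h \<noteq> 0\<close> \<epsilon> by (simp add: field_simps power2_eq_square abs_if)
        finally show "norm ((soft_cut \<epsilon> (\<epsilon> + h) - soft_cut \<epsilon> \<epsilon>) / h) \<le> \<bar>h\<bar> / \<epsilon>"
          using \<epsilon> soft_cut_eq_0[of \<epsilon> \<epsilon>] by (simp add: abs_divide)
      qed
      have "((\<lambda>h. \<bar>h\<bar> / \<epsilon>) \<longlongrightarrow> \<bar>0\<bar> / \<epsilon>) (at 0)" by (intro tendsto_intros) (use \<epsilon> in auto)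
      then show "((\<lambda>h. \<bar>h\<bar> / \<epsilon>) \<longlongrightarrow> 0) (at 0)" by simp
    qed
    then show ?thesis using 2 \<epsilon> by (simp add: DERIV_def soft_cut_deriv_def)
  qed
qed

lemma soft_cut_close:
  assumes \<epsilon>: "0 < \<epsilon>" and s: "0 < s"
  shows "\<bar>soft_cut \<epsilon> s - s\<bar> \<le> 2 * \<epsilon>" "\<bar>soft_cut_deriv \<epsilon> s - 1\<bar> \<le> 1"
proof -
  show "\<bar>soft_cut \<epsilon> s - s\<bar> \<le> 2 * \<epsilon>"
  proof (cases "s \<le> \<epsilon>")
    case True
    then show ?thesis using soft_cut_eq_0[OF \<epsilon> True] s \<epsilon> by simp
  next
    case False
    then have "\<epsilon>\<^sup>2 / s \<le> \<epsilon>\<^sup>2 / \<epsilon>" "0 \<le> \<epsilon>\<^sup>2 / s" using \<epsilon> by (auto intro!: divide_left_mono)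
    then show ?thesis using False \<epsilon> by (simp add: soft_cut_def max_def power2_eq_square)
  qed
  have "0 \<le> \<epsilon> / max \<epsilon> s" "\<epsilon> / max \<epsilon> s \<le> 1" using \<epsilon> by (auto simp: max_def)
  then have "(\<epsilon> / max \<epsilon> s)\<^sup>2 \<le> 1" by (simp add: power_le_one)
  then show "\<bar>soft_cut_deriv \<epsilon> s - 1\<bar> \<le> 1" by (simp add: soft_cut_deriv_def)
qed

lemma soft_cut_cont:
  assumes "0 < \<epsilon>"
  shows "continuous_on A (soft_cut \<epsilon>)" "continuous_on A (soft_cut_deriv \<epsilon>)"
proof -
  have "max \<epsilon> s \<noteq> 0" for s using assms by (simp add: max_def)
  then show "continuous_on A (soft_cut \<epsilon>)" "continuous_on A (soft_cut_deriv \<epsilon>)"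
    unfolding soft_cut_def soft_cut_deriv_def by (auto intro!: continuous_intros)
qed

lemma continuous_bounded_family:
  fixes p Lp :: "'a::euclidean_space \<Rightarrow> real" and dp :: "'a \<Rightarrow> 'a \<Rightarrow> real"
  assumes "compact K" "continuous_on K p" "\<And>e. e \<in> Basis \<Longrightarrow> continuous_on K (dp e)" "continuous_on K Lp"
  obtains C where "\<And>y. y \<in> K \<Longrightarrow> \<bar>p y\<bar> \<le> C" "\<And>y e. y \<in> K \<Longrightarrow> e \<in> Basis \<Longrightarrow> \<bar>dp e y\<bar> \<le> C"
    "\<And>y. y \<in> K \<Longrightarrow> \<bar>Lp y\<bar> \<le> C"
proof -
  have "continuous_on K (\<lambda>y. \<bar>p y\<bar> + (\<Sum>e\<in>Basis. \<bar>dp e y\<bar>) + \<bar>Lp y\<bar>)"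
    by (intro continuous_intros assms)
  then have "bounded ((\<lambda>y. \<bar>p y\<bar> + (\<Sum>e\<in>Basis. \<bar>dp e y\<bar>) + \<bar>Lp y\<bar>) ` K)"
    using assms(1) by (intro compact_imp_bounded compact_continuous_image)
  then obtain C where C: "\<And>y. y \<in> K \<Longrightarrow> \<bar>p y\<bar> + (\<Sum>e\<in>Basis. \<bar>dp e y\<bar>) + \<bar>Lp y\<bar> \<le> C"
    unfolding bounded_iff by force
  have s: "0 \<le> (\<Sum>e\<in>Basis. \<bar>dp e y\<bar>)" "\<And>e. e \<in> Basis \<Longrightarrow> \<bar>dp e y\<bar> \<le> (\<Sum>e\<in>Basis. \<bar>dp e y\<bar>)" for y
    by (auto intro!: sum_nonneg member_le_sum)
  show thesis
  proof (rule that[of C])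
    fix y assume y: "y \<in> K"
    show "\<bar>p y\<bar> \<le> C" using C[OF y] s(1)[of y] by linarith
    show "\<bar>Lp y\<bar> \<le> C" using C[OF y] s(1)[of y] by linarith
    show "\<bar>dp e y\<bar> \<le> C" if "e \<in> Basis" for e using C[OF y] s(2)[OF that, of y] by linarith
  qed
qed

text \<open>The functions \<open>soft_cut \<epsilon> \<circ> q\<close> approximate \<open>q\<close>. Each of them is supported where \<open>q \<ge> \<epsilon>\<close>, a compact
subset of the open box since \<open>q\<close> vanishes on the faces; dominated convergence gives the limit in \<open>H\<^sup>1\<close>.\<close>

lemma zero_trace_box:
  fixes q :: "'a::euclidean_space \<Rightarrow> real" and dq ddq :: "'a \<Rightarrow> 'a \<Rightarrow> real"
  defines "\<epsilon> \<equiv> \<lambda>k::nat. 1 / (real k + 1)"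
  assumes q_cont: "continuous_on UNIV q" "\<And>e. e \<in> Basis \<Longrightarrow> continuous_on UNIV (dq e)"
      "\<And>e. e \<in> Basis \<Longrightarrow> continuous_on UNIV (ddq e)"
    and q_deriv: "\<And>e y. e \<in> Basis \<Longrightarrow> dir_deriv q e (dq e y) y"
      "\<And>e y. e \<in> Basis \<Longrightarrow> dir_deriv (dq e) e (ddq e y) y"
    and q_pos: "\<And>y. y \<in> box (- a) a \<Longrightarrow> 0 < q y"
    and q_zero: "\<And>y. y \<in> cbox (- a) a \<Longrightarrow> y \<notin> box (- a) a \<Longrightarrow> q y = 0"
  shows "zero_trace (box (- a) a) q dq ddq (\<lambda>k y. soft_cut (\<epsilon> k) (q y)) (\<lambda>k e y. soft_cut_deriv (\<epsilon> k) (q y) * dq e y)"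
proof -
  let ?V = "box (- a) a" and ?K = "cbox (- a) a"
  have VK: "?V \<subseteq> ?K" by (rule box_subset_cbox)
  have \<epsilon>: "0 < \<epsilon> k" "\<epsilon> k \<le> 1" for k by (auto simp: \<epsilon>_def)
  have \<epsilon>0: "\<epsilon> \<longlonglongrightarrow> 0" unfolding \<epsilon>_def using LIMSEQ_inverse_real_of_nat by (simp add: inverse_eq_divide add.commute)
  have cut_cont: "continuous_on UNIV (\<lambda>y. soft_cut (\<epsilon> k) (q y))" "continuous_on UNIV (\<lambda>y. soft_cut_deriv (\<epsilon> k) (q y))" for k
    using continuous_on_compose2[OF soft_cut_cont(1)[OF \<epsilon>(1)] q_cont(1)]
      continuous_on_compose2[OF soft_cut_cont(2)[OF \<epsilon>(1)] q_cont(1)] by auto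
  define L where "L = (\<lambda>y. (\<Sum>e\<in>Basis. ddq e y))"
  have L: "continuous_on UNIV L" unfolding L_def by (intro continuous_intros q_cont)
  obtain C where C: "\<And>y. y \<in> ?K \<Longrightarrow> \<bar>q y\<bar> \<le> C" "\<And>y e. y \<in> ?K \<Longrightarrow> e \<in> Basis \<Longrightarrow> \<bar>dq e y\<bar> \<le> C"
    "\<And>y. y \<in> ?K \<Longrightarrow> \<bar>L y\<bar> \<le> C"
    using continuous_bounded_family[of ?K q dq L]
      continuous_on_subset[OF L subset_UNIV] continuous_on_subset[OF q_cont(1) subset_UNIV]
      continuous_on_subset[OF q_cont(2) subset_UNIV] by (metis compact_cbox)
  define E where "E = (\<lambda>k y. (soft_cut (\<epsilon> k) (q y) - q y)\<^sup>2 + (\<Sum>e\<in>Basis. (soft_cut_deriv (\<epsilon> k) (q y) * dq e y - dq e y)\<^sup>2))"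
  have E_cont: "continuous_on UNIV (E k)" for k
    unfolding E_def by (intro continuous_intros cut_cont q_cont)
  define W where "W = 4 + DIM('a) * C\<^sup>2"
  have E_bound: "E k y \<le> W" if y: "y \<in> ?V" for k y
  proof -
    note sc = soft_cut_close[OF \<epsilon>(1)[of k] q_pos[OF y]]
    have "\<bar>soft_cut (\<epsilon> k) (q y) - q y\<bar> \<le> 2" using sc(1) \<epsilon>(2)[of k] by linarith
    then have 1: "(soft_cut (\<epsilon> k) (q y) - q y)\<^sup>2 \<le> 2\<^sup>2" by (subst abs_le_square_iff[symmetric]) simp
    have "(\<Sum>e\<in>Basis. (soft_cut_deriv (\<epsilon> k) (q y) * dq e y - dq e y)\<^sup>2) \<le> (\<Sum>e\<in>(Basis::'a set). C\<^sup>2)"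
    proof (rule sum_mono)
      fix e :: 'a assume e: "e \<in> Basis"
      have "\<bar>soft_cut_deriv (\<epsilon> k) (q y) * dq e y - dq e y\<bar> = \<bar>soft_cut_deriv (\<epsilon> k) (q y) - 1\<bar> * \<bar>dq e y\<bar>"
        by (simp add: abs_mult[symmetric] algebra_simps)
      also have "\<dots> \<le> 1 * C" using sc(2) C(2)[OF _ e] y VK by (intro mult_mono) auto
      finally show "(soft_cut_deriv (\<epsilon> k) (q y) * dq e y - dq e y)\<^sup>2 \<le> C\<^sup>2"
        by (subst abs_le_square_iff[symmetric]) simp
    qed
    with 1 show ?thesis by (simp add: E_def W_def)
  qed
  have E_lim: "(\<lambda>k. E k y) \<longlonglongrightarrow> 0" if y: "y \<in> ?V" for y
  proof -
    have m: "(\<lambda>k. max (\<epsilon> k) (q y)) \<longlonglongrightarrow> q y"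
      using tendsto_max[OF \<epsilon>0 tendsto_const[of "q y"]] q_pos[OF y] by simp
    have "(\<lambda>k. E k y) \<longlonglongrightarrow> (q y - 2 * 0 + 0\<^sup>2 / q y - q y)\<^sup>2 + (\<Sum>e\<in>Basis. ((1 - (0 / q y)\<^sup>2) * dq e y - dq e y)\<^sup>2)"
      unfolding E_def soft_cut_def soft_cut_deriv_def using q_pos[OF y] by (intro tendsto_intros m \<epsilon>0) auto
    then show ?thesis by simp
  qed
  have fin: "emeasure lborel ?V < \<infinity>" by (intro emeasure_bounded_finite bounded_box)
  have "(\<lambda>k. \<integral>\<^sup>+y. ennreal (E k y) * indicator ?V y \<partial>lborel) \<longlonglongrightarrow> nn_integral lborel (\<lambda>y::'a. 0)"
  proof (rule nn_integral_dominated_convergence[where w="\<lambda>y. ennreal W * indicator ?V y"])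
    show "(\<lambda>y. ennreal (E k y) * indicator ?V y) \<in> borel_measurable lborel" for k
      using borel_measurable_continuous_onI[OF E_cont[of k]] by measurable
    show "(\<integral>\<^sup>+y. ennreal W * indicator ?V y \<partial>lborel) < \<infinity>"
      using fin by (simp add: nn_integral_cmult ennreal_mult_less_top)
    show "AE y in lborel. ennreal (E k y) * indicator ?V y \<le> ennreal W * indicator ?V y" for k
      using E_bound by (intro AE_I2) (auto simp: indicator_def intro!: ennreal_leI)
    show "AE y in lborel. (\<lambda>k. ennreal (E k y) * indicator ?V y) \<longlonglongrightarrow> 0"
      using tendsto_ennrealI[OF E_lim] by (intro AE_I2) (auto simp: indicator_def)
  qed auto
  then have approx: "(\<lambda>k. \<integral>\<^sup>+y\<in>?V. ennreal (E k y) \<partial>lborel) \<longlonglongrightarrow> 0" by simp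
  show ?thesis
  proof (rule zero_trace.intro)
    show "open ?V" "bounded ?V" by (rule open_box, rule bounded_box)
    show "(\<lambda>k. \<integral>\<^sup>+y\<in>?V. ennreal ((soft_cut (\<epsilon> k) (q y) - q y)\<^sup>2 + (\<Sum>e\<in>Basis. (soft_cut_deriv (\<epsilon> k) (q y) * dq e y - dq e y)\<^sup>2)) \<partial>lborel) \<longlonglongrightarrow> 0"
      using approx by (simp add: E_def)
    show "\<exists>Z. compact Z \<and> Z \<subseteq> ?V \<and> (\<forall>y\<in>?V - Z. soft_cut (\<epsilon> k) (q y) = 0)" for k
    proof (intro exI conjI ballI)
      have "closed {y. \<epsilon> k \<le> q y}" using q_cont(1) by (intro closed_Collect_le continuous_intros)
      then show "compact (?K \<inter> {y. \<epsilon> k \<le> q y})" by (intro compact_Int_closed compact_cbox)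
      show "?K \<inter> {y. \<epsilon> k \<le> q y} \<subseteq> ?V"
      proof
        fix y assume y: "y \<in> ?K \<inter> {y. \<epsilon> k \<le> q y}"
        then have "q y \<noteq> 0" using \<epsilon>(1)[of k] by auto
        then show "y \<in> ?V" using q_zero y by blast
      qed
      fix y assume "y \<in> ?V - (?K \<inter> {y. \<epsilon> k \<le> q y})"
      then have "q y \<le> \<epsilon> k" using VK by auto
      then show "soft_cut (\<epsilon> k) (q y) = 0" using \<epsilon>(1) soft_cut_eq_0 by blast
    qed
    show "dir_deriv (\<lambda>y. soft_cut (\<epsilon> k) (q y)) e (soft_cut_deriv (\<epsilon> k) (q y) * dq e y) y" if "e \<in> Basis" for k e y
      using DERIV_chain2[of "soft_cut (\<epsilon> k)" "soft_cut_deriv (\<epsilon> k) (q y)" "\<lambda>s. q (y + s *\<^sub>R e)" 0 "dq e y" UNIV]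
        soft_cut_has_derivative[OF \<epsilon>(1)[of k], of "q y"] q_deriv(1)[OF that, of y] by simp
    show "set_integrable lborel ?V (\<lambda>y. (\<Sum>e\<in>Basis. ddq e y)\<^sup>2)"
    proof (rule set_integrable_continuous_bound)
      show "continuous_on ?V (\<lambda>y. (\<Sum>e\<in>Basis. ddq e y)\<^sup>2)"
        by (intro continuous_intros continuous_on_subset[OF q_cont(3) subset_UNIV])
      show "set_integrable lborel ?V (\<lambda>_. C\<^sup>2)" by (rule set_integrable_const_bounded) (auto simp: open_box bounded_box)
      fix y assume "y \<in> ?V"
      then have "\<bar>L y\<bar> \<le> C" using C(3) VK by auto
      then have "(L y)\<^sup>2 \<le> C\<^sup>2" by (subst abs_le_square_iff[symmetric]) simp
      then show "\<bar>(\<Sum>e\<in>Basis. ddq e y)\<^sup>2\<bar> \<le> C\<^sup>2" by (simp add: L_def)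
    qed (rule open_box)
    show "continuous_on ?V (\<lambda>y. soft_cut (\<epsilon> k) (q y))" for k
      by (rule continuous_on_subset[OF cut_cont(1) subset_UNIV])
    show "continuous_on ?V (\<lambda>y. soft_cut_deriv (\<epsilon> k) (q y) * dq e y)" if "e \<in> Basis" for k e
      by (intro continuous_intros continuous_on_subset[OF cut_cont(2) subset_UNIV] continuous_on_subset[OF q_cont(2)[OF that] subset_UNIV])
  qed (simp_all add: q_deriv continuous_on_subset[OF q_cont(1) subset_UNIV]
      continuous_on_subset[OF q_cont(2) subset_UNIV] continuous_on_subset[OF q_cont(3) subset_UNIV])
qed

section \<open>Pairing an eigenfunction with the heat flow\<close>

text \<open>The derivative of the quantity that is monotone along the flow: \<open>\<partial>\<^sub>t q = \<Delta>q\<close> holds for each mode.\<close>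

lemma heat_pairing_deriv:
  fixes b :: "'a::euclidean_space"
  assumes V: "open V" "bounded V" and \<phi>: "set_integrable lborel V \<phi>" and I: "finite I"
  shows "((\<lambda>t. exp (lam * t) * (LINT y:V|lborel. \<phi> y * box_heat b I C t y)) has_real_derivative
     exp (lam * t) * (LINT y:V|lborel. lam * \<phi> y * box_heat b I C t y + \<phi> y * (\<Sum>e\<in>Basis. box_heat_deriv2 b I C t e y))) (at t)"
proof -
  define A where "A = (\<lambda>\<kappa>. LINT y:V|lborel. \<phi> y * sine_mode b \<kappa> y)"
  have int: "set_integrable lborel V (\<lambda>y. \<phi> y * sine_mode b \<kappa> y)" for \<kappa>
    by (rule set_integrable_mult_continuous[OF \<phi> sine_mode_cont(1) V(2)])
  have lin: "(LINT y:V|lborel. (\<Sum>\<kappa>\<in>I. a \<kappa> * (\<phi> y * sine_mode b \<kappa> y))) = (\<Sum>\<kappa>\<in>I. a \<kappa> * A \<kappa>)" for a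
    unfolding A_def by (subst set_integral_sum) (auto intro: int)
  have ee: "exp ((lam - mode_eigenvalue b \<kappa>) * t) = exp (lam * t) * exp (- mode_eigenvalue b \<kappa> * t)" for \<kappa> t
    by (simp add: exp_add[symmetric] algebra_simps)
  have 1: "exp (lam * t) * (LINT y:V|lborel. \<phi> y * box_heat b I C t y)
     = (\<Sum>\<kappa>\<in>I. C \<kappa> * A \<kappa> * exp ((lam - mode_eigenvalue b \<kappa>) * t))" for t
  proof -
    have "(LINT y:V|lborel. \<phi> y * box_heat b I C t y)
      = (LINT y:V|lborel. (\<Sum>\<kappa>\<in>I. (C \<kappa> * exp (- mode_eigenvalue b \<kappa> * t)) * (\<phi> y * sine_mode b \<kappa> y)))"
    proof (intro set_lebesgue_integral_cong allI impI)
      show "\<phi> y * box_heat b I C t y = (\<Sum>\<kappa>\<in>I. (C \<kappa> * exp (- mode_eigenvalue b \<kappa> * t)) * (\<phi> y * sine_mode b \<kappa> y))" for y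
        unfolding box_heat_def sum_distrib_left by (intro sum.cong refl) (simp add: algebra_simps)
    qed (use V in simp)
    also have "\<dots> = (\<Sum>\<kappa>\<in>I. (C \<kappa> * exp (- mode_eigenvalue b \<kappa> * t)) * A \<kappa>)" by (rule lin)
    finally show ?thesis
      unfolding sum_distrib_left ee by (simp add: sum_distrib_left mult_ac)
  qed
  have 2: "exp (lam * t) * (LINT y:V|lborel. lam * \<phi> y * box_heat b I C t y + \<phi> y * (\<Sum>e\<in>Basis. box_heat_deriv2 b I C t e y))
     = (\<Sum>\<kappa>\<in>I. C \<kappa> * A \<kappa> * (exp ((lam - mode_eigenvalue b \<kappa>) * t) * (lam - mode_eigenvalue b \<kappa>)))"
  proof -
    have "(LINT y:V|lborel. lam * \<phi> y * box_heat b I C t y + \<phi> y * (\<Sum>e\<in>Basis. box_heat_deriv2 b I C t e y))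
      = (LINT y:V|lborel. (\<Sum>\<kappa>\<in>I. (C \<kappa> * exp (- mode_eigenvalue b \<kappa> * t) * (lam - mode_eigenvalue b \<kappa>)) * (\<phi> y * sine_mode b \<kappa> y)))"
    proof (intro set_lebesgue_integral_cong allI impI)
      show "lam * \<phi> y * box_heat b I C t y + \<phi> y * (\<Sum>e\<in>Basis. box_heat_deriv2 b I C t e y)
        = (\<Sum>\<kappa>\<in>I. (C \<kappa> * exp (- mode_eigenvalue b \<kappa> * t) * (lam - mode_eigenvalue b \<kappa>)) * (\<phi> y * sine_mode b \<kappa> y))" for y
        unfolding box_heat_laplacian box_heat_def sum_distrib_left sum.distrib[symmetric]
        by (intro sum.cong refl) (simp add: algebra_simps)
    qed (use V in simp)
    also have "\<dots> = (\<Sum>\<kappa>\<in>I. (C \<kappa> * exp (- mode_eigenvalue b \<kappa> * t) * (lam - mode_eigenvalue b \<kappa>)) * A \<kappa>)" by (rule lin)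
    finally show ?thesis
      unfolding sum_distrib_left ee by (simp add: sum_distrib_left mult_ac)
  qed
  show ?thesis unfolding 1 2
    by (intro DERIV_sum DERIV_cmult) (auto intro!: derivative_eq_intros)
qed

text \<open>Positivity, the equation and zero boundary values drive the comparison with heat flows. Positivity also ties
\<open>lam\<close> to the ground eigenvalues of the boxes.\<close>

locale positive_eigenfunction = zero_trace +
  fixes lam :: real
  assumes u_pos: "\<And>y. y \<in> V \<Longrightarrow> 0 < u y"
    and eigen: "\<And>y. y \<in> V \<Longrightarrow> (\<Sum>e\<in>Basis. ddu e y) = - lam * u y"
    and nonempty: "V \<noteq> {}"
begin

lemma set_integrable_u: "set_integrable lborel V u"
  by (rule set_integrable_continuous_bound[OF open_V u_cont(1) u_int]) simp

text \<open>Green's inequality for the eigenfunction \<open>u\<close>, which vanishes on the boundary of \<open>V\<close>, against the flow,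
which is smooth on the whole space; the box may be any box on which the flow is nonnegative over \<open>V\<close>.\<close>

lemma box_heat_pairing_nonneg:
  assumes p: "\<And>y. y \<in> V \<Longrightarrow> 0 \<le> box_heat b I C t y"
  shows "0 \<le> (LINT y:V|lborel. lam * u y * box_heat b I C t y + u y * (\<Sum>e\<in>Basis. box_heat_deriv2 b I C t e y))"
proof -
  let ?p = "box_heat b I C t" and ?dp = "box_heat_deriv b I C t" and ?ddp = "box_heat_deriv2 b I C t"
  have "continuous_on (closure V) (\<lambda>y. \<Sum>e\<in>Basis. ?ddp e y)" by (intro continuous_intros box_heat_cont)
  then obtain M where M: "\<And>y. y \<in> closure V \<Longrightarrow> \<bar>?p y\<bar> \<le> M" "\<And>y e. y \<in> closure V \<Longrightarrow> e \<in> Basis \<Longrightarrow> \<bar>?dp e y\<bar> \<le> M"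
    "\<And>y. y \<in> closure V \<Longrightarrow> \<bar>\<Sum>e\<in>Basis. ?ddp e y\<bar> \<le> M"
    using continuous_bounded_family[of "closure V" ?p ?dp "\<lambda>y. \<Sum>e\<in>Basis. ?ddp e y"] bounded_V box_heat_cont
    by (metis compact_closure)
  have "(LINT y:V|lborel. ?p y * (\<Sum>e\<in>Basis. ddu e y) - u y * (\<Sum>e\<in>Basis. ?ddp e y)) \<le> 0"
  proof (rule green_inequality[where C=M and dp="?dp"])
    fix y assume "y \<in> V"
    then have y: "y \<in> closure V" using closure_subset by blast
    show "?p y \<le> M" "\<bar>\<Sum>e\<in>Basis. ?ddp e y\<bar> \<le> M" using M(1,3)[OF y] by auto
    show "\<bar>?dp e y\<bar> \<le> M" if "e \<in> Basis" for e by (rule M(2)[OF y that])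
  qed (use p u_pos in \<open>auto intro!: box_heat_cont box_heat_dir_deriv\<close>)
  moreover have "(LINT y:V|lborel. ?p y * (\<Sum>e\<in>Basis. ddu e y) - u y * (\<Sum>e\<in>Basis. ?ddp e y))
     = (LINT y:V|lborel. - (lam * u y * ?p y + u y * (\<Sum>e\<in>Basis. ?ddp e y)))"
    by (intro set_lebesgue_integral_cong) (use open_V eigen in auto)
  ultimately show ?thesis
    by (simp add: set_lebesgue_integral_def Bochner_Integration.integral_minus del: minus_add_distrib)
qed

lemma box_heat_flow_up:
  assumes I: "finite I" and T: "0 \<le> T" and p: "\<And>t y. 0 \<le> t \<Longrightarrow> y \<in> V \<Longrightarrow> 0 \<le> box_heat b I C t y"
  shows "(LINT y:V|lborel. u y * box_heat b I C 0 y) \<le> exp (lam * T) * (LINT y:V|lborel. u y * box_heat b I C T y)"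
proof -
  let ?F = "\<lambda>t. exp (lam * t) * (LINT y:V|lborel. u y * box_heat b I C t y)"
  have "?F 0 \<le> ?F T"
  proof (rule DERIV_nonneg_imp_nondecreasing[OF T])
    fix t :: real assume "0 \<le> t"
    then show "\<exists>d. (?F has_real_derivative d) (at t) \<and> 0 \<le> d"
      using heat_pairing_deriv[OF open_V bounded_V set_integrable_u I] box_heat_pairing_nonneg[OF p] by fastforce
  qed
  then show ?thesis by simp
qed

text \<open>Green's inequality with the roles exchanged: now the flow vanishes on the faces of the box, and \<open>u\<close> is smooth
up to them because the closed box lies in \<open>V\<close>.\<close>

lemma box_heat_pairing_nonpos:
  assumes a: "\<And>e. e \<in> Basis \<Longrightarrow> 0 < a \<bullet> e" and aV: "cbox (- a) a \<subseteq> V"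
    and q: "\<And>y. y \<in> box (- a) a \<Longrightarrow> 0 < box_heat a I C t y"
  shows "(LINT y:box (- a) a|lborel. lam * u y * box_heat a I C t y + u y * (\<Sum>e\<in>Basis. box_heat_deriv2 a I C t e y)) \<le> 0"
proof -
  let ?q = "box_heat a I C t" and ?dq = "box_heat_deriv a I C t" and ?ddq = "box_heat_deriv2 a I C t"
  let ?B = "box (- a) a"
  have BV: "?B \<subseteq> V" using aV box_subset_cbox by blast
  interpret q: zero_trace ?B ?q ?dq ?ddq "\<lambda>k y. soft_cut (1 / (real k + 1)) (?q y)"
    "\<lambda>k e y. soft_cut_deriv (1 / (real k + 1)) (?q y) * ?dq e y"
  proof (rule zero_trace_box)
    show "?q y = 0" if "y \<in> cbox (- a) a" "y \<notin> ?B" for y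
      unfolding box_heat_def using sine_mode_boundary[OF a that] by (simp add: sum.neutral)
  qed (use q in \<open>auto intro!: box_heat_cont box_heat_dir_deriv\<close>)
  have Lu: "continuous_on (cbox (- a) a) (\<lambda>y. \<Sum>e\<in>Basis. ddu e y)"
    by (intro continuous_intros continuous_on_subset[OF u_cont(3) aV])
  obtain M where M: "\<And>y. y \<in> cbox (- a) a \<Longrightarrow> \<bar>u y\<bar> \<le> M" "\<And>y e. y \<in> cbox (- a) a \<Longrightarrow> e \<in> Basis \<Longrightarrow> \<bar>du e y\<bar> \<le> M"
    "\<And>y. y \<in> cbox (- a) a \<Longrightarrow> \<bar>\<Sum>e\<in>Basis. ddu e y\<bar> \<le> M"
    using continuous_bounded_family[of "cbox (- a) a" u du "\<lambda>y. \<Sum>e\<in>Basis. ddu e y"]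
      continuous_on_subset[OF u_cont(1) aV] continuous_on_subset[OF u_cont(2) aV] Lu
    by (metis compact_cbox)
  have "(LINT y:?B|lborel. u y * (\<Sum>e\<in>Basis. ?ddq e y) - ?q y * (\<Sum>e\<in>Basis. ddu e y)) \<le> 0"
  proof (rule q.green_inequality[where C=M and dp=du])
    fix y assume y': "y \<in> ?B"
    then have y: "y \<in> cbox (- a) a" using box_subset_cbox by blast
    show "u y \<le> M" "\<bar>\<Sum>e\<in>Basis. ddu e y\<bar> \<le> M" using M(1,3)[OF y] by auto
    show "\<bar>du e y\<bar> \<le> M" if "e \<in> Basis" for e by (rule M(2)[OF y that])
    show "0 \<le> u y" using u_pos BV y' by force
    show "0 < ?q y" by (rule q[OF y'])
    show "dir_deriv u e (du e y) y" "dir_deriv (du e) e (ddu e y) y" if "e \<in> Basis" for e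
      using u_deriv[OF that] BV y' by auto
  qed (use u_cont continuous_on_subset[OF _ BV] in auto)
  moreover have "(LINT y:?B|lborel. u y * (\<Sum>e\<in>Basis. ?ddq e y) - ?q y * (\<Sum>e\<in>Basis. ddu e y))
     = (LINT y:?B|lborel. lam * u y * ?q y + u y * (\<Sum>e\<in>Basis. ?ddq e y))"
    by (intro set_lebesgue_integral_cong) (use eigen BV in auto)
  ultimately show ?thesis by simp
qed

lemma set_integrable_u_box:
  assumes "cbox (- a) a \<subseteq> V"
  shows "set_integrable lborel (box (- a) a) u"
  by (rule set_integrable_subset[OF set_integrable_u]) (use assms box_subset_cbox in auto)

lemma box_heat_flow_down:
  assumes a: "\<And>e. e \<in> Basis \<Longrightarrow> 0 < a \<bullet> e" and aV: "cbox (- a) a \<subseteq> V"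
    and I: "finite I" and T: "0 \<le> T" and q: "\<And>t y. 0 \<le> t \<Longrightarrow> y \<in> box (- a) a \<Longrightarrow> 0 < box_heat a I C t y"
  shows "exp (lam * T) * (LINT y:box (- a) a|lborel. u y * box_heat a I C T y) \<le> (LINT y:box (- a) a|lborel. u y * box_heat a I C 0 y)"
proof -
  let ?F = "\<lambda>t. exp (lam * t) * (LINT y:box (- a) a|lborel. u y * box_heat a I C t y)"
  have "?F T \<le> ?F 0"
  proof (rule DERIV_nonpos_imp_nonincreasing[OF T])
    fix t :: real assume "0 \<le> t"
    then have "(LINT y:box (- a) a|lborel. lam * u y * box_heat a I C t y + u y * (\<Sum>e\<in>Basis. box_heat_deriv2 a I C t e y)) \<le> 0"
      by (intro box_heat_pairing_nonpos a aV q)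
    then show "\<exists>d. (?F has_real_derivative d) (at t) \<and> d \<le> 0"
      using heat_pairing_deriv[OF open_box bounded_box set_integrable_u_box[OF aV] I, of lam a C t]
        mult_nonneg_nonpos[OF exp_ge_zero] by blast
  qed
  then show ?thesis by simp
qed

text \<open>The ground mode is the heat flow with a single coefficient at time 0, so the two pairing inequalities apply to it.\<close>

lemma ground_as_heat:
  "box_heat b {\<lambda>_. 1} (\<lambda>_. 1) 0 y = ground_mode b y"
  "(\<Sum>e\<in>Basis. box_heat_deriv2 b {\<lambda>_. 1} (\<lambda>_. 1) 0 e y) = - ground_eigenvalue b * ground_mode b y"
  unfolding box_heat_laplacian by (simp_all add: box_heat_def)

lemma set_integrable_u_ground:
  assumes "set_integrable lborel A u" "bounded A"
  shows "set_integrable lborel A (\<lambda>y. u y * ground_mode b y)"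
  by (rule set_integrable_mult_continuous[OF assms(1) sine_mode_cont(1) assms(2)])

lemma eigenvalue_ge:
  assumes b: "\<And>e. e \<in> Basis \<Longrightarrow> 0 < b \<bullet> e" and Vb: "V \<subseteq> box (- b) b"
  shows "ground_eigenvalue b \<le> lam"
proof -
  have pos: "0 < ground_mode b y" if "y \<in> V" for y using ground_mode_bounds(2)[OF b] Vb that by blast
  have "0 \<le> (LINT y:V|lborel. lam * u y * ground_mode b y + u y * (- ground_eigenvalue b * ground_mode b y))"
    using box_heat_pairing_nonneg[of b "{\<lambda>_. 1}" "\<lambda>_. 1" 0] pos unfolding ground_as_heat by (force intro: less_imp_le)
  also have "\<dots> = (LINT y:V|lborel. (lam - ground_eigenvalue b) * (u y * ground_mode b y))"
    by (intro set_lebesgue_integral_cong) (use open_V in \<open>auto simp: algebra_simps\<close>)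
  also have "\<dots> = (lam - ground_eigenvalue b) * (LINT y:V|lborel. u y * ground_mode b y)" by simp
  finally have "0 \<le> (lam - ground_eigenvalue b) * (LINT y:V|lborel. u y * ground_mode b y)" .
  moreover have "0 < (LINT y:V|lborel. u y * ground_mode b y)"
    using u_pos pos by (intro set_integral_pos open_V nonempty set_integrable_u_ground set_integrable_u bounded_V) auto
  ultimately show ?thesis by (simp add: zero_le_mult_iff)
qed

lemma eigenvalue_le:
  assumes a: "\<And>e. e \<in> Basis \<Longrightarrow> 0 < a \<bullet> e" and aV: "cbox (- a) a \<subseteq> V"
  shows "lam \<le> ground_eigenvalue a"
proof -
  let ?B = "box (- a) a"
  have pos: "0 < ground_mode a y" if "y \<in> ?B" for y using ground_mode_bounds(2)[OF a] that by blast
  have "(LINT y:?B|lborel. (lam - ground_eigenvalue a) * (u y * ground_mode a y)) =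
     (LINT y:?B|lborel. lam * u y * ground_mode a y + u y * (- ground_eigenvalue a * ground_mode a y))"
    by (intro set_lebesgue_integral_cong) (auto simp: algebra_simps)
  also have "\<dots> \<le> 0"
    using box_heat_pairing_nonpos[OF a aV, of "{\<lambda>_. 1}" "\<lambda>_. 1" 0] pos unfolding ground_as_heat by blast
  finally have "(lam - ground_eigenvalue a) * (LINT y:?B|lborel. u y * ground_mode a y) \<le> 0" by simp
  moreover have "0 < (LINT y:?B|lborel. u y * ground_mode a y)"
  proof (intro set_integral_pos open_box set_integrable_u_ground set_integrable_u_box aV bounded_box)
    show "?B \<noteq> {}" using a by (auto simp: box_ne_empty)
    show "0 < u y * ground_mode a y" if "y \<in> ?B" for y
      using pos[OF that] u_pos[of y] that aV box_subset_cbox by (intro mult_pos_pos) blast+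
  qed
  ultimately show ?thesis by (simp add: mult_le_0_iff)
qed

end

section \<open>Pointwise bounds in terms of the mass\<close>

text \<open>If \<open>h\<close> is continuous and positive at \<open>x\<close>, then one of the peaked initial data has a positive integral against
\<open>h\<close>.\<close>

lemma detecting_heat_flow:
  fixes b :: "'a::euclidean_space"
  assumes b: "\<And>e. e \<in> Basis \<Longrightarrow> 0 < b \<bullet> e" and x: "x \<in> box (- b) b"
    and h: "set_integrable lborel (box (- b) b) h" "isCont h x" "0 < h x"
  obtains I C \<gamma> where "controlled_flow b I C \<gamma>" "0 < (LINT y:box (- b) b|lborel. h y * box_heat b I C 0 y)"
proof -
  let ?D = "box (- b) b"
  have Dc: "y \<in> cbox (- b) b" if "y \<in> ?D" for y using that box_subset_cbox by blast
  define \<delta> where "\<delta> = h x / 2"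
  have \<delta>: "0 < \<delta>" using h(3) by (simp add: \<delta>_def)
  then obtain s where s: "0 < s" "\<And>y. dist y x < s \<Longrightarrow> \<bar>h y - h x\<bar> < \<delta>"
    using h(2) unfolding continuous_at_eps_delta dist_real_def by metis
  obtain r0 where r0: "0 < r0" "ball x r0 \<subseteq> ?D" using open_box x open_contains_ball by blast
  define r where "r = min r0 s"
  have hr: "\<delta> \<le> h y" if "y \<in> ball x r" for y
  proof -
    have "dist y x < s" using that by (simp add: r_def dist_commute)
    from s(2)[OF this] show ?thesis unfolding \<delta>_def by linarith
  qed
  have "\<exists>m. 0 < (LINT y:?D|lborel. ground_mode b y * peak b x y ^ m * h y)"
  proof (rule peaking_test_functions[where \<delta>=\<delta> and r=r and x=x])
    have cl: "closure ?D = cbox (- b) b" using x by (intro closure_box) auto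
    show "peak b x y < 1" if "y \<in> closure ?D" "y \<noteq> x" for y
      using peak_less_1[OF b Dc[OF x]] that unfolding cl by blast
    show "0 < ground_mode b y" "ground_mode b y \<le> 1" if "y \<in> ?D" for y
      using ground_mode_bounds(2)[OF b that] ground_mode_bounds(3)[OF b Dc[OF that]] by auto
    show "continuous_on (closure ?D) (peak b x)" by (rule peak_cont[OF b])
    show "peak b x x = 1" by (rule peak_at[OF b])
    show "0 \<le> peak b x y" for y by (rule peak_nonneg[OF b])
    show "0 < r" "ball x r \<subseteq> ?D" using r0 s by (auto simp: r_def)
  qed (use x h(1) \<delta> hr in \<open>auto simp: open_box bounded_box intro: sine_mode_cont\<close>)
  then obtain m where m: "0 < (LINT y:?D|lborel. ground_mode b y * peak b x y ^ m * h y)" by blast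
  obtain I C \<gamma> where flow: "controlled_flow b I C \<gamma>"
    and q0: "\<forall>y. box_heat b I C 0 y = ground_mode b y * peak b x y ^ m"
    using peaked_heat_flow[OF b x, of m] by blast
  have "0 < (LINT y:?D|lborel. h y * box_heat b I C 0 y)" using m by (simp add: q0 mult_ac)
  with flow show thesis by (rule that)
qed

lemma ground_mode_integrable:
  fixes b :: "'a::euclidean_space"
  shows "set_integrable lborel (box (- b) b) (ground_mode b)"
  using set_integrable_mult_continuous[OF set_integrable_const_bounded[OF open_box bounded_box, of _ _ 1] sine_mode_cont(1) bounded_box]
  by simp

context positive_eigenfunction
begin

text \<open>Otherwise \<open>h = u - K S\<close> is positive near \<open>x\<close>, where \<open>S\<close> is the ground mode and \<open>u\<close> is extended by zero to the
box. Testing \<open>h\<close> with data peaked at \<open>x\<close> contradicts the monotonicity along the flow, which bounds \<open>\<integral> u q\<^sub>0\<close> by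
\<open>exp (lam T) * (\<integral> u q\<^sub>T)\<close> and hence by \<open>K (\<integral> S q\<^sub>0)\<close>.\<close>

lemma upper_bound_by_mass:
  assumes b: "\<And>e. e \<in> Basis \<Longrightarrow> 0 < b \<bullet> e" and Vb: "V \<subseteq> box (- b) b"
    and T: "0 \<le> T" "\<And>e. e \<in> Basis \<Longrightarrow> 10 \<le> (pi / (2 * (b \<bullet> e)))\<^sup>2 * T" and x: "x \<in> V"
  shows "u x \<le> 2 ^ DIM('a) * exp ((lam - ground_eigenvalue b) * T) * (LINT y:V|lborel. u y) / (\<Prod>e\<in>Basis. b \<bullet> e) * ground_mode b x"
    (is "_ \<le> ?K * _")
proof (rule ccontr)
  define A where "A = (LINT y:V|lborel. u y)"
  define P where "P = (\<Prod>e\<in>Basis. b \<bullet> e)"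
  define K where "K = ?K"
  let ?D = "box (- b) b"
  have P: "0 < P" unfolding P_def using b by (intro prod_pos) auto
  have Vc: "y \<in> cbox (- b) b" if "y \<in> V" for y using that Vb box_subset_cbox by blast
  have xD: "x \<in> ?D" using x Vb by blast
  assume "\<not> u x \<le> ?K * ground_mode b x"
  then have gt: "0 < u x - K * ground_mode b x" by (simp add: K_def)
  define h where "h = (\<lambda>y. indicator V y * u y - K * ground_mode b y)"
  have "continuous_on V (\<lambda>y. u y - K * ground_mode b y)" by (intro continuous_intros u_cont sine_mode_cont)
  then have "continuous_on V h" by (rule continuous_on_eq) (simp add: h_def)
  then have "isCont h x" using x open_V continuous_on_eq_continuous_at by blast
  moreover have "0 < h x" using gt x by (simp add: h_def)
  ultimately have h: "isCont h x" "0 < h x" .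
  have "(\<lambda>y. indicator ?D y *\<^sub>R (indicator V y * u y)) = (\<lambda>y. indicator V y *\<^sub>R u y)"
    using Vb by (auto simp: indicator_def fun_eq_iff)
  then have "set_integrable lborel ?D (\<lambda>y. indicator V y * u y)"
    using set_integrable_u unfolding set_integrable_def by simp
  then have h_int: "set_integrable lborel ?D h"
    unfolding h_def by (intro set_integral_diff(1) set_integrable_mult_right ground_mode_integrable)
  obtain I C \<gamma> where flow: "controlled_flow b I C \<gamma>" and pos: "0 < (LINT y:?D|lborel. h y * box_heat b I C 0 y)"
    by (rule detecting_heat_flow[OF b xD h_int h])
  have I: "finite I" and \<gamma>: "0 \<le> \<gamma>"
    and pair: "(LINT y:?D|lborel. box_heat b I C 0 y * ground_mode b y) = P * \<gamma>"
    using flow unfolding controlled_flow_def P_def by blast+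
  let ?q = "box_heat b I C"
  note int_V = set_integrable_mult_continuous[OF set_integrable_u box_heat_cont(1) bounded_V, of b I C]
  have int_D: "set_integrable lborel ?D (\<lambda>y. ?q 0 y * ground_mode b y)"
    using set_integrable_mult_continuous[OF ground_mode_integrable box_heat_cont(1) bounded_box, of b b I C 0]
    by (simp only: mult.commute)
  have "indicator ?D y *\<^sub>R (h y * ?q 0 y) = indicator V y *\<^sub>R (u y * ?q 0 y) - K * (indicator ?D y *\<^sub>R (?q 0 y * ground_mode b y))" for y
    using Vb by (auto simp: h_def indicator_def algebra_simps)
  then have "(LINT y:?D|lborel. h y * ?q 0 y) = (LINT y:V|lborel. u y * ?q 0 y) - K * (P * \<gamma>)"
    using int_V int_D pair unfolding set_lebesgue_integral_def set_integrable_def by simp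
  also have "(LINT y:V|lborel. u y * ?q 0 y) \<le> exp (lam * T) * (LINT y:V|lborel. u y * ?q T y)"
    using flow unfolding controlled_flow_def by (intro box_heat_flow_up[OF I T(1)]) (blast intro: Vc)
  also have "(LINT y:V|lborel. u y * ?q T y) \<le> (LINT y:V|lborel. (2 ^ DIM('a) * exp (- ground_eigenvalue b * T) * \<gamma>) * u y)"
  proof (rule set_integral_mono[OF int_V set_integrable_mult_right[OF set_integrable_u]])
    fix y assume y: "y \<in> V"
    have "?q T y \<le> 2 ^ DIM('a) * exp (- ground_eigenvalue b * T) * \<gamma> * ground_mode b y"
      using flow T(2) Vc[OF y] unfolding controlled_flow_def by blast
    also have "\<dots> \<le> 2 ^ DIM('a) * exp (- ground_eigenvalue b * T) * \<gamma> * 1"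
      using ground_mode_bounds(3)[OF b Vc[OF y]] \<gamma> by (intro mult_left_mono) auto
    finally show "u y * ?q T y \<le> (2 ^ DIM('a) * exp (- ground_eigenvalue b * T) * \<gamma>) * u y"
      using u_pos[OF y] by (simp add: mult.commute)
  qed
  also have "\<dots> = (2 ^ DIM('a) * exp (- ground_eigenvalue b * T) * \<gamma>) * A" by (simp add: A_def)
  finally have "0 < exp (lam * T) * ((2 ^ DIM('a) * exp (- ground_eigenvalue b * T) * \<gamma>) * A) - K * (P * \<gamma>)"
    using pos by simp
  moreover have "exp ((lam - ground_eigenvalue b) * T) = exp (lam * T) * exp (- ground_eigenvalue b * T)"
    by (simp add: exp_add[symmetric] algebra_simps)
  ultimately show False unfolding K_def A_def[symmetric] P_def[symmetric] using P by simp
qed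

text \<open>The mirror image of the upper bound, with \<open>h = K S - u\<close> on a box whose closure lies in \<open>V\<close>.\<close>

lemma lower_bound_by_mass:
  assumes a: "\<And>e. e \<in> Basis \<Longrightarrow> 0 < a \<bullet> e" and aV: "cbox (- a) a \<subseteq> V"
    and T: "0 \<le> T" "\<And>e. e \<in> Basis \<Longrightarrow> 10 \<le> (pi / (2 * (a \<bullet> e)))\<^sup>2 * T" and x: "x \<in> box (- a) a"
  shows "(1 / 2) ^ DIM('a) * exp ((lam - ground_eigenvalue a) * T) * (LINT y:box (- a) a|lborel. u y * ground_mode a y) / (\<Prod>e\<in>Basis. a \<bullet> e) * ground_mode a x \<le> u x"
    (is "?K * _ \<le> _")
proof (rule ccontr)
  let ?D = "box (- a) a"
  define A where "A = (LINT y:?D|lborel. u y * ground_mode a y)"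
  define P where "P = (\<Prod>e\<in>Basis. a \<bullet> e)"
  define K where "K = ?K"
  have P: "0 < P" unfolding P_def using a by (intro prod_pos) auto
  have Dc: "y \<in> cbox (- a) a" if "y \<in> ?D" for y using that box_subset_cbox by blast
  have DV: "?D \<subseteq> V" using aV Dc by blast
  assume "\<not> ?K * ground_mode a x \<le> u x"
  then have gt: "0 < K * ground_mode a x - u x" by (simp add: K_def)
  define h where "h = (\<lambda>y. K * ground_mode a y - u y)"
  have "continuous_on ?D h" unfolding h_def by (intro continuous_intros continuous_on_subset[OF u_cont(1) DV] sine_mode_cont)
  then have "isCont h x" using x open_box continuous_on_eq_continuous_at by blast
  moreover have "0 < h x" using gt by (simp add: h_def)
  ultimately have h: "isCont h x" "0 < h x" .
  note uD = set_integrable_u_box[OF aV]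
  have h_int: "set_integrable lborel ?D h"
    unfolding h_def by (intro set_integral_diff(1) uD set_integrable_mult_right ground_mode_integrable)
  obtain I C \<gamma> where flow: "controlled_flow a I C \<gamma>" and pos: "0 < (LINT y:?D|lborel. h y * box_heat a I C 0 y)"
    by (rule detecting_heat_flow[OF a x h_int h])
  have I: "finite I" and \<gamma>: "0 \<le> \<gamma>"
    and pair: "(LINT y:?D|lborel. box_heat a I C 0 y * ground_mode a y) = P * \<gamma>"
    using flow unfolding controlled_flow_def P_def by blast+
  let ?q = "box_heat a I C"
  note int_u = set_integrable_mult_continuous[OF uD box_heat_cont(1) bounded_box, of a I C]
  have int_D: "set_integrable lborel ?D (\<lambda>y. ?q 0 y * ground_mode a y)"
    using set_integrable_mult_continuous[OF ground_mode_integrable box_heat_cont(1) bounded_box, of a a I C 0]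
    by (simp only: mult.commute)
  have "indicator ?D y *\<^sub>R (h y * ?q 0 y) = K * (indicator ?D y *\<^sub>R (?q 0 y * ground_mode a y)) - indicator ?D y *\<^sub>R (u y * ?q 0 y)" for y
    by (auto simp: h_def indicator_def algebra_simps)
  then have eq: "(LINT y:?D|lborel. h y * ?q 0 y) = K * (P * \<gamma>) - (LINT y:?D|lborel. u y * ?q 0 y)"
    using int_u int_D pair unfolding set_lebesgue_integral_def set_integrable_def by simp
  have "exp (lam * T) * ((1 / 2) ^ DIM('a) * exp (- ground_eigenvalue a * T) * \<gamma> * A)
      = exp (lam * T) * (LINT y:?D|lborel. ((1 / 2) ^ DIM('a) * exp (- ground_eigenvalue a * T) * \<gamma>) * (u y * ground_mode a y))"
    unfolding A_def by (subst set_integral_mult_right) simp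
  also have "\<dots> \<le> exp (lam * T) * (LINT y:?D|lborel. u y * ?q T y)"
  proof (rule mult_left_mono[OF set_integral_mono[OF set_integrable_mult_right[OF set_integrable_u_ground[OF uD bounded_box]] int_u]])
    fix y assume y: "y \<in> ?D"
    have "(1 / 2) ^ DIM('a) * exp (- ground_eigenvalue a * T) * \<gamma> * ground_mode a y \<le> ?q T y"
      using flow T(2) Dc[OF y] unfolding controlled_flow_def by blast
    then have "u y * ((1 / 2) ^ DIM('a) * exp (- ground_eigenvalue a * T) * \<gamma> * ground_mode a y) \<le> u y * ?q T y"
      using u_pos[of y] y DV by (intro mult_left_mono) (auto intro: less_imp_le)
    then show "((1 / 2) ^ DIM('a) * exp (- ground_eigenvalue a * T) * \<gamma>) * (u y * ground_mode a y) \<le> u y * ?q T y"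
      by (simp add: mult_ac)
  qed simp
  also have "\<dots> \<le> (LINT y:?D|lborel. u y * ?q 0 y)"
    using flow unfolding controlled_flow_def by (intro box_heat_flow_down[OF a aV I T(1)]) blast+
  finally have "exp (lam * T) * ((1 / 2) ^ DIM('a) * exp (- ground_eigenvalue a * T) * \<gamma> * A) < K * (P * \<gamma>)"
    using pos eq by simp
  moreover have "exp ((lam - ground_eigenvalue a) * T) = exp (lam * T) * exp (- ground_eigenvalue a * T)"
    by (simp add: exp_add[symmetric] algebra_simps)
  ultimately show False unfolding K_def A_def[symmetric] P_def[symmetric] using P by simp
qed

text \<open>The Cauchy--Schwarz inequality against the constant 1, in the form \<open>2 u \<le> s u\<^sup>2 + 1 / s\<close> with
\<open>s\<^sup>2\<close> the volume of the box.\<close>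

lemma mass_le:
  assumes b: "\<And>e. e \<in> Basis \<Longrightarrow> 0 < b \<bullet> e" and Vb: "V \<subseteq> box (- b) b"
    and n: "set_integrable lborel V (\<lambda>y. (u y)\<^sup>2)" "(LINT y:V|lborel. (u y)\<^sup>2) = 1"
  shows "(LINT y:V|lborel. u y) \<le> sqrt (2 ^ DIM('a) * (\<Prod>e\<in>Basis. b \<bullet> e))"
proof -
  define P where "P = 2 ^ DIM('a) * (\<Prod>e\<in>Basis. b \<bullet> e)"
  have P: "0 < P" unfolding P_def using b by (intro mult_pos_pos prod_pos) auto
  define s where "s = sqrt P"
  have s: "0 < s" "s * s = P" using P by (auto simp: s_def)
  have cV: "set_integrable lborel V (\<lambda>_. 1 / (2 * s))" by (rule set_integrable_const_bounded[OF open_V bounded_V])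
  have "(LINT y:V|lborel. u y) \<le> (LINT y:V|lborel. s / 2 * (u y)\<^sup>2 + 1 / (2 * s))"
  proof (rule set_integral_mono[OF set_integrable_u])
    show "set_integrable lborel V (\<lambda>y. s / 2 * (u y)\<^sup>2 + 1 / (2 * s))"
      by (intro set_integral_add set_integrable_mult_right n cV)
    fix y
    have "0 \<le> (s * u y - 1)\<^sup>2" by simp
    then have "2 * (s * u y) \<le> s * (s * (u y)\<^sup>2) + 1" by (simp add: power2_eq_square algebra_simps)
    then show "u y \<le> s / 2 * (u y)\<^sup>2 + 1 / (2 * s)" using s(1) by (simp add: field_simps)
  qed
  also have "\<dots> = s / 2 * 1 + (LINT y:V|lborel. 1 / (2 * s))"
    using n cV by (subst set_integral_add) (auto intro: set_integrable_mult_right)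
  also have "(LINT y:V|lborel. 1 / (2 * s)) \<le> (LINT y:box (- b) b|lborel. 1 / (2 * s))"
    using cV set_integrable_const_bounded[OF open_box bounded_box, of "- b" b "1 / (2 * s)"] Vb s(1)
    unfolding set_lebesgue_integral_def set_integrable_def by (intro integral_mono) (auto simp: indicator_def)
  also have "\<dots> = 1 / (2 * s) * P" unfolding P_def by (rule measure_symmetric_box[OF b])
  also have "s / 2 * 1 + 1 / (2 * s) * P = s" using s by (simp add: field_simps)
  finally show ?thesis by (simp add: s_def P_def)
qed

end

section \<open>Two-sided bounds for a domain between two boxes\<close>

text \<open>The lower bound is the concavity of the sine on \<open>[0, \<pi>/2]\<close>.\<close>

lemma sin_half_pi_bounds:
  assumes t: "0 \<le> t" "t \<le> (1::real)"
  shows "t \<le> sin (pi / 2 * t)" "sin (pi / 2 * t) \<le> pi / 2 * t"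
proof -
  have "convex_on {0..pi / 2} (\<lambda>x. - sin x)"
  proof (rule f''_ge0_imp_convex)
    show "((\<lambda>x. - sin x) has_real_derivative - cos x) (at x)" for x :: real
      by (auto intro!: derivative_eq_intros)
    show "((\<lambda>x. - cos x) has_real_derivative sin x) (at x)" for x :: real
      by (auto intro!: derivative_eq_intros)
    show "0 \<le> sin x" if "x \<in> {0..pi / 2}" for x
      using that by (intro sin_ge_zero) auto
  qed auto
  from convex_onD[OF this, of t 0 "pi / 2"] t
  show "t \<le> sin (pi / 2 * t)" by (simp add: mult.commute)
  show "sin (pi / 2 * t) \<le> pi / 2 * t" using t by (intro sin_x_le_x) auto
qed

lemma sin_angle_bounds:
  assumes A: "0 < A" and y: "\<bar>y\<bar> \<le> A"
  shows "1 - \<bar>y\<bar> / A \<le> sin (angle A y)" "sin (angle A y) \<le> pi / 2 * (1 - \<bar>y\<bar> / A)"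
proof -
  have "sin (angle A y) = sin (pi / 2 * (1 - \<bar>y\<bar> / A))"
  proof (cases "y \<le> 0")
    case True
    then have "angle A y = pi / 2 * (1 - \<bar>y\<bar> / A)" using A by (simp add: angle_def field_simps)
    then show ?thesis by (simp only:)
  next
    case False
    then have "angle A y = pi - pi / 2 * (1 - \<bar>y\<bar> / A)" using A by (simp add: angle_def field_simps)
    then show ?thesis by (simp only: sin_pi_minus)
  qed
  moreover have "0 \<le> 1 - \<bar>y\<bar> / A" "1 - \<bar>y\<bar> / A \<le> 1" using A y by auto
  ultimately show "1 - \<bar>y\<bar> / A \<le> sin (angle A y)" "sin (angle A y) \<le> pi / 2 * (1 - \<bar>y\<bar> / A)"
    using sin_half_pi_bounds by auto
qed

text \<open>The three constants of the two-sided bound in dimension \<open>n\<close>, where \<open>G\<close> bounds \<open>(\<Lambda>\<^sub>a - \<Lambda>\<^sub>b) T\<close>.\<close>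

definition upper_const :: "nat \<Rightarrow> real \<Rightarrow> real" where
  "upper_const n G = 2 ^ n * exp G * sqrt (2 ^ n)"

text \<open>The relative width of a layer along the faces that carries at most half of \<open>\<integral> u\<^sup>2\<close> under the upper bound.\<close>

definition layer_width :: "nat \<Rightarrow> real \<Rightarrow> real" where
  "layer_width n G = 1 / (2 * (upper_const n G)\<^sup>2 * 2 ^ n * real n)"

definition lower_const :: "nat \<Rightarrow> real \<Rightarrow> real" where
  "lower_const n G = (1 / 2) ^ n * exp (- G) * (layer_width n G / 2) ^ n / (2 * upper_const n G)"

lemma consts_pos:
  assumes "1 \<le> n" "0 \<le> G"
  shows "1 \<le> upper_const n G" "0 < layer_width n G" "layer_width n G \<le> 1 / 2" "0 < lower_const n G"
proof -
  have "1 * 1 * 1 \<le> 2 ^ n * exp G * sqrt (2 ^ n)"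
    using assms by (intro mult_mono) auto
  then show K: "1 \<le> upper_const n G" by (simp add: upper_const_def)
  have "1 * 1 * 1 \<le> (upper_const n G)\<^sup>2 * 2 ^ n * real n"
    using assms K by (intro mult_mono) auto
  then show w: "0 < layer_width n G" "layer_width n G \<le> 1 / 2"
    using K assms unfolding layer_width_def by (auto simp: divide_simps mult.assoc)
  show "0 < lower_const n G" unfolding lower_const_def using w K by (auto intro!: divide_pos_pos mult_pos_pos)
qed

lemma ground_eigenvalue_scaleR:
  "ground_eigenvalue (\<sigma> *\<^sub>R a) = ground_eigenvalue a / \<sigma>\<^sup>2"
  unfolding mode_eigenvalue_def sum_divide_distrib
  by (intro sum.cong refl) (simp add: power_divide power_mult_distrib)

text \<open>With \<open>X = \<bar>x\<^sub>e\<bar>\<close> the hypothesis says \<open>B - X \<le> 2 (A - X)\<close>, and the factors of the two modes are comparable to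
\<open>1 - X / B\<close> and \<open>1 - X / A\<close>.\<close>

lemma ground_mode_compare:
  fixes a b :: "'a::euclidean_space"
  assumes ab: "\<And>e. e \<in> Basis \<Longrightarrow> 0 < a \<bullet> e" "\<And>e. e \<in> Basis \<Longrightarrow> a \<bullet> e \<le> b \<bullet> e"
    and x: "\<And>e. e \<in> Basis \<Longrightarrow> \<bar>x \<bullet> e\<bar> \<le> a \<bullet> e - (b \<bullet> e - a \<bullet> e)"
  shows "ground_mode b x \<le> pi ^ DIM('a) * ground_mode a x"
proof -
  have "ground_mode b x \<le> (\<Prod>e\<in>(Basis::'a set). pi * sin (angle (a \<bullet> e) (x \<bullet> e)))"
    unfolding sine_mode_def
  proof (rule prod_mono)
    fix e :: 'a assume e: "e \<in> Basis"
    define A B X where "A = a \<bullet> e" and "B = b \<bullet> e" and "X = \<bar>x \<bullet> e\<bar>"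
    have h: "0 < A" "A \<le> B" "X \<le> A - (B - A)" "0 \<le> X" using ab(1,2)[OF e] x[OF e] by (auto simp: A_def B_def X_def)
    have B0: "0 < B" and XB: "X \<le> B" and XA: "X \<le> A" using h by linarith+
    have "1 - X / B = (B - X) / B" using B0 by (simp add: field_simps)
    also have "\<dots> \<le> (2 * (A - X)) / A" using h XB by (intro frac_le) auto
    also have "\<dots> = 2 * (1 - X / A)" using h by (simp add: field_simps)
    finally have c: "1 - X / B \<le> 2 * (1 - X / A)" .
    have "sin (angle B (x \<bullet> e)) \<le> pi / 2 * (1 - X / B)"
      using sin_angle_bounds(2)[OF B0, of "x \<bullet> e"] XB by (simp add: X_def)
    also have "\<dots> \<le> pi / 2 * (2 * (1 - X / A))" using c by (intro mult_left_mono) auto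
    also have "\<dots> \<le> pi * sin (angle A (x \<bullet> e))"
      using sin_angle_bounds(1)[OF h(1), of "x \<bullet> e"] XA by (simp add: X_def)
    finally have 1: "sin (angle B (x \<bullet> e)) \<le> pi * sin (angle A (x \<bullet> e))" .
    have "0 \<le> 1 - X / B" using XB B0 by simp
    then have "0 \<le> sin (angle B (x \<bullet> e))"
      using sin_angle_bounds(1)[OF B0, of "x \<bullet> e"] XB unfolding X_def by linarith
    with 1 show "0 \<le> sin (real 1 * angle (b \<bullet> e) (x \<bullet> e)) \<and> sin (real 1 * angle (b \<bullet> e) (x \<bullet> e)) \<le> pi * sin (angle (a \<bullet> e) (x \<bullet> e))"
      by (simp add: A_def B_def)
  qed
  then show ?thesis by (simp add: sine_mode_def prod.distrib)
qed

context positive_eigenfunction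
begin

context
  fixes a b :: 'a and M G :: real
  assumes a: "\<And>e. e \<in> Basis \<Longrightarrow> 0 < a \<bullet> e" and b: "\<And>e. e \<in> Basis \<Longrightarrow> 0 < b \<bullet> e"
    and aV: "box (- a) a \<subseteq> V" and Vb: "V \<subseteq> box (- b) b"
    and normalized: "set_integrable lborel V (\<lambda>y. (u y)\<^sup>2)" "(LINT y:V|lborel. (u y)\<^sup>2) = 1"
    and M: "\<And>e. e \<in> Basis \<Longrightarrow> b \<bullet> e \<le> M"
    and G: "0 \<le> G" "(ground_eigenvalue a - ground_eigenvalue b) * (5 * M\<^sup>2) \<le> G"
begin

text \<open>Explains the choice \<open>T = 5 M\<^sup>2\<close>: measured by the clock of any side it is at least 10, since \<open>\<pi> > 3\<close>.\<close>

lemma long_time: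
  assumes "0 < r" "r \<le> M"
  shows "10 \<le> (pi / (2 * r))\<^sup>2 * (5 * M\<^sup>2)"
proof -
  have "3 / 2 \<le> pi / 2 * 1" using pi_gt3 by simp
  also have "\<dots> \<le> pi / 2 * (M / r)" using assms by (intro mult_left_mono) auto
  finally have "(3 / 2)\<^sup>2 \<le> (pi / 2 * (M / r))\<^sup>2" by (intro power_mono) auto
  also have "\<dots> = (pi / (2 * r))\<^sup>2 * M\<^sup>2" by (simp add: power_mult_distrib power_divide)
  finally have "5 * (3 / 2)\<^sup>2 \<le> 5 * ((pi / (2 * r))\<^sup>2 * M\<^sup>2)" by (intro mult_left_mono) auto
  moreover have "(10::real) \<le> 5 * (3 / 2)\<^sup>2" by (simp add: power2_eq_square)
  ultimately show ?thesis by (simp only: mult.left_commute)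
qed

lemma a_le_b: "e \<in> Basis \<Longrightarrow> a \<bullet> e \<le> b \<bullet> e"
proof -
  have "box (- a) a \<subseteq> box (- b) b" using aV Vb by blast
  moreover have "\<forall>e\<in>Basis. (- a) \<bullet> e < a \<bullet> e" using a by auto
  ultimately show "a \<bullet> e \<le> b \<bullet> e" if "e \<in> Basis" for e
    using that subset_box(4)[of "- a" a "- b" b] by auto
qed

definition "shrink m = 1 - 1 / (real m + 2)" for m :: nat

lemma shrink: "0 < shrink m" "shrink m < 1" "shrink \<longlonglongrightarrow> 1"
proof -
  show "0 < shrink m" "shrink m < 1" by (auto simp: shrink_def field_simps)
  have "(\<lambda>m. inverse (real (Suc (Suc m)))) \<longlonglongrightarrow> 0"
    using LIMSEQ_Suc[OF LIMSEQ_inverse_real_of_nat] by simp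
  then have "(\<lambda>m. 1 - inverse (real (Suc (Suc m)))) \<longlonglongrightarrow> 1 - 0" by (intro tendsto_intros)
  then show "shrink \<longlonglongrightarrow> 1" unfolding shrink_def by (simp add: inverse_eq_divide add.commute)
qed

text \<open>Only \<open>box (- a) a \<subseteq> V\<close> is known, while the comparison from below needs closed boxes inside \<open>V\<close>. So it is
made on the boxes scaled by \<open>shrink m < 1\<close>, which tends to 1.\<close>

lemma shrunk_box:
  assumes "0 < \<sigma>" "\<sigma> < 1"
  shows "\<And>e. e \<in> Basis \<Longrightarrow> 0 < (\<sigma> *\<^sub>R a) \<bullet> e" "cbox (- (\<sigma> *\<^sub>R a)) (\<sigma> *\<^sub>R a) \<subseteq> V"
proof -
  show p: "0 < (\<sigma> *\<^sub>R a) \<bullet> e" if "e \<in> Basis" for e using a[OF that] assms by simp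
  have "cbox (- (\<sigma> *\<^sub>R a)) (\<sigma> *\<^sub>R a) \<subseteq> box (- a) a"
  proof
    fix y assume y: "y \<in> cbox (- (\<sigma> *\<^sub>R a)) (\<sigma> *\<^sub>R a)"
    have "- (a \<bullet> e) < y \<bullet> e \<and> y \<bullet> e < a \<bullet> e" if e: "e \<in> Basis" for e
    proof -
      have "\<sigma> * (a \<bullet> e) < 1 * (a \<bullet> e)" using a[OF e] assms by (intro mult_strict_right_mono) auto
      moreover have "- (\<sigma> * (a \<bullet> e)) \<le> y \<bullet> e" "y \<bullet> e \<le> \<sigma> * (a \<bullet> e)" using y e by (auto simp: mem_box)
      ultimately show ?thesis by linarith
    qed
    then show "y \<in> box (- a) a" by (auto simp: mem_box)
  qed
  then show "cbox (- (\<sigma> *\<^sub>R a)) (\<sigma> *\<^sub>R a) \<subseteq> V" using aV by blast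
qed

lemma eigenvalue_le_ground: "lam \<le> ground_eigenvalue a"
proof -
  have "(\<lambda>m. ground_eigenvalue a / (shrink m)\<^sup>2) \<longlonglongrightarrow> ground_eigenvalue a / 1\<^sup>2"
    by (intro tendsto_intros shrink) auto
  moreover have "lam \<le> ground_eigenvalue a / (shrink m)\<^sup>2" for m
    using eigenvalue_le[OF shrunk_box[OF shrink(1,2)]] unfolding ground_eigenvalue_scaleR .
  ultimately show ?thesis by (intro LIMSEQ_le_const) auto
qed

lemma upper_bound:
  assumes x: "x \<in> V"
  shows "u x \<le> upper_const DIM('a) G / sqrt (\<Prod>e\<in>Basis. b \<bullet> e) * ground_mode b x"
proof -
  define P where "P = (\<Prod>e\<in>Basis. b \<bullet> e)"
  have P: "0 < P" unfolding P_def using b by (intro prod_pos) auto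
  have "(lam - ground_eigenvalue b) * (5 * M\<^sup>2) \<le> (ground_eigenvalue a - ground_eigenvalue b) * (5 * M\<^sup>2)"
    using eigenvalue_le_ground by (intro mult_right_mono) auto
  then have E: "exp ((lam - ground_eigenvalue b) * (5 * M\<^sup>2)) \<le> exp G" using G by simp
  have gm: "0 \<le> ground_mode b x" using ground_mode_bounds(2)[OF b] x Vb by (force intro: less_imp_le)
  have "0 < (LINT y:V|lborel. u y)" by (intro set_integral_pos open_V nonempty set_integrable_u u_pos)
  then have mass: "0 \<le> (LINT y:V|lborel. u y)" by simp
  have "u x \<le> 2 ^ DIM('a) * exp ((lam - ground_eigenvalue b) * (5 * M\<^sup>2)) * (LINT y:V|lborel. u y) / P * ground_mode b x"
    unfolding P_def by (rule upper_bound_by_mass[OF b Vb _ long_time x]) (use b M in auto)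
  also have "\<dots> \<le> 2 ^ DIM('a) * exp G * sqrt (2 ^ DIM('a) * P) / P * ground_mode b x"
    using mass_le[OF b Vb normalized] E P gm mass unfolding P_def[symmetric]
    by (intro mult_right_mono divide_right_mono mult_mono) auto
  also have "\<dots> = upper_const DIM('a) G / sqrt P * ground_mode b x"
  proof -
    have "sqrt (2 ^ DIM('a) * P) / P = sqrt (2 ^ DIM('a)) / sqrt P"
      using P by (simp add: real_sqrt_mult real_div_sqrt field_simps)
    then show ?thesis unfolding upper_const_def by (simp only: times_divide_eq_right[symmetric])
  qed
  finally show ?thesis by (simp add: P_def)
qed

text \<open>By the upper bound \<open>u \<le> K (\<Prod>i. b\<^sub>i)\<^sup>-\<^sup>1\<^sup>/\<^sup>2\<close>, so the layer between the two boxes carries at most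
\<open>K\<^sup>2 2\<^sup>n (1 - (1 - \<delta>)\<^sup>n) \<le> K\<^sup>2 2\<^sup>n n \<delta> = 1/2\<close> of \<open>\<integral> u\<^sup>2 = 1\<close>. The other half lies in the inner box, where
\<open>u\<^sup>2\<close> is at most the bound for \<open>u\<close> times \<open>u\<close>.\<close>

lemma inner_mass:
  assumes inner: "box (- ((1 - layer_width DIM('a) G) *\<^sub>R b)) ((1 - layer_width DIM('a) G) *\<^sub>R b) \<subseteq> V"
  shows "sqrt (\<Prod>e\<in>Basis. b \<bullet> e) / (2 * upper_const DIM('a) G)
    \<le> (LINT y:box (- ((1 - layer_width DIM('a) G) *\<^sub>R b)) ((1 - layer_width DIM('a) G) *\<^sub>R b)|lborel. u y)"
proof -
  define n where "n = DIM('a)"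
  define K where "K = upper_const n G"
  define \<delta> where "\<delta> = layer_width n G"
  define P where "P = (\<Prod>e\<in>Basis. b \<bullet> e)"
  define c where "c = (1 - \<delta>) *\<^sub>R b"
  define J where "J = box (- c) c"
  let ?D = "box (- b) b"
  have n: "1 \<le> n" unfolding n_def by (simp add: Suc_leI)
  have P: "0 < P" unfolding P_def using b by (intro prod_pos) auto
  note cp = consts_pos[OF n G(1), folded K_def \<delta>_def]
  have c: "0 < c \<bullet> e" if "e \<in> Basis" for e unfolding c_def using b[OF that] cp(3) by simp
  have Pc: "(\<Prod>e\<in>Basis. c \<bullet> e) = (1 - \<delta>) ^ n * P" by (simp add: c_def prod.distrib P_def n_def)
  have JV: "J \<subseteq> V" using inner by (simp add: J_def c_def \<delta>_def n_def)
  have u_le: "u y \<le> K / sqrt P" if y: "y \<in> V" for y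
  proof -
    have yc: "y \<in> cbox (- b) b" using y Vb box_subset_cbox by blast
    have "u y \<le> K / sqrt P * ground_mode b y" using upper_bound[OF y] by (simp add: K_def P_def n_def)
    also have "\<dots> \<le> K / sqrt P * 1"
      using ground_mode_bounds(3)[OF b yc] cp(1) P by (intro mult_left_mono) auto
    finally show ?thesis by simp
  qed
  have uJ: "set_integrable lborel J u"
    by (rule set_integrable_subset[OF set_integrable_u]) (use JV in \<open>auto simp: J_def\<close>)
  have iD: "set_integrable lborel ?D (\<lambda>_. K\<^sup>2 / P)" and iJ: "set_integrable lborel J (\<lambda>_. K\<^sup>2 / P)"
    unfolding J_def by (rule set_integrable_const_bounded[OF open_box bounded_box])+
  have KP: "K\<^sup>2 / P * (r * P) = K\<^sup>2 * r" for r using P by simp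
  have vol_D: "(LINT y:?D|lborel. K\<^sup>2 / P) = K\<^sup>2 * 2 ^ n"
    unfolding KP[symmetric] P_def n_def by (rule measure_symmetric_box[OF b])
  have "(LINT y:J|lborel. K\<^sup>2 / P) = K\<^sup>2 / P * (2 ^ n * ((1 - \<delta>) ^ n * P))"
    using measure_symmetric_box[OF c, of "K\<^sup>2 / P"] unfolding J_def Pc n_def[symmetric] .
  then have vol_J: "(LINT y:J|lborel. K\<^sup>2 / P) = K\<^sup>2 * 2 ^ n * (1 - \<delta>) ^ n"
    using KP[of "2 ^ n * (1 - \<delta>) ^ n"] by (simp only: mult.assoc)
  have "1 = (LINT y|lborel. indicator V y *\<^sub>R (u y)\<^sup>2)"
    using normalized(2) by (simp add: set_lebesgue_integral_def)
  also have "\<dots> \<le> (LINT y|lborel. K / sqrt P * (indicator J y *\<^sub>R u y) + (indicator ?D y *\<^sub>R (K\<^sup>2 / P) - indicator J y *\<^sub>R (K\<^sup>2 / P)))"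
  proof (rule integral_mono)
    show "integrable lborel (\<lambda>y. indicator V y *\<^sub>R (u y)\<^sup>2)" using normalized(1) by (simp add: set_integrable_def)
    show "integrable lborel (\<lambda>y. K / sqrt P * (indicator J y *\<^sub>R u y) + (indicator ?D y *\<^sub>R (K\<^sup>2 / P) - indicator J y *\<^sub>R (K\<^sup>2 / P)))"
      using uJ iD iJ unfolding set_integrable_def
      by (intro Bochner_Integration.integrable_add Bochner_Integration.integrable_diff integrable_mult_right)
    fix y
    show "indicator V y *\<^sub>R (u y)\<^sup>2 \<le> K / sqrt P * (indicator J y *\<^sub>R u y) + (indicator ?D y *\<^sub>R (K\<^sup>2 / P) - indicator J y *\<^sub>R (K\<^sup>2 / P))"
    proof -
      have KP: "0 \<le> K\<^sup>2 / P" using P by simp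
      consider "y \<in> J" | "y \<in> V" "y \<notin> J" | "y \<notin> V" by blast
      then show ?thesis
      proof cases
        case 1
        then have y: "y \<in> V" "y \<in> ?D" using JV Vb by auto
        have "u y * u y \<le> K / sqrt P * u y" using u_le[OF y(1)] u_pos[OF y(1)] by (intro mult_right_mono) auto
        then show ?thesis using 1 y by (simp add: power2_eq_square)
      next
        case 2
        then have y: "y \<in> ?D" using Vb by auto
        have "(u y)\<^sup>2 \<le> (K / sqrt P)\<^sup>2" using u_le[OF 2(1)] u_pos[OF 2(1)] by (intro power_mono) auto
        also have "\<dots> = K\<^sup>2 / P" using P by (simp add: power_divide)
        finally show ?thesis using 2 y by simp
      next
        case 3
        then have "y \<notin> J" using JV by auto
        then show ?thesis using 3 KP by (simp add: indicator_def)
      qed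
    qed
  qed
  also have "\<dots> = K / sqrt P * (LINT y:J|lborel. u y) + ((LINT y:?D|lborel. K\<^sup>2 / P) - (LINT y:J|lborel. K\<^sup>2 / P))"
    using uJ iD iJ unfolding set_integrable_def set_lebesgue_integral_def
    by (simp only: Bochner_Integration.integral_add Bochner_Integration.integral_diff
        Bochner_Integration.integrable_diff integrable_mult_right integral_mult_right_zero)
  also have "(LINT y:?D|lborel. K\<^sup>2 / P) = K\<^sup>2 * 2 ^ n"
    by (rule vol_D)
  also have "(LINT y:J|lborel. K\<^sup>2 / P) = K\<^sup>2 * 2 ^ n * (1 - \<delta>) ^ n"
    by (rule vol_J)
  finally have 1: "1 \<le> K / sqrt P * (LINT y:J|lborel. u y) + K\<^sup>2 * 2 ^ n * (1 - (1 - \<delta>) ^ n)"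
    by (simp add: algebra_simps)
  have "1 - real n * \<delta> \<le> (1 - \<delta>) ^ n"
    using Bernoulli_inequality[of "- \<delta>" n] cp(3) by simp
  then have "K\<^sup>2 * 2 ^ n * (1 - (1 - \<delta>) ^ n) \<le> K\<^sup>2 * 2 ^ n * (real n * \<delta>)"
    by (intro mult_left_mono) auto
  also have "\<dots> = 1 / 2"
    unfolding \<delta>_def layer_width_def K_def[symmetric] using cp(1) n by (simp add: field_simps)
  finally have "1 / 2 \<le> K / sqrt P * (LINT y:J|lborel. u y)" using 1 by linarith
  then have "sqrt P / (2 * K) \<le> (LINT y:J|lborel. u y)" using P cp(1) by (simp add: field_simps)
  then show ?thesis by (simp add: J_def c_def \<delta>_def K_def P_def n_def)
qed

text \<open>The inner box \<open>J\<close> of half-sides \<open>(1 - \<delta>) b\<close> lies in the box of half-sides \<open>(1 - \<delta>/2) \<sigma> a\<close> for \<open>\<sigma>\<close>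
close to 1, so the ground mode of the box \<open>\<sigma> a\<close> is at least \<open>(\<delta>/2)\<^sup>n\<close> on \<open>J\<close>. Together with the mass of
\<open>u\<close> on \<open>J\<close> this bounds the mass in the comparison from below; then \<open>\<sigma> \<rightarrow> 1\<close>.\<close>

lemma lower_bound:
  assumes close: "\<And>e. e \<in> Basis \<Longrightarrow> b \<bullet> e \<le> (1 + layer_width DIM('a) G / 4) * (a \<bullet> e)"
    and x: "x \<in> box (- a) a"
  shows "lower_const DIM('a) G / sqrt (\<Prod>e\<in>Basis. a \<bullet> e) * ground_mode a x \<le> u x"
proof -
  define n where "n = DIM('a)"
  define K where "K = upper_const n G"
  define \<delta> where "\<delta> = layer_width n G"
  define P where "P = (\<Prod>e\<in>Basis. b \<bullet> e)"
  define Q where "Q = (\<Prod>e\<in>Basis. a \<bullet> e)"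
  define c where "c = (1 - \<delta>) *\<^sub>R b"
  define J where "J = box (- c) c"
  define T where "T = 5 * M\<^sup>2"
  have n: "1 \<le> n" unfolding n_def by (simp add: Suc_leI)
  have P: "0 < P" unfolding P_def using b by (intro prod_pos) auto
  have Q: "0 < Q" unfolding Q_def using a by (intro prod_pos) auto
  have QP: "Q \<le> P" unfolding P_def Q_def using a a_le_b by (intro prod_mono) (auto intro: less_imp_le)
  note cp = consts_pos[OF n G(1), folded K_def \<delta>_def]
  have inner: "\<bar>y \<bullet> e\<bar> \<le> (1 - \<delta> / 2) * (\<sigma> * (a \<bullet> e))"
    if y: "y \<in> J" and e: "e \<in> Basis" and \<sigma>: "1 - \<delta> / 4 \<le> \<sigma>" for y e \<sigma>
  proof -
    have "\<bar>y \<bullet> e\<bar> \<le> (1 - \<delta>) * (b \<bullet> e)" using y e by (auto simp: J_def c_def mem_box abs_le_iff intro: less_imp_le)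
    also have "\<dots> \<le> (1 - \<delta>) * ((1 + \<delta> / 4) * (a \<bullet> e))"
      using close[OF e] cp(3) by (intro mult_left_mono) (auto simp: \<delta>_def n_def)
    also have "\<dots> = ((1 - \<delta>) * (1 + \<delta> / 4)) * (a \<bullet> e)" by simp
    also have "\<dots> \<le> ((1 - \<delta> / 2) * \<sigma>) * (a \<bullet> e)"
    proof (rule mult_right_mono)
      have "(1 - \<delta>) * (1 + \<delta> / 4) \<le> (1 - \<delta> / 2) * (1 - \<delta> / 4)"
        using zero_le_square[of \<delta>] by (simp add: algebra_simps)
      also have "\<dots> \<le> (1 - \<delta> / 2) * \<sigma>" using \<sigma> cp(3) by (intro mult_left_mono) auto
      finally show "(1 - \<delta>) * (1 + \<delta> / 4) \<le> (1 - \<delta> / 2) * \<sigma>" .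
    qed (use a[OF e] in simp)
    finally show ?thesis by (simp add: mult.assoc)
  qed
  have JB: "J \<subseteq> box (- (\<sigma> *\<^sub>R a)) (\<sigma> *\<^sub>R a)" if \<sigma>: "1 - \<delta> / 4 \<le> \<sigma>" for \<sigma>
  proof
    fix y assume y: "y \<in> J"
    have "- (\<sigma> * (a \<bullet> e)) < y \<bullet> e \<and> y \<bullet> e < \<sigma> * (a \<bullet> e)" if e: "e \<in> Basis" for e
    proof -
      have "0 < \<sigma> * (a \<bullet> e)" using \<sigma> cp(3) a[OF e] by (intro mult_pos_pos) auto
      then have "(1 - \<delta> / 2) * (\<sigma> * (a \<bullet> e)) < 1 * (\<sigma> * (a \<bullet> e))"
        using cp(2) by (intro mult_strict_right_mono) auto
      with inner[OF y e \<sigma>] show ?thesis by linarith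
    qed
    then show "y \<in> box (- (\<sigma> *\<^sub>R a)) (\<sigma> *\<^sub>R a)" by (auto simp: mem_box)
  qed
  have JV: "J \<subseteq> V" using JB[of 1] cp(2) aV by auto
  have mass: "sqrt P / (2 * K) \<le> (LINT y:J|lborel. u y)"
    using inner_mass JV by (simp add: J_def c_def \<delta>_def K_def P_def n_def)
  \<comment> \<open>The estimate on a shrunken box, where the comparison from below applies.\<close>
  have step: "(1 / 2) ^ n * exp ((lam - ground_eigenvalue a / \<sigma>\<^sup>2) * T) * ((\<delta> / 2) ^ n * (sqrt P / (2 * K))) / (\<sigma> ^ n * Q)
      * ground_mode (\<sigma> *\<^sub>R a) x \<le> u x"
    if \<sigma>: "1 - \<delta> / 4 \<le> \<sigma>" "\<sigma> < 1" "0 < \<sigma>" and x\<sigma>: "x \<in> box (- (\<sigma> *\<^sub>R a)) (\<sigma> *\<^sub>R a)" for \<sigma>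
  proof -
    let ?a = "\<sigma> *\<^sub>R a"
    let ?B = "box (- ?a) ?a"
    note sb = shrunk_box[OF \<sigma>(3,2)]
    have prodQ: "(\<Prod>e\<in>Basis. ?a \<bullet> e) = \<sigma> ^ n * Q" by (simp add: prod.distrib Q_def n_def)
    have "(\<delta> / 2) ^ n * (sqrt P / (2 * K)) \<le> (\<delta> / 2) ^ n * (LINT y:J|lborel. u y)"
      using mass cp(2) by (intro mult_left_mono) auto
    also have "\<dots> = (LINT y:J|lborel. (\<delta> / 2) ^ n * u y)" by simp
    also have "\<dots> \<le> (LINT y:?B|lborel. u y * ground_mode ?a y)"
      unfolding set_lebesgue_integral_def
    proof (rule integral_mono)
      have "set_integrable lborel J (\<lambda>y. (\<delta> / 2) ^ n * u y)"
        by (intro set_integrable_mult_right set_integrable_subset[OF set_integrable_u]) (use JV in \<open>auto simp: J_def\<close>)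
      then show "integrable lborel (\<lambda>y. indicator J y *\<^sub>R ((\<delta> / 2) ^ n * u y))" by (simp add: set_integrable_def)
      show "integrable lborel (\<lambda>y. indicator ?B y *\<^sub>R (u y * ground_mode ?a y))"
        using set_integrable_u_ground[OF set_integrable_u_box[OF sb(2)] bounded_box] by (simp add: set_integrable_def)
      fix y
      show "indicator J y *\<^sub>R ((\<delta> / 2) ^ n * u y) \<le> indicator ?B y *\<^sub>R (u y * ground_mode ?a y)"
      proof (cases "y \<in> J")
        case True
        then have yB: "y \<in> ?B" and yV: "y \<in> V" using JB[OF \<sigma>(1)] JV by auto
        have "(\<Prod>e\<in>(Basis::'a set). \<delta> / 2) \<le> ground_mode ?a y"
          unfolding sine_mode_def
        proof (rule prod_mono)
          fix e :: 'a assume e: "e \<in> Basis"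
          have p: "0 < ?a \<bullet> e" by (rule sb(1)[OF e])
          have y1: "\<bar>y \<bullet> e\<bar> \<le> (1 - \<delta> / 2) * (?a \<bullet> e)" using inner[OF True e \<sigma>(1)] by simp
          then have "\<bar>y \<bullet> e\<bar> / (?a \<bullet> e) \<le> 1 - \<delta> / 2" using p by (simp add: pos_divide_le_eq)
          moreover have "\<bar>y \<bullet> e\<bar> \<le> ?a \<bullet> e"
            using y1 mult_right_mono[of "1 - \<delta> / 2" 1 "?a \<bullet> e"] p cp(2) by linarith
          ultimately have "\<delta> / 2 \<le> sin (angle (?a \<bullet> e) (y \<bullet> e))"
            using sin_angle_bounds(1)[OF p, of "y \<bullet> e"] by linarith
          then show "0 \<le> \<delta> / 2 \<and> \<delta> / 2 \<le> sin (real 1 * angle (?a \<bullet> e) (y \<bullet> e))" using cp(2) by simp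
        qed
        then have "(\<delta> / 2) ^ n \<le> ground_mode ?a y" by (simp add: n_def)
        then have "(\<delta> / 2) ^ n * u y \<le> ground_mode ?a y * u y" using u_pos[OF yV] by (intro mult_right_mono) auto
        then show ?thesis using True yB by (simp add: mult.commute)
      next
        case False
        have "0 \<le> u y * ground_mode ?a y" if y: "y \<in> ?B"
          using u_pos[of y] ground_mode_bounds(2)[OF sb(1) y] y sb(2) box_subset_cbox
          by (intro mult_nonneg_nonneg) (blast intro: less_imp_le)+
        then show ?thesis using False by (simp add: indicator_def)
      qed
    qed
    finally have m: "(\<delta> / 2) ^ n * (sqrt P / (2 * K)) \<le> (LINT y:?B|lborel. u y * ground_mode ?a y)" .
    have gm: "0 \<le> ground_mode ?a x" using ground_mode_bounds(2)[OF sb(1) x\<sigma>] by simp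
    have "(1 / 2) ^ n * exp ((lam - ground_eigenvalue ?a) * T) * ((\<delta> / 2) ^ n * (sqrt P / (2 * K))) / (\<sigma> ^ n * Q) * ground_mode ?a x
       \<le> (1 / 2) ^ n * exp ((lam - ground_eigenvalue ?a) * T) * (LINT y:?B|lborel. u y * ground_mode ?a y) / (\<sigma> ^ n * Q) * ground_mode ?a x"
      using m gm Q \<sigma> by (intro mult_right_mono divide_right_mono mult_left_mono) auto
    also have "\<dots> \<le> u x"
      unfolding n_def T_def prodQ[unfolded n_def, symmetric]
    proof (rule lower_bound_by_mass[OF sb _ long_time x\<sigma>])
      show "?a \<bullet> e \<le> M" if e: "e \<in> Basis" for e
      proof -
        have "?a \<bullet> e \<le> 1 * (a \<bullet> e)" unfolding inner_scaleR_left using \<sigma> a[OF e] by (intro mult_right_mono) auto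
        then show ?thesis using a_le_b[OF e] M[OF e] by linarith
      qed
    qed (use sb in auto)
    finally show ?thesis unfolding ground_eigenvalue_scaleR .
  qed
  have lim: "(\<lambda>m. (1 / 2) ^ n * exp ((lam - ground_eigenvalue a / (shrink m)\<^sup>2) * T) * ((\<delta> / 2) ^ n * (sqrt P / (2 * K))) / ((shrink m) ^ n * Q)
      * ground_mode (shrink m *\<^sub>R a) x)
    \<longlonglongrightarrow> (1 / 2) ^ n * exp ((lam - ground_eigenvalue a / 1\<^sup>2) * T) * ((\<delta> / 2) ^ n * (sqrt P / (2 * K))) / (1 ^ n * Q)
      * ground_mode (1 *\<^sub>R a) x"
  proof (intro tendsto_mult tendsto_divide tendsto_const tendsto_exp tendsto_diff tendsto_power shrink)
    show "(\<lambda>m. ground_mode (shrink m *\<^sub>R a) x) \<longlonglongrightarrow> ground_mode (1 *\<^sub>R a) x"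
      unfolding sine_mode_def angle_def inner_scaleR_left
      by (intro tendsto_intros shrink) (use a in force)
  qed (use Q cp(1) in auto)
  have ev: "\<forall>\<^sub>F m in sequentially. 1 - \<delta> / 4 \<le> shrink m \<and> x \<in> box (- (shrink m *\<^sub>R a)) (shrink m *\<^sub>R a)"
  proof (rule eventually_conj)
    have "\<forall>\<^sub>F m in sequentially. 1 - \<delta> / 4 < shrink m" using cp(2) by (intro order_tendstoD(1)[OF shrink(3)]) auto
    then show "\<forall>\<^sub>F m in sequentially. 1 - \<delta> / 4 \<le> shrink m" by eventually_elim simp
    have "\<forall>\<^sub>F m in sequentially. \<forall>e\<in>Basis. \<bar>x \<bullet> e\<bar> < shrink m * (a \<bullet> e)"
    proof (intro eventually_ball_finite finite_Basis ballI)
      fix e :: 'a assume e: "e \<in> Basis"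
      have "(\<lambda>m. shrink m * (a \<bullet> e)) \<longlonglongrightarrow> 1 * (a \<bullet> e)" by (intro tendsto_intros shrink)
      moreover have "\<bar>x \<bullet> e\<bar> < 1 * (a \<bullet> e)" using x e by (auto simp: mem_box abs_less_iff)
      ultimately show "\<forall>\<^sub>F m in sequentially. \<bar>x \<bullet> e\<bar> < shrink m * (a \<bullet> e)" by (rule order_tendstoD(1))
    qed
    then show "\<forall>\<^sub>F m in sequentially. x \<in> box (- (shrink m *\<^sub>R a)) (shrink m *\<^sub>R a)"
      by eventually_elim (auto simp: mem_box abs_less_iff minus_less_iff[of "x \<bullet> _"])
  qed
  have main: "(1 / 2) ^ n * exp ((lam - ground_eigenvalue a) * T) * ((\<delta> / 2) ^ n * (sqrt P / (2 * K))) / Q * ground_mode a x \<le> u x"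
  proof (rule tendsto_upperbound[OF _ _ sequentially_bot])
    show "(\<lambda>m. (1 / 2) ^ n * exp ((lam - ground_eigenvalue a / (shrink m)\<^sup>2) * T) * ((\<delta> / 2) ^ n * (sqrt P / (2 * K))) / ((shrink m) ^ n * Q)
      * ground_mode (shrink m *\<^sub>R a) x)
      \<longlonglongrightarrow> (1 / 2) ^ n * exp ((lam - ground_eigenvalue a) * T) * ((\<delta> / 2) ^ n * (sqrt P / (2 * K))) / Q * ground_mode a x"
      using lim by simp
    show "\<forall>\<^sub>F m in sequentially. (1 / 2) ^ n * exp ((lam - ground_eigenvalue a / (shrink m)\<^sup>2) * T) * ((\<delta> / 2) ^ n * (sqrt P / (2 * K))) / ((shrink m) ^ n * Q)
      * ground_mode (shrink m *\<^sub>R a) x \<le> u x"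
      using ev by eventually_elim (use step shrink in blast)
  qed
  have gm: "0 \<le> ground_mode a x" using ground_mode_bounds(2)[OF a x] by simp
  have "(ground_eigenvalue b - ground_eigenvalue a) * T \<le> (lam - ground_eigenvalue a) * T"
    using eigenvalue_ge[OF b Vb] by (intro mult_right_mono) (auto simp: T_def)
  then have "- G \<le> (lam - ground_eigenvalue a) * T" using G(2) by (simp add: T_def algebra_simps)
  then have E: "exp (- G) \<le> exp ((lam - ground_eigenvalue a) * T)" by simp
  have "1 / sqrt Q = sqrt Q / Q" using Q by (simp add: real_div_sqrt field_simps)
  also have "\<dots> \<le> sqrt P / Q" using QP Q by (intro divide_right_mono) auto
  finally have S: "1 / sqrt Q \<le> sqrt P / Q" .
  have "lower_const n G / sqrt Q * ground_mode a x
     = (1 / 2) ^ n * exp (- G) * ((\<delta> / 2) ^ n / (2 * K)) * (1 / sqrt Q) * ground_mode a x"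
    by (simp add: lower_const_def \<delta>_def K_def)
  also have "\<dots> \<le> (1 / 2) ^ n * exp ((lam - ground_eigenvalue a) * T) * ((\<delta> / 2) ^ n / (2 * K)) * (sqrt P / Q) * ground_mode a x"
    using E S gm cp(1,2) Q P by (intro mult_right_mono mult_mono) auto
  also have "\<dots> = (1 / 2) ^ n * exp ((lam - ground_eigenvalue a) * T) * ((\<delta> / 2) ^ n * (sqrt P / (2 * K))) / Q * ground_mode a x"
    by simp
  finally show ?thesis using main by (simp add: n_def Q_def)
qed

end

end

section \<open>Eigenfunctions of domains between two boxes\<close>

text \<open>The first condition on the half-sides is exactly what keeps the gap between the two ground eigenvalues bounded over
the time \<open>T = 5 M\<^sup>2\<close>.\<close>

lemma ground_eigenvalue_gap:
  fixes a b :: "'a::euclidean_space"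
  assumes "\<And>e. e \<in> Basis \<Longrightarrow> 1 / (a \<bullet> e)\<^sup>2 - 1 / (b \<bullet> e)\<^sup>2 \<le> c / M\<^sup>2"
  shows "(ground_eigenvalue a - ground_eigenvalue b) * (5 * M\<^sup>2) \<le> 5 * DIM('a) * (pi / 2)\<^sup>2 * \<bar>c\<bar>"
proof -
  have "ground_eigenvalue a - ground_eigenvalue b = (\<Sum>e\<in>Basis. (pi / 2)\<^sup>2 * (1 / (a \<bullet> e)\<^sup>2 - 1 / (b \<bullet> e)\<^sup>2))"
    unfolding mode_eigenvalue_def sum_subtractf[symmetric]
    by (intro sum.cong refl) (simp add: power_divide power_mult_distrib right_diff_distrib)
  also have "\<dots> \<le> (\<Sum>e\<in>(Basis::'a set). (pi / 2)\<^sup>2 * (c / M\<^sup>2))"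
    by (intro sum_mono mult_left_mono assms) auto
  also have "\<dots> = DIM('a) * (pi / 2)\<^sup>2 * (c / M\<^sup>2)" by simp
  finally have "(ground_eigenvalue a - ground_eigenvalue b) * (5 * M\<^sup>2) \<le> DIM('a) * (pi / 2)\<^sup>2 * (c / M\<^sup>2) * (5 * M\<^sup>2)"
    by (intro mult_right_mono) auto
  also have "\<dots> = 5 * DIM('a) * (pi / 2)\<^sup>2 * (c / M\<^sup>2 * M\<^sup>2)" by simp
  also have "\<dots> \<le> 5 * DIM('a) * (pi / 2)\<^sup>2 * \<bar>c\<bar>"
    by (intro mult_left_mono) (auto simp: abs_ge_self)
  finally show ?thesis .
qed

lemma dir_deriv_partial:
  assumes "f differentiable (at y)"
  shows "dir_deriv f e (partial_deriv e f y) y"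
proof -
  have 1: "(f has_derivative frechet_derivative f (at y)) (at (y + 0 *\<^sub>R e))"
    using frechet_derivative_works[THEN iffD1, OF assms] by simp
  have 2: "((\<lambda>s. y + s *\<^sub>R e) has_derivative (\<lambda>s. s *\<^sub>R e)) (at 0)"
    by (auto intro!: derivative_eq_intros)
  have "((\<lambda>s. f (y + s *\<^sub>R e)) has_derivative (\<lambda>s. frechet_derivative f (at y) (s *\<^sub>R e))) (at 0)"
    using has_derivative_compose[OF 2 1] by simp
  moreover have "(\<lambda>s. frechet_derivative f (at y) (s *\<^sub>R e)) = (*) (partial_deriv e f y)"
    using linear_frechet_derivative[OF assms] by (simp add: fun_eq_iff partial_deriv_def linear_cmul mult.commute)
  ultimately show ?thesis
    unfolding has_field_derivative_def by simp
qed

lemma differentiable_at_imp_continuous_on: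
  fixes f :: "'a::euclidean_space \<Rightarrow> real"
  assumes "\<And>y. y \<in> S \<Longrightarrow> f differentiable (at y)"
  shows "continuous_on S f"
  using assms differentiable_imp_continuous_within continuous_at_imp_continuous_on by blast

lemma Ck_on_1_unfolded:
  assumes "Ck_on 1 f S"
  shows "continuous_on S f" "\<And>e. e \<in> Basis \<Longrightarrow> continuous_on S (partial_deriv e f)"
    "\<And>y e. y \<in> S \<Longrightarrow> dir_deriv f e (partial_deriv e f y) y"
  using assms by (auto intro: dir_deriv_partial differentiable_at_imp_continuous_on)

lemma Ck_on_2_unfolded:
  assumes "Ck_on 2 f S"
  shows "Ck_on 1 f S" "\<And>e. e \<in> Basis \<Longrightarrow> Ck_on 1 (partial_deriv e f) S"
  using assms by (auto simp: numeral_2_eq_2 intro: differentiable_at_imp_continuous_on)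

lemma norm_grad_diff:
  fixes f g :: "'a::euclidean_space \<Rightarrow> real"
  shows "(norm (grad f x - grad g x))\<^sup>2 = (\<Sum>e\<in>Basis. (partial_deriv e f x - partial_deriv e g x)\<^sup>2)"
proof -
  have "grad f x \<bullet> e = partial_deriv e f x" if "e \<in> Basis" for f :: "'a \<Rightarrow> real" and e
    using that by (simp add: grad_def inner_sum_left_Basis)
  then have "(grad f x - grad g x) \<bullet> e = partial_deriv e f x - partial_deriv e g x" if "e \<in> Basis" for e
    using that by (simp add: inner_diff_left)
  then show ?thesis
    by (subst power2_norm_eq_inner, subst euclidean_inner) (simp add: power2_eq_square)
qed

text \<open>The test functions that witness the Dirichlet condition serve as the approximating sequence.\<close>

lemma principal_eigenfunction_positive_eigenfunction:
  assumes U: "open U" "bounded U" "U \<noteq> {}" and \<phi>: "principal_eigenfunction U \<phi>"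
  obtains lam f where
    "positive_eigenfunction U \<phi> (\<lambda>e. partial_deriv e \<phi>) (\<lambda>e. partial_deriv e (partial_deriv e \<phi>)) f (\<lambda>k e. partial_deriv e (f k)) lam"
    "set_integrable lborel U (\<lambda>y. (\<phi> y)\<^sup>2)" "(LINT y:U|lborel. (\<phi> y)\<^sup>2) = 1"
proof -
  obtain lam where lam: "dirichlet_eigenfunction U lam \<phi>"
    and pos: "\<And>y. y \<in> U \<Longrightarrow> 0 < \<phi> y" and norm1: "(\<integral>\<^sup>+x\<in>U. ennreal ((\<phi> x)\<^sup>2) \<partial>lborel) = 1"
    using \<phi> unfolding principal_eigenfunction_def by blast
  have C2: "Ck_on 2 \<phi> U" and bc: "dirichlet_bc U \<phi>" and eq: "\<And>y. y \<in> U \<Longrightarrow> - laplacian \<phi> y = lam * \<phi> y"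
    using lam unfolding dirichlet_eigenfunction_def by blast+
  obtain f where f: "\<And>k. f k \<in> test_functions U"
    and lim: "(\<lambda>k. \<integral>\<^sup>+x\<in>U. ennreal ((f k x - \<phi> x)\<^sup>2 + (norm (grad (f k) x - grad \<phi> x))\<^sup>2) \<partial>lborel) \<longlonglongrightarrow> 0"
    using bc unfolding dirichlet_bc_def by blast
  note D1 = Ck_on_1_unfolded[OF Ck_on_2_unfolded(1)[OF C2]] and D2 = Ck_on_1_unfolded[OF Ck_on_2_unfolded(2)[OF C2]]
  have "Ck_on 1 (f k) UNIV" for k using f[of k] unfolding test_functions_def by blast
  note F = Ck_on_1_unfolded[OF this]
  have lap: "(\<Sum>e\<in>Basis. partial_deriv e (partial_deriv e \<phi>) y) = - lam * \<phi> y" if "y \<in> U" for y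
    using eq[OF that] by (simp add: laplacian_def)
  have meas: "(\<lambda>y. indicator U y *\<^sub>R (\<phi> y)\<^sup>2) \<in> borel_measurable borel"
    using U(1) by (intro borel_measurable_continuous_on_indicator continuous_intros D1) auto
  have nn: "(\<integral>\<^sup>+y. ennreal (indicator U y *\<^sub>R (\<phi> y)\<^sup>2) \<partial>lborel) = 1"
    unfolding norm1[symmetric] by (intro nn_integral_cong) (auto simp: indicator_def)
  have int: "set_integrable lborel U (\<lambda>y. (\<phi> y)\<^sup>2)"
    unfolding set_integrable_def using meas nn by (intro integrableI_nonneg AE_I2) auto
  have one: "(LINT y:U|lborel. (\<phi> y)\<^sup>2) = 1"
    unfolding set_lebesgue_integral_def using meas nn by (subst integral_eq_nn_integral) auto
  have "positive_eigenfunction U \<phi> (\<lambda>e. partial_deriv e \<phi>) (\<lambda>e. partial_deriv e (partial_deriv e \<phi>)) f (\<lambda>k e. partial_deriv e (f k)) lam"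
  proof (intro positive_eigenfunction.intro zero_trace.intro positive_eigenfunction_axioms.intro)
    show "\<exists>Z. compact Z \<and> Z \<subseteq> U \<and> (\<forall>y\<in>U - Z. f k y = 0)" for k
    proof -
      have "compact (closure {x. f k x \<noteq> 0})" "closure {x. f k x \<noteq> 0} \<subseteq> U"
        using f[of k] unfolding test_functions_def by auto
      moreover have "f k y = 0" if "y \<in> U - closure {x. f k x \<noteq> 0}" for y
        using that closure_subset[of "{x. f k x \<noteq> 0}"] by blast
      ultimately show ?thesis by blast
    qed
    show "(\<lambda>k. \<integral>\<^sup>+y\<in>U. ennreal ((f k y - \<phi> y)\<^sup>2 + (\<Sum>e\<in>Basis. (partial_deriv e (f k) y - partial_deriv e \<phi> y)\<^sup>2)) \<partial>lborel) \<longlonglongrightarrow> 0"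
      using lim unfolding norm_grad_diff .
    have "set_integrable lborel U (\<lambda>y. lam\<^sup>2 * (\<phi> y)\<^sup>2)" using int by (rule set_integrable_mult_right)
    moreover have "(\<Sum>e\<in>Basis. partial_deriv e (partial_deriv e \<phi>) y)\<^sup>2 = lam\<^sup>2 * (\<phi> y)\<^sup>2" if "y \<in> U" for y
      by (simp add: lap[OF that] power_mult_distrib)
    ultimately show "set_integrable lborel U (\<lambda>y. (\<Sum>e\<in>Basis. partial_deriv e (partial_deriv e \<phi>) y)\<^sup>2)"
      using set_integrable_cong[OF refl refl] by (metis (no_types, lifting))
    show "continuous_on U (partial_deriv e (f k))" if "e \<in> Basis" for k e
      by (rule continuous_on_subset[OF F(2)[OF that] subset_UNIV])
    show "continuous_on U (f k)" for k
      by (rule continuous_on_subset[OF F(1) subset_UNIV])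
  qed (use U D1 D2 F pos lap in auto)
  then show thesis using int one that by blast
qed

lemma Basis_cart_axis:
  assumes "e \<in> (Basis :: (real ^ 'n) set)"
  obtains i where "e = axis i 1" "\<And>x. x \<bullet> e = x $ i"
  using assms by (auto simp: Basis_vec_def inner_axis)

theorem corollary1p2:
  fixes C1 :: real
  assumes "C1 > 0"
  shows "\<exists>\<epsilon>>0. \<exists>K>0. \<forall>C2. 1 < C2 \<and> C2 < 1 + \<epsilon> \<longrightarrow>
    (\<forall>(a :: real ^ 'n) (b :: real ^ 'n) U \<phi>\<^sub>U \<phi>\<^sub>B.
       (\<forall>i. a $ i > 0) \<and> (\<forall>i. b $ i > 0) \<and> box (- a) a \<subseteq> box (- b) b \<and>
       domain U \<and> box (- a) a \<subseteq> U \<and> U \<subseteq> box (- b) b \<and>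
       (\<forall>i. 1 / (a $ i)\<^sup>2 - 1 / (b $ i)\<^sup>2 \<le> C1 / Max (range (\<lambda>j. (b $ j)\<^sup>2))) \<and>
       (\<forall>i. a $ i \<ge> 1 / C2 * b $ i) \<and>
       principal_eigenfunction U \<phi>\<^sub>U \<and> principal_eigenfunction (box (- a) a) \<phi>\<^sub>B
       \<longrightarrow> (\<forall>x. (\<forall>i. \<bar>x $ i\<bar> < a $ i - (b $ i - a $ i)) \<longrightarrow>
              \<phi>\<^sub>U x \<le> K * \<phi>\<^sub>B x \<and> \<phi>\<^sub>B x \<le> K * \<phi>\<^sub>U x))"
proof -
  define n where "n = DIM(real ^ 'n)"
  define G where "G = 5 * n * (pi / 2)\<^sup>2 * C1"
  \<comment> \<open>The upper constant, the loss in replacing the larger ground mode by the smaller, and the lower constant.\<close>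
  define K where "K = upper_const n G * pi ^ n / lower_const n G"
  have n: "1 \<le> n" unfolding n_def by (simp add: Suc_leI)
  have G: "0 \<le> G" using assms by (simp add: G_def)
  note cp = consts_pos[OF n G]
  have K: "0 < K" unfolding K_def using cp by (intro divide_pos_pos mult_pos_pos) auto
  \<comment> \<open>Symmetric in the two domains: any two principal eigenfunctions of domains between the boxes are comparable.
    Applied to \<open>U\<close> and the smaller box in both orders, this gives both inequalities.\<close>
  have main: "\<phi> x \<le> K * \<psi> x"
    if C2: "1 < C2" "C2 < 1 + layer_width n G / 4"
      and a: "\<forall>i. a $ i > 0" and b: "\<forall>i. b $ i > 0"
      and U: "domain U" "box (- a) a \<subseteq> U" "U \<subseteq> box (- b) b"
      and W: "domain W" "box (- a) a \<subseteq> W" "W \<subseteq> box (- b) b"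
      and gap: "\<forall>i. 1 / (a $ i)\<^sup>2 - 1 / (b $ i)\<^sup>2 \<le> C1 / Max (range (\<lambda>j. (b $ j)\<^sup>2))"
      and close: "\<forall>i. a $ i \<ge> 1 / C2 * b $ i"
      and \<phi>: "principal_eigenfunction U \<phi>" and \<psi>: "principal_eigenfunction W \<psi>"
      and x: "\<forall>i. \<bar>x $ i\<bar> < a $ i - (b $ i - a $ i)"
    for C2 and a b :: "real ^ 'n" and U W \<phi> \<psi> x
  proof -
    define M where "M = sqrt (Max (range (\<lambda>j. (b $ j)\<^sup>2)))"
    have sq: "(b $ i)\<^sup>2 \<le> Max (range (\<lambda>j. (b $ j)\<^sup>2))" for i by (intro Max_ge) auto
    have M2: "M\<^sup>2 = Max (range (\<lambda>j. (b $ j)\<^sup>2))"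
      unfolding M_def using sq order_trans[OF zero_le_power2] by (intro real_sqrt_pow2) blast
    have aB: "0 < a \<bullet> e" and bB: "0 < b \<bullet> e" and bM: "b \<bullet> e \<le> M"
      and gapB: "1 / (a \<bullet> e)\<^sup>2 - 1 / (b \<bullet> e)\<^sup>2 \<le> C1 / M\<^sup>2"
      and closeB: "b \<bullet> e \<le> (1 + layer_width n G / 4) * (a \<bullet> e)"
      and xB: "\<bar>x \<bullet> e\<bar> < a \<bullet> e - (b \<bullet> e - a \<bullet> e)"
      if e: "e \<in> Basis" for e
    proof -
      obtain i where i: "\<And>x. x \<bullet> e = x $ i" using Basis_cart_axis[OF e] by blast
      show "0 < a \<bullet> e" "0 < b \<bullet> e" "1 / (a \<bullet> e)\<^sup>2 - 1 / (b \<bullet> e)\<^sup>2 \<le> C1 / M\<^sup>2"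
        "\<bar>x \<bullet> e\<bar> < a \<bullet> e - (b \<bullet> e - a \<bullet> e)"
        using a b gap x by (auto simp: i M2)
      show "b \<bullet> e \<le> M" unfolding i M_def by (rule real_le_rsqrt[OF sq])
      have "b $ i \<le> C2 * a $ i" using close C2 by (auto simp: field_simps)
      also have "\<dots> \<le> (1 + layer_width n G / 4) * a $ i" using C2 a by (intro mult_right_mono) (auto intro: less_imp_le)
      finally show "b \<bullet> e \<le> (1 + layer_width n G / 4) * (a \<bullet> e)" by (simp add: i)
    qed
    have gap': "(ground_eigenvalue a - ground_eigenvalue b) * (5 * M\<^sup>2) \<le> G"
      using ground_eigenvalue_gap[OF gapB] assms by (simp add: G_def n_def)
    have open_bounded: "open S" "bounded S" "S \<noteq> {}" if "domain S" "S \<subseteq> box (- b) b" for S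
      using that unfolding domain_def by (auto intro: bounded_subset[OF bounded_box])
    have ab: "a \<bullet> e \<le> b \<bullet> e" and xa: "- (a \<bullet> e) < x \<bullet> e \<and> x \<bullet> e < a \<bullet> e" if e: "e \<in> Basis" for e
    proof -
      have "box (- a) a \<subseteq> box (- b) b" using U by blast
      then show "a \<bullet> e \<le> b \<bullet> e"
        using subset_box(4)[of "- a" a "- b" b] aB e by auto
      then show "- (a \<bullet> e) < x \<bullet> e \<and> x \<bullet> e < a \<bullet> e" using xB[OF e] by linarith
    qed
    have xa': "x \<in> box (- a) a" using xa by (auto simp: mem_box)
    define P where "P = (\<Prod>e\<in>Basis. b \<bullet> e)"
    define Q where "Q = (\<Prod>e\<in>Basis. a \<bullet> e)"
    have Q: "0 < Q" unfolding Q_def using aB by (intro prod_pos) auto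
    have QP: "Q \<le> P" unfolding P_def Q_def using aB ab by (intro prod_mono) (auto intro: less_imp_le)
    obtain lam f where L: "positive_eigenfunction U \<phi> (\<lambda>e. partial_deriv e \<phi>) (\<lambda>e. partial_deriv e (partial_deriv e \<phi>)) f (\<lambda>k e. partial_deriv e (f k)) lam"
      "set_integrable lborel U (\<lambda>y. (\<phi> y)\<^sup>2)" "(LINT y:U|lborel. (\<phi> y)\<^sup>2) = 1"
      by (rule principal_eigenfunction_positive_eigenfunction[OF open_bounded[OF U(1,3)] \<phi>])
    have "\<phi> x \<le> upper_const n G / sqrt P * ground_mode b x"
      using positive_eigenfunction.upper_bound[OF L(1) aB bB U(2,3) L(2,3) bM G gap'] xa' U(2)
      unfolding P_def n_def by blast
    also have "\<dots> \<le> upper_const n G / sqrt Q * (pi ^ n * ground_mode a x)"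
    proof (rule mult_mono)
      show "upper_const n G / sqrt P \<le> upper_const n G / sqrt Q"
        using Q QP cp(1) by (intro divide_left_mono) auto
      show "ground_mode b x \<le> pi ^ n * ground_mode a x"
        unfolding n_def by (rule ground_mode_compare[OF aB ab less_imp_le[OF xB]])
      show "0 \<le> ground_mode b x"
        using ground_mode_bounds(2)[OF bB, of x] xa' U by (force intro: less_imp_le)
    qed (use Q cp(1) in auto)
    also have "\<dots> = K * (lower_const n G / sqrt Q * ground_mode a x)"
      unfolding K_def using cp(4) by simp
    also have "\<dots> \<le> K * \<psi> x"
    proof -
      obtain lam f where L: "positive_eigenfunction W \<psi> (\<lambda>e. partial_deriv e \<psi>) (\<lambda>e. partial_deriv e (partial_deriv e \<psi>)) f (\<lambda>k e. partial_deriv e (f k)) lam"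
        "set_integrable lborel W (\<lambda>y. (\<psi> y)\<^sup>2)" "(LINT y:W|lborel. (\<psi> y)\<^sup>2) = 1"
        by (rule principal_eigenfunction_positive_eigenfunction[OF open_bounded[OF W(1,3)] \<psi>])
      have "lower_const n G / sqrt Q * ground_mode a x \<le> \<psi> x"
        using positive_eigenfunction.lower_bound[OF L(1) aB bB W(2,3) L(2,3) bM G gap'] closeB xa'
        unfolding Q_def n_def by blast
      then show ?thesis using K by (intro mult_left_mono) auto
    qed
    finally show ?thesis .
  qed
  have dom: "domain (box (- a) a)" if "\<forall>i. a $ i > 0" for a :: "real ^ 'n"
    unfolding domain_def
  proof (intro conjI)
    have "0 \<in> box (- a) a" using that by (auto simp: mem_box_cart)
    then show "box (- a) a \<noteq> {}" by blast
  qed (auto simp: open_box intro: convex_connected convex_box)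
  show ?thesis
  proof (rule exI[of _ "layer_width n G / 4"], intro conjI exI[of _ K] allI impI K)
    show "0 < layer_width n G / 4" using cp(2) by simp
  next
    fix C2 and a b :: "real ^ 'n" and U \<phi>\<^sub>U \<phi>\<^sub>B x
    assume C2: "1 < C2 \<and> C2 < 1 + layer_width n G / 4"
      and h: "(\<forall>i. a $ i > 0) \<and> (\<forall>i. b $ i > 0) \<and> box (- a) a \<subseteq> box (- b) b \<and>
       domain U \<and> box (- a) a \<subseteq> U \<and> U \<subseteq> box (- b) b \<and>
       (\<forall>i. 1 / (a $ i)\<^sup>2 - 1 / (b $ i)\<^sup>2 \<le> C1 / Max (range (\<lambda>j. (b $ j)\<^sup>2))) \<and>
       (\<forall>i. a $ i \<ge> 1 / C2 * b $ i) \<and>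
       principal_eigenfunction U \<phi>\<^sub>U \<and> principal_eigenfunction (box (- a) a) \<phi>\<^sub>B"
      and x: "\<forall>i. \<bar>x $ i\<bar> < a $ i - (b $ i - a $ i)"
    show "\<phi>\<^sub>U x \<le> K * \<phi>\<^sub>B x"
      by (rule main[where a=a and b=b and U=U and W="box (- a) a" and ?C2.0=C2]) (use C2 h x dom in auto)
    show "\<phi>\<^sub>B x \<le> K * \<phi>\<^sub>U x"
      by (rule main[where a=a and b=b and W=U and U="box (- a) a" and ?C2.0=C2]) (use C2 h x dom in auto)
  qed
qed

end
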